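(* Let $K$ be an algebraically closed field of characteristic different from $2$, $g\ge 1$ an integer, $\alpha_1,\dots,\alpha_{2g+1}$ distinct elements of $K$, $f(x)=\prod_{i=1}^{2g+1}(x-\alpha_i)$, $\mathcal{C}$ the smooth projective model of $y^2=f(x)$, and $J$ its jacobian. Let $K_0$ be a subfield of $K$ such that $f(x)\in K_0[x]$. Let properties (M3), (M2), (M) and the subvarieties $\Theta_d\subset J$ be as defined in the context. (i) Suppose that $g\ge 2$ and $J$ enjoys the property (M3). Put $d_{(4)}=[2g/4]=[g/2]$. Let $\mathfrak{a}\in J(K)$ be a torsion point that lies on $\Theta_{d_{(4)}}$. If the order of $\mathfrak{a}$ is a power of $2$, then it is either $1$ or $2$. (ii) Suppose that $g\ge 2$ and $J$ enjoys the property (M2). Put $d_{(3)}=[2g/3]$. Let $\mathfrak{b}\in J(K)$ be a torsion point of odd order that lies on $\Theta_{d_{(3)}}$. Then $\mathfrak{b}=0\in J(K)$. (iii) Suppose that $g\ge 3$ and $J$ enjoys the property (M). Put $d_{(6)}=[2g/6]=[g/3]$. Let $\mathfrak{c}\in J(K)$ be a torsion point that lies on $\Theta_{d_{(6)}}$. Then the order of $\mathfrak{c}$ is either $1$ or $2$.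
   Context: The curve $\mathcal{C}$ is a genus $g$ hyperelliptic curve with exactly one point at infinity, denoted $\infty$. A point $P\in\mathcal{C}(K)$ is identified with the linear equivalence class $\mathrm{cl}((P)-(\infty))\in J(K)$. For a positive integer $d\le g$, $\Theta_d\subset J$ is the image of the regular map $\mathcal{C}^d\to J$, $(Q_1,\dots,Q_d)\mapsto\sum_{i=1}^dQ_i$ (sum in $J$). $[\cdot]$ denotes the integer part (floor) of a real number. $\bar{K}_0$ is the algebraic closure of $K_0$ in $K$, and $\mathrm{Gal}(K_0)=\mathrm{Aut}(\bar{K}_0/K_0)$ is the absolute Galois group of $K_0$. Since $f\in K_0[x]$, $\mathcal{C}$ and $J$ are defined over $K_0$ and $\mathrm{Gal}(K_0)$ acts on $J(\bar{K}_0)$. All torsion points of $J(K)$ lie in $J(\bar{K}_0)$. The properties are: (M3) If $\mathfrak{a}\in J(\bar{K}_0)$ has finite order that is a power of $2$, then there exists $\sigma\in\mathrm{Gal}(K_0)$ such that $\sigma(\mathfrak{a})=3\mathfrak{a}$. (M2) If $\mathfrak{b}\in J(\bar{K}_0)$ has finite order that is odd, then there exists $\tau\in\mathrm{Gal}(K_0)$ such that $\tau(\mathfrak{b})=2\mathfrak{b}$. (M) If $\mathfrak{a},\mathfrak{b}\in J(\bar{K}_0)$ are points of finite order such that the order of $\mathfrak{a}$ is a power of $2$ and the order of $\mathfrak{b}$ is odd, then there exist $\sigma_1,\sigma_2\in\mathrm{Gal}(K_0)$ such that $\sigma_1(\mathfrak{a})=-\mathfrak{a}$, $\sigma_1(\mathfrak{b})=2\mathfrak{b}$,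 $\sigma_2(\mathfrak{a})=5\mathfrak{a}$, $\sigma_2(\mathfrak{b})=2\mathfrak{b}$. *)

theory Defs
  imports "HOL-Algebra.Algebra" "HOL-Algebra.Algebraic_Closure_Type"
    "HOL-Algebra.Free_Abelian_Groups" "HOL-Algebra.Multiplicative_Group"
begin

text \<open>
  Throughout, \<open>f\<close> is a squarefree polynomial of odd degree \<open>2g + 1\<close> over an algebraically closed
  field of characteristic different from 2.

  The function field \<open>K(x)[y]/(y\<^sup>2 - f)\<close> is realised inside an algebraic closure of \<open>K(x)\<close>, with
  \<open>y\<close> a fixed square root of \<open>f\<close>.
\<close>

type_synonym 'a ff = "'a poly fract alg_closure"

definition ff_const :: "'a::field \<Rightarrow> 'a ff" where
  "ff_const c = to_ac (to_fract [:c:])"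

definition ff_x :: "'a::field ff" where
  "ff_x = to_ac (to_fract [:0, 1:])"

definition ff_y :: "'a::field poly \<Rightarrow> 'a ff" where
  "ff_y f = (SOME y. y ^ 2 = to_ac (to_fract f))"

definition function_field :: "'a::field poly \<Rightarrow> 'a ff set" where
  "function_field f = {to_ac A + to_ac B * ff_y f | A B. True}"

text \<open>
  The smooth projective model of \<open>y\<^sup>2 = f(x)\<close> is glued from the affine curve \<open>y\<^sup>2 = f(x)\<close> and the
  affine curve \<open>s\<^sup>2 = t\<^bsup>2g+2\<^esup> f(1/t)\<close> along \<open>t = 1/x\<close>, \<open>s = y/x\<^bsup>g+1\<^esup>\<close>. The only point of the second
  chart that is not in the first one is \<open>(t, s) = (0, 0)\<close>, here called \<open>Infinity\<close>.
\<close>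

datatype 'a curve_point = Affine 'a 'a | Infinity

definition curve :: "'a::field poly \<Rightarrow> 'a curve_point set" where
  "curve f = {Affine a b | a b. b ^ 2 = poly f a} \<union> {Infinity}"

definition genus :: "'a::field poly \<Rightarrow> nat" where
  "genus f = (degree f - 1) div 2"

fun chart_functions :: "'a::field poly \<Rightarrow> 'a curve_point \<Rightarrow> 'a ff \<times> 'a ff" where
  "chart_functions f (Affine a b) = (ff_x, ff_y f)"
| "chart_functions f Infinity = (1 / ff_x, ff_y f / ff_x ^ (genus f + 1))"

fun chart_values :: "'a::field curve_point \<Rightarrow> 'a \<times> 'a" where
  "chart_values (Affine a b) = (a, b)"
| "chart_values Infinity = (0, 0)"

text \<open>
  A bivariate polynomial is a polynomial in the second variable whose coefficients are
  polynomials in the first one.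
\<close>

definition eval2 :: "('a::comm_ring_1 \<Rightarrow> 'b::comm_ring_1) \<Rightarrow> 'a poly poly \<Rightarrow> 'b \<times> 'b \<Rightarrow> 'b" where
  "eval2 \<phi> G = (\<lambda>(u, v). poly (map_poly (\<lambda>p. poly (map_poly \<phi> p) u) G) v)"

definition local_ring :: "'a::field poly \<Rightarrow> 'a curve_point \<Rightarrow> 'a ff set" where
  "local_ring f P =
     {eval2 ff_const G (chart_functions f P) / eval2 ff_const H (chart_functions f P) | G H.
        eval2 id H (chart_values P) \<noteq> 0}"

definition max_ideal :: "'a::field poly \<Rightarrow> 'a curve_point \<Rightarrow> 'a ff set" where
  "max_ideal f P =
     {eval2 ff_const G (chart_functions f P) / eval2 ff_const H (chart_functions f P) | G H.
        eval2 id G (chart_values P) = 0 \<and> eval2 id H (chart_values P) \<noteq> 0}"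

definition uniformizer :: "'a::field poly \<Rightarrow> 'a curve_point \<Rightarrow> 'a ff \<Rightarrow> bool" where
  "uniformizer f P t \<longleftrightarrow> max_ideal f P = (\<lambda>u. t * u) ` local_ring f P"

definition vanishing_order :: "'a::field poly \<Rightarrow> 'a curve_point \<Rightarrow> 'a ff \<Rightarrow> int" where
  "vanishing_order f P h =
     (THE n. \<exists>t u. uniformizer f P t \<and> u \<in> local_ring f P - max_ideal f P \<and> h = t powi n * u)"

text \<open>
  As \<open>K\<close> is algebraically closed, \<open>J(K)\<close> is the group of linear equivalence classes of divisors of
  degree 0. It is written multiplicatively, as a quotient group.
\<close>

definition div_degree :: "('a curve_point \<Rightarrow>\<^sub>0 int) \<Rightarrow> int" where
  "div_degree D = (\<Sum>P\<in>Poly_Mapping.keys D. Poly_Mapping.lookup D P)"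

definition Div0 :: "'a::field poly \<Rightarrow> ('a curve_point \<Rightarrow>\<^sub>0 int) monoid" where
  "Div0 f = (free_Abelian_group (curve f))
     \<lparr>carrier := {D \<in> carrier (free_Abelian_group (curve f)). div_degree D = 0}\<rparr>"

definition principal_divisors :: "'a::field poly \<Rightarrow> ('a curve_point \<Rightarrow>\<^sub>0 int) set" where
  "principal_divisors f =
     {D \<in> carrier (free_Abelian_group (curve f)).
        \<exists>h \<in> function_field f - {0}. \<forall>P \<in> curve f. Poly_Mapping.lookup D P = vanishing_order f P h}"

definition Jac :: "'a::field poly \<Rightarrow> ('a curve_point \<Rightarrow>\<^sub>0 int) set monoid" where
  "Jac f = Div0 f Mod principal_divisors f"

definition divisor_class ::
    "'a::field poly \<Rightarrow> ('a curve_point \<Rightarrow>\<^sub>0 int) \<Rightarrow> ('a curve_point \<Rightarrow>\<^sub>0 int) set" where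
  "divisor_class f D = principal_divisors f #>\<^bsub>Div0 f\<^esub> D"

definition point_class :: "'a::field poly \<Rightarrow> 'a curve_point \<Rightarrow> ('a curve_point \<Rightarrow>\<^sub>0 int) set" where
  "point_class f P = divisor_class f (frag_of P - frag_of Infinity)"

definition Theta :: "'a::field poly \<Rightarrow> nat \<Rightarrow> ('a curve_point \<Rightarrow>\<^sub>0 int) set set" where
  "Theta f d = {finprod (Jac f) (\<lambda>i. point_class f (Q i)) {1..d} | Q. \<forall>i\<in>{1..d}. Q i \<in> curve f}"

definition torsion :: "('b, 'c) monoid_scheme \<Rightarrow> 'b \<Rightarrow> bool" where
  "torsion G a \<longleftrightarrow> a \<in> carrier G \<and> (\<exists>n::nat. n > 0 \<and> a [^]\<^bsub>G\<^esub> n = \<one>\<^bsub>G\<^esub>)"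

definition closure_in :: "'a::field set \<Rightarrow> 'a set" where
  "closure_in K0 = {z. \<exists>p. p \<noteq> 0 \<and> (\<forall>i. coeff p i \<in> K0) \<and> poly p z = 0}"

text \<open>Only the restriction of \<open>\<sigma>\<close> to \<open>closure_in K0\<close> is relevant.\<close>

definition Gal :: "'a::field set \<Rightarrow> ('a \<Rightarrow> 'a) set" where
  "Gal K0 =
     {\<sigma> \<in> ring_iso (ring_of_type_algebra\<lparr>carrier := closure_in K0\<rparr>)
                    (ring_of_type_algebra\<lparr>carrier := closure_in K0\<rparr>). \<forall>c\<in>K0. \<sigma> c = c}"

definition curve_over :: "'a::field set \<Rightarrow> 'a poly \<Rightarrow> 'a curve_point set" where
  "curve_over L f = {P \<in> curve f. set_curve_point P \<subseteq> L}"

text \<open>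
  For an algebraically closed subfield \<open>L\<close> over which the curve is defined, the group \<open>J(L)\<close>, viewed
  as a subgroup of \<open>J(K)\<close>, consists of the classes of the divisors of degree 0 supported
  in \<open>L\<close>-points of the curve.
\<close>

definition Jac_over :: "'a::field set \<Rightarrow> 'a poly \<Rightarrow> ('a curve_point \<Rightarrow>\<^sub>0 int) set set" where
  "Jac_over L f =
     {divisor_class f D | D. D \<in> carrier (Div0 f) \<and> Poly_Mapping.keys D \<subseteq> curve_over L f}"

text \<open>
  The action of \<open>\<sigma>\<close> on \<open>J(L)\<close> for \<open>L = closure_in K0\<close> sends the class of a divisor \<open>D\<close> supported
  in \<open>L\<close>-points to the class of the divisor \<open>\<sigma>(D)\<close>. The latter does not depend on the choice of \<open>D\<close>,
  so the union below is over equal sets.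
\<close>

definition Gal_act :: "'a::field set \<Rightarrow> 'a poly \<Rightarrow> ('a \<Rightarrow> 'a) \<Rightarrow>
    ('a curve_point \<Rightarrow>\<^sub>0 int) set \<Rightarrow> ('a curve_point \<Rightarrow>\<^sub>0 int) set" where
  "Gal_act K0 f \<sigma> A =
     (\<Union>D \<in> {D \<in> A. Poly_Mapping.keys D \<subseteq> curve_over (closure_in K0) f}.
        divisor_class f (frag_extend (\<lambda>P. frag_of (map_curve_point \<sigma> P)) D))"

text \<open>
  \<^const>\<open>group.ord\<close> is 0 for elements of infinite order, so both \<open>ord a = 2 ^ k\<close> and
  \<open>odd (ord b)\<close> include the finiteness of the order.
\<close>

definition property_M3 :: "'a::field set \<Rightarrow> 'a poly \<Rightarrow> bool" where
  "property_M3 K0 f \<longleftrightarrow>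
     (\<forall>a \<in> Jac_over (closure_in K0) f. (\<exists>k. group.ord (Jac f) a = 2 ^ k) \<longrightarrow>
        (\<exists>\<sigma> \<in> Gal K0. Gal_act K0 f \<sigma> a = a [^]\<^bsub>Jac f\<^esub> (3::nat)))"

definition property_M2 :: "'a::field set \<Rightarrow> 'a poly \<Rightarrow> bool" where
  "property_M2 K0 f \<longleftrightarrow>
     (\<forall>b \<in> Jac_over (closure_in K0) f. odd (group.ord (Jac f) b) \<longrightarrow>
        (\<exists>\<tau> \<in> Gal K0. Gal_act K0 f \<tau> b = b [^]\<^bsub>Jac f\<^esub> (2::nat)))"

definition property_M :: "'a::field set \<Rightarrow> 'a poly \<Rightarrow> bool" where
  "property_M K0 f \<longleftrightarrow>
     (\<forall>a \<in> Jac_over (closure_in K0) f. \<forall>b \<in> Jac_over (closure_in K0) f.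
        (\<exists>k. group.ord (Jac f) a = 2 ^ k) \<longrightarrow> odd (group.ord (Jac f) b) \<longrightarrow>
        (\<exists>\<sigma>\<^sub>1 \<in> Gal K0. \<exists>\<sigma>\<^sub>2 \<in> Gal K0.
           Gal_act K0 f \<sigma>\<^sub>1 a = inv\<^bsub>Jac f\<^esub> a \<and>
           Gal_act K0 f \<sigma>\<^sub>1 b = b [^]\<^bsub>Jac f\<^esub> (2::nat) \<and>
           Gal_act K0 f \<sigma>\<^sub>2 a = a [^]\<^bsub>Jac f\<^esub> (5::nat) \<and>
           Gal_act K0 f \<sigma>\<^sub>2 b = b [^]\<^bsub>Jac f\<^esub> (2::nat)))"

end

theory Submission
  imports Defs
begin

text \<open>
  Write \<open>[M]\<close> for the class of \<open>M - deg M \<infinity>\<close>, where \<open>M\<close> is an effective divisor, and let \<open>\<iota>\<close> be the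
  hyperelliptic involution, so that \<open>- [M] = [\<iota> M]\<close>. The hypotheses provide conjugates of the given
  torsion class \<open>[M]\<close> whose sum is \<open>m [M]\<close>, with \<open>m\<close> larger than the number of conjugates: \<open>\<sigma> [M] = 3 [M]\<close>,
  \<open>\<tau> [M] = 2 [M]\<close> and \<open>\<sigma>\<^sub>1 [M] + \<sigma>\<^sub>2 [M] = 4 [M]\<close> respectively. Then the sum of the conjugates of \<open>M\<close>
  and of \<open>m \<iota> M\<close> is linearly equivalent to a multiple of \<open>\<infinity>\<close>, and its degree is at most \<open>2g\<close> by the choice
  of \<open>d\<close>. It is therefore cut out by a polynomial in \<open>x\<close> and invariant under \<open>\<iota>\<close>. Comparing multiplicities,
  all points of \<open>M\<close> are fixed by \<open>\<iota>\<close>, so \<open>2 [M] = 0\<close>.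

  The Galois group only acts on points over the algebraic closure \<open>L\<close> of \<open>K\<^sub>0\<close>. Instead of proving that
  torsion points are defined over \<open>L\<close>, we specialize: a torsion class \<open>[M]\<close> with a point of \<open>M\<close> not fixed
  by \<open>\<iota>\<close> is certified by finitely many polynomial equations and inequations over \<open>L\<close>, which by the
  Nullstellensatz have a solution in \<open>L\<close>.
\<close>

subsection \<open>Algebraically closed subfields and specialization\<close>

text \<open>The denominators 4, 3, 6 are 1 + 3, 1 + 2, 2 + 4: the number of conjugates plus m. They
  keep the degree below 2g + 1, the odd pole order of y at infinity. A conjugation is injective on
  points and commutes with the involution, so one conjugate of M cannot exceed the largest
  multiplicity of a non-fixed point of M; this is why m larger than the number of conjugates is
  contradictory.

  The obstacle is the descent to L. A specialization may shrink the order of a class and may make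
  distinct points collide. Therefore only "n kills the class" is transported (the new order divides
  n, so it stays odd or a power of 2), and the certificate is phrased through the norm p^2 - q^2 f
  and nonvanishing values, from which semireducedness is recovered after specializing.

  Vanishing orders are definite descriptions over all uniformizers, so their existence and
  uniqueness have to be established at every point. Both charts have the form v^2 = F(u), hence one
  locale serves the affine points and infinity.\<close>

definition coeffs_in :: "'a::zero set \<Rightarrow> 'a poly \<Rightarrow> bool" where
  "coeffs_in R p \<longleftrightarrow> (\<forall>i. coeff p i \<in> R)"

definition adjoin :: "'a::comm_ring_1 set \<Rightarrow> 'a \<Rightarrow> 'a set" where
  "adjoin R t = {poly p t | p. coeffs_in R p}"

locale subring_set =
  fixes R :: "'a::field set"
  assumes one_mem: "1 \<in> R"
    and diff_mem: "x \<in> R \<Longrightarrow> y \<in> R \<Longrightarrow> x - y \<in> R"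
    and mult_mem: "x \<in> R \<Longrightarrow> y \<in> R \<Longrightarrow> x * y \<in> R"
begin

lemma zero_mem: "0 \<in> R"
  using diff_mem[OF one_mem one_mem] by simp

lemma uminus_mem: "x \<in> R \<Longrightarrow> - x \<in> R"
  using diff_mem[OF zero_mem, of x] by simp

lemma add_mem: "x \<in> R \<Longrightarrow> y \<in> R \<Longrightarrow> x + y \<in> R"
  using diff_mem[of x "- y"] uminus_mem by simp

lemma power_mem: "x \<in> R \<Longrightarrow> x ^ n \<in> R"
  by (induction n) (auto intro: one_mem mult_mem)

lemma sum_mem: "(\<And>x. x \<in> A \<Longrightarrow> h x \<in> R) \<Longrightarrow> sum h A \<in> R"
  by (induction A rule: infinite_finite_induct) (auto intro: zero_mem add_mem)

lemma prod_mem: "(\<And>x. x \<in> A \<Longrightarrow> h x \<in> R) \<Longrightarrow> prod h A \<in> R"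
  by (induction A rule: infinite_finite_induct) (auto intro: one_mem mult_mem)

lemma coeffs_in_0 [simp]: "coeffs_in R 0"
  by (simp add: coeffs_in_def zero_mem)

lemma coeffs_in_pCons [simp]: "coeffs_in R (pCons c p) \<longleftrightarrow> c \<in> R \<and> coeffs_in R p"
  unfolding coeffs_in_def by (metis coeff_pCons_0 coeff_pCons_Suc nat.exhaust)

lemma coeffs_in_1 [simp]: "coeffs_in R 1"
  by (simp add: one_pCons one_mem del: pCons_one)

lemma coeffs_in_add: "coeffs_in R p \<Longrightarrow> coeffs_in R q \<Longrightarrow> coeffs_in R (p + q)"
  by (simp add: coeffs_in_def add_mem)

lemma coeffs_in_diff: "coeffs_in R p \<Longrightarrow> coeffs_in R q \<Longrightarrow> coeffs_in R (p - q)"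
  by (simp add: coeffs_in_def diff_mem)

lemma coeffs_in_mult: "coeffs_in R p \<Longrightarrow> coeffs_in R q \<Longrightarrow> coeffs_in R (p * q)"
  by (simp add: coeffs_in_def coeff_mult sum_mem mult_mem)

lemma coeffs_in_smult: "c \<in> R \<Longrightarrow> coeffs_in R q \<Longrightarrow> coeffs_in R (smult c q)"
  by (simp add: coeffs_in_def mult_mem)

lemma coeffs_in_monom: "c \<in> R \<Longrightarrow> coeffs_in R (monom c n)"
  by (simp add: coeffs_in_def zero_mem)

lemma poly_mem: "coeffs_in R p \<Longrightarrow> x \<in> R \<Longrightarrow> poly p x \<in> R"
  by (induction p) (auto intro: zero_mem add_mem mult_mem)

lemma lead_coeff_mem: "coeffs_in R p \<Longrightarrow> lead_coeff p \<in> R"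
  by (simp add: coeffs_in_def)

lemma adjoin_superset: "R \<subseteq> adjoin R t"
proof
  fix c assume "c \<in> R"
  then have "coeffs_in R [:c:]" "poly [:c:] t = c"
    by auto
  then show "c \<in> adjoin R t"
    unfolding adjoin_def by (metis (mono_tags, lifting) mem_Collect_eq)
qed

lemma adjoin_mem: "t \<in> adjoin R t"
proof -
  have "coeffs_in R [:0, 1:]" "poly [:0, 1:] t = t"
    by (auto intro: zero_mem one_mem)
  then show ?thesis
    unfolding adjoin_def by (metis (mono_tags, lifting) mem_Collect_eq)
qed

lemma adjoin_subring: "subring_set (adjoin R t)"
proof
  show "1 \<in> adjoin R t"
    using adjoin_superset one_mem by blast
next
  fix x y assume "x \<in> adjoin R t" "y \<in> adjoin R t"
  then obtain p q where "coeffs_in R p" "x = poly p t" "coeffs_in R q" "y = poly q t"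
    by (auto simp: adjoin_def)
  then have "coeffs_in R (p - q)" "coeffs_in R (p * q)" "x - y = poly (p - q) t" "x * y = poly (p * q) t"
    by (simp_all add: coeffs_in_diff coeffs_in_mult)
  then show "x - y \<in> adjoin R t" "x * y \<in> adjoin R t"
    unfolding adjoin_def by blast+
qed

text \<open>\<open>R\<close> is only a ring, so the leading coefficient of \<open>q\<close> cannot
  be inverted; each reduction step multiplies \<open>p\<close> by it instead.\<close>

lemma pseudo_division:
  assumes "coeffs_in R p" "coeffs_in R q" "q \<noteq> 0"
  shows "\<exists>k w r. coeffs_in R w \<and> coeffs_in R r \<and> smult (lead_coeff q ^ k) p = q * w + r \<and>
           (r = 0 \<or> degree r < degree q)"
  using assms(1)
\<comment> \<open>The measure ranks the zero polynomial below the nonzero constants. The degree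
  alone would not decrease when a constant is reduced to 0.\<close>
proof (induction "if p = 0 then 0 else Suc (degree p)" arbitrary: p rule: less_induct)
  case less
  show ?case
  proof (cases "p = 0 \<or> degree p < degree q")
    case True
    have "coeffs_in R (0 :: 'a poly)" by simp
    moreover have "smult (lead_coeff q ^ 0) p = q * 0 + p" by simp
    ultimately show ?thesis using True less.prems by blast
  next
    case False
    define p' where "p' = smult (lead_coeff q) p - q * monom (lead_coeff p) (degree p - degree q)"
    have cp': "coeffs_in R p'"
      unfolding p'_def using less.prems assms(2)
      by (intro coeffs_in_diff coeffs_in_smult coeffs_in_mult coeffs_in_monom lead_coeff_mem)
    have "coeff p' (degree p) = 0"
      using False by (simp add: p'_def coeff_mult_degree_sum coeff_monom_mult mult.commute[of q])
    moreover have "degree p' \<le> degree p"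
      unfolding p'_def using False
      by (intro degree_diff_le order_trans[OF degree_mult_le]) (auto simp: degree_monom_le intro: order_trans[OF add_left_mono[OF degree_monom_le]])
    ultimately have "p' = 0 \<or> degree p' < degree p"
      by (metis le_neq_implies_less leading_coeff_0_iff)
    then have "(if p' = 0 then 0 else Suc (degree p')) < (if p = 0 then 0 else Suc (degree p))"
      using False by auto
    from less.hyps[OF this cp'] obtain k w r where
      *: "coeffs_in R w" "coeffs_in R r" "smult (lead_coeff q ^ k) p' = q * w + r"
         "r = 0 \<or> degree r < degree q"
      by blast
    define w' where "w' = w + smult (lead_coeff q ^ k) (monom (lead_coeff p) (degree p - degree q))"
    have "smult (lead_coeff q ^ Suc k) p = smult (lead_coeff q ^ k)
            (p' + q * monom (lead_coeff p) (degree p - degree q))"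
      by (simp add: p'_def mult.commute)
    also have "\<dots> = q * w' + r"
      using *(3) by (simp add: w'_def smult_add_right algebra_simps)
    finally have "smult (lead_coeff q ^ Suc k) p = q * w' + r" .
    moreover have "coeffs_in R w'"
      unfolding w'_def using less.prems assms(2) *(1)
      by (intro coeffs_in_add coeffs_in_smult coeffs_in_monom lead_coeff_mem power_mem)
    ultimately show ?thesis using * by blast
  qed
qed

end

locale alg_closed_subfield = subring_set L for L :: "'a::field set" +
  assumes inverse_mem: "x \<in> L \<Longrightarrow> inverse x \<in> L"
    and root_mem: "coeffs_in L p \<Longrightarrow> degree p > 0 \<Longrightarrow> \<exists>z\<in>L. poly p z = 0"
begin

text \<open>A root of \<open>p - 1\<close> is not a root of \<open>p\<close>.\<close>

lemma exists_nonroot: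
  assumes "coeffs_in L p" "p \<noteq> 0"
  shows "\<exists>z\<in>L. poly p z \<noteq> 0"
proof (cases "degree p = 0")
  case True
  then obtain c where "p = [:c:]"
    by (rule degree_eq_zeroE)
  then show ?thesis
    using assms zero_mem by (intro bexI[of _ 0]) simp_all
next
  case False
  then have "degree (p - 1) > 0"
    using degree_add_eq_left[of "- 1" p] by simp
  moreover have "coeffs_in L (p - 1)"
    using assms by (simp add: coeffs_in_diff)
  ultimately obtain z where "z \<in> L" "poly (p - 1) z = 0"
    using root_mem by blast
  then show ?thesis by force
qed

end

text \<open>An \<open>L\<close>-algebra homomorphism from \<open>R\<close> to \<open>L\<close>, that
  is, an \<open>L\<close>-valued point of the spectrum of \<open>R\<close>. Only the values of
  \<open>\<phi>\<close> on \<open>R\<close> matter.\<close>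

locale specialization = L: alg_closed_subfield L + subring_set R for L R :: "'a::field set" +
  fixes \<phi> :: "'a \<Rightarrow> 'a"
  assumes L_subset: "L \<subseteq> R"
    and maps_to: "x \<in> R \<Longrightarrow> \<phi> x \<in> L"
    and fixes_L: "c \<in> L \<Longrightarrow> \<phi> c = c"
    and map_diff: "x \<in> R \<Longrightarrow> y \<in> R \<Longrightarrow> \<phi> (x - y) = \<phi> x - \<phi> y"
    and map_mult: "x \<in> R \<Longrightarrow> y \<in> R \<Longrightarrow> \<phi> (x * y) = \<phi> x * \<phi> y"
begin

lemma map_zero [simp]: "\<phi> 0 = 0" and map_one [simp]: "\<phi> 1 = 1"
  by (auto intro: fixes_L L.zero_mem L.one_mem)

lemma map_uminus: "x \<in> R \<Longrightarrow> \<phi> (- x) = - \<phi> x"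
  using map_diff[OF zero_mem, of x] by simp

lemma map_add: "x \<in> R \<Longrightarrow> y \<in> R \<Longrightarrow> \<phi> (x + y) = \<phi> x + \<phi> y"
  using map_diff[of x "- y"] map_uminus uminus_mem by simp

lemma map_power: "x \<in> R \<Longrightarrow> \<phi> (x ^ n) = \<phi> x ^ n"
  by (induction n) (auto simp: map_mult power_mem)

lemma map_sum: "(\<And>x. x \<in> A \<Longrightarrow> h x \<in> R) \<Longrightarrow> \<phi> (sum h A) = (\<Sum>x\<in>A. \<phi> (h x))"
  by (induction A rule: infinite_finite_induct) (auto simp: map_add sum_mem)

lemma map_prod: "(\<And>x. x \<in> A \<Longrightarrow> h x \<in> R) \<Longrightarrow> \<phi> (prod h A) = (\<Prod>x\<in>A. \<phi> (h x))"
  by (induction A rule: infinite_finite_induct) (auto simp: map_mult prod_mem)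

lemma coeffs_in_map: "coeffs_in R p \<Longrightarrow> coeffs_in L (map_poly \<phi> p)"
  by (auto simp: coeffs_in_def coeff_map_poly maps_to)

lemma map_poly_fixed: "coeffs_in L p \<Longrightarrow> map_poly \<phi> p = p"
  by (rule poly_eqI) (auto simp: coeffs_in_def coeff_map_poly fixes_L)

lemma map_poly_diff:
  "coeffs_in R p \<Longrightarrow> coeffs_in R q \<Longrightarrow> map_poly \<phi> (p - q) = map_poly \<phi> p - map_poly \<phi> q"
  by (rule poly_eqI) (auto simp: coeffs_in_def coeff_map_poly map_diff)

lemma map_poly_smult:
  "c \<in> R \<Longrightarrow> coeffs_in R q \<Longrightarrow> map_poly \<phi> (smult c q) = smult (\<phi> c) (map_poly \<phi> q)"
  by (rule poly_eqI) (auto simp: coeffs_in_def coeff_map_poly map_mult)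

lemma map_poly_mult:
  "coeffs_in R p \<Longrightarrow> coeffs_in R q \<Longrightarrow> map_poly \<phi> (p * q) = map_poly \<phi> p * map_poly \<phi> q"
  by (rule poly_eqI)
    (auto simp: coeffs_in_def coeff_map_poly coeff_mult map_sum map_mult mult_mem intro!: sum.cong)

lemma map_poly_power: "coeffs_in R p \<Longrightarrow> map_poly \<phi> (p ^ n) = map_poly \<phi> p ^ n \<and> coeffs_in R (p ^ n)"
  by (induction n) (auto simp: map_poly_mult coeffs_in_mult map_poly_1')

lemma map_poly_prod_mset:
  "(\<And>x. x \<in># M \<Longrightarrow> coeffs_in R (h x)) \<Longrightarrow>
     map_poly \<phi> (\<Prod>x\<in>#M. h x) = (\<Prod>x\<in>#M. map_poly \<phi> (h x)) \<and> coeffs_in R (\<Prod>x\<in>#M. h x)"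
  by (induction M) (auto simp: map_poly_mult coeffs_in_mult map_poly_1')

lemma map_poly_eval: "coeffs_in R p \<Longrightarrow> x \<in> R \<Longrightarrow> \<phi> (poly p x) = poly (map_poly \<phi> p) (\<phi> x)"
  by (induction p) (auto simp: map_poly_pCons map_add map_mult mult_mem poly_mem)

text \<open>The universal property of \<open>adjoin R t\<close>: sending \<open>t\<close> to
  \<open>\<xi>\<close> is consistent as soon as every relation satisfied by \<open>t\<close>
  specializes to one satisfied by \<open>\<xi>\<close>. The choice of a representing polynomial in
  \<open>\<phi>'\<close> is harmless because two choices differ by such a relation.\<close>

lemma extend_to_adjoin:
  assumes \<xi>: "\<xi> \<in> L"
    and ker: "\<And>q. coeffs_in R q \<Longrightarrow> poly q t = 0 \<Longrightarrow> poly (map_poly \<phi> q) \<xi> = 0"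
  shows "\<exists>\<phi>'. specialization L (adjoin R t) \<phi>' \<and>
           (\<forall>p. coeffs_in R p \<longrightarrow> \<phi>' (poly p t) = poly (map_poly \<phi> p) \<xi>)"
proof -
  define \<phi>' where "\<phi>' x = poly (map_poly \<phi> (SOME p. coeffs_in R p \<and> poly p t = x)) \<xi>" for x
  have \<phi>': "\<phi>' (poly p t) = poly (map_poly \<phi> p) \<xi>" if p: "coeffs_in R p" for p
  proof -
    define q where "q = (SOME q. coeffs_in R q \<and> poly q t = poly p t)"
    have q: "coeffs_in R q \<and> poly q t = poly p t"
      unfolding q_def by (rule someI[of _ p]) (simp add: p)
    then have "poly (map_poly \<phi> (q - p)) \<xi> = 0"
      using p by (intro ker) (auto simp: coeffs_in_diff)
    then show ?thesis
      using p q by (simp add: \<phi>'_def map_poly_diff flip: q_def)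
  qed
  interpret A: subring_set "adjoin R t" by (rule adjoin_subring)
  have "specialization L (adjoin R t) \<phi>'"
  proof
    show "L \<subseteq> adjoin R t"
      using L_subset adjoin_superset by blast
    show "\<phi>' x \<in> L" if "x \<in> adjoin R t" for x
      using that \<xi> by (auto simp: adjoin_def \<phi>' intro!: L.poly_mem coeffs_in_map)
    show "\<phi>' c = c" if "c \<in> L" for c
    proof -
      have c: "coeffs_in R [:c:]" using that L_subset by auto
      show ?thesis using \<phi>'[OF c] that by (simp add: map_poly_pCons fixes_L)
    qed
    fix x y assume "x \<in> adjoin R t" "y \<in> adjoin R t"
    then obtain p q where pq: "coeffs_in R p" "x = poly p t" "coeffs_in R q" "y = poly q t"
      by (auto simp: adjoin_def)
    have "\<phi>' (x - y) = \<phi>' (poly (p - q) t)" "\<phi>' (x * y) = \<phi>' (poly (p * q) t)"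
      by (simp_all add: pq)
    then show "\<phi>' (x - y) = \<phi>' x - \<phi>' y" "\<phi>' (x * y) = \<phi>' x * \<phi>' y"
      using pq \<phi>'[OF coeffs_in_diff] \<phi>'[OF coeffs_in_mult]
      by (simp_all add: \<phi>' map_poly_diff map_poly_mult del: poly_diff poly_mult)
        (simp_all add: map_poly_diff map_poly_mult)
  qed
  then show ?thesis using \<phi>' by blast
qed

end

text \<open>The form of the Nullstellensatz that can be carried through the adjunction of one
  generator at a time. \<open>R\<close> lies in a field, so it is a domain, and keeping one element
  nonzero handles finitely many at once through their product.\<close>

definition separates :: "'a::field set \<Rightarrow> 'a set \<Rightarrow> bool" where
  "separates L R \<longleftrightarrow> L \<subseteq> R \<and> subring_set R \<and>
     (\<forall>r\<in>R - {0}. \<exists>\<phi>. specialization L R \<phi> \<and> \<phi> r \<noteq> 0)"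

context alg_closed_subfield
begin

lemma separates_self: "separates L L"
proof -
  have "specialization L L (\<lambda>x. x)"
    by unfold_locales auto
  then show ?thesis
    unfolding separates_def using subring_set_axioms by fast
qed

text \<open>
  If \<open>t\<close> is algebraic over \<open>R\<close>, choose \<open>a\<close> of minimal degree with \<open>a(t) = 0\<close>; every polynomial vanishing
  at \<open>t\<close> is divisible by \<open>a\<close> up to a power of its leading coefficient, so \<open>t\<close> can be sent to any root
  of the specialization of \<open>a\<close> as long as the leading coefficient survives. A second minimality
  argument provides a nonzero multiple of \<open>s\<close> in \<open>R\<close>, which only has to survive as well.
\<close>

lemma separates_adjoin:
  assumes "separates L R"
  shows "separates L (adjoin R t)"
proof -
  interpret R: subring_set R
    using assms by (simp add: separates_def)
  have "\<exists>\<phi>. specialization L (adjoin R t) \<phi> \<and> \<phi> s \<noteq> 0" if s: "s \<in> adjoin R t" "s \<noteq> 0" for s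
  proof -
    obtain p where p: "coeffs_in R p" "s = poly p t"
      using s by (auto simp: adjoin_def)
    show ?thesis
    proof (cases "\<exists>a. a \<noteq> 0 \<and> coeffs_in R a \<and> poly a t = 0")
      \<comment> \<open>Here \<open>t\<close> is transcendental over \<open>R\<close> and may be
        sent anywhere; it suffices to avoid the roots of the specialized \<open>p\<close>, which
        stays nonzero because its leading coefficient survives.\<close>
      case False
      have "lead_coeff p \<in> R - {0}"
        using p s R.lead_coeff_mem by auto
      then obtain \<phi> where \<phi>: "specialization L R \<phi>" "\<phi> (lead_coeff p) \<noteq> 0"
        using assms unfolding separates_def by blast
      interpret specialization L R \<phi> by (rule \<phi>)
      have "coeff (map_poly \<phi> p) (degree p) \<noteq> 0"
        using \<phi>(2) by (simp add: coeff_map_poly)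
      then have "map_poly \<phi> p \<noteq> 0" by auto
      then obtain \<xi> where \<xi>: "\<xi> \<in> L" "poly (map_poly \<phi> p) \<xi> \<noteq> 0"
        using exists_nonroot[OF coeffs_in_map[OF p(1)]] by blast
      have "poly (map_poly \<phi> q) \<xi> = 0" if "coeffs_in R q" "poly q t = 0" for q
        using that False by (cases "q = 0") auto
      then obtain \<phi>' where "specialization L (adjoin R t) \<phi>'" "\<phi>' s = poly (map_poly \<phi> p) \<xi>"
        using extend_to_adjoin[OF \<xi>(1), of t] p by blast
      then show ?thesis
        using \<xi>(2) by auto
    next
      case True
      define deg where "deg = (LEAST d. \<exists>a. a \<noteq> 0 \<and> coeffs_in R a \<and> poly a t = 0 \<and> degree a = d)"
      have "\<exists>a. a \<noteq> 0 \<and> coeffs_in R a \<and> poly a t = 0 \<and> degree a = deg"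
        unfolding deg_def by (rule LeastI_ex) (use True in blast)
      then obtain a where a: "a \<noteq> 0" "coeffs_in R a" "poly a t = 0" "degree a = deg"
        by blast
      have min: "deg \<le> degree q" if "q \<noteq> 0" "coeffs_in R q" "poly q t = 0" for q
        unfolding deg_def by (rule Least_le) (use that in blast)
      have div_a: "\<exists>k w. coeffs_in R w \<and> smult (lead_coeff a ^ k) q = a * w"
        if q: "coeffs_in R q" "poly q t = 0" for q
      proof -
        obtain k w r where *: "coeffs_in R w" "coeffs_in R r"
          "smult (lead_coeff a ^ k) q = a * w + r" "r = 0 \<or> degree r < degree a"
          using R.pseudo_division[OF q(1) a(2,1)] by blast
        have "poly r t = 0"
          using arg_cong[OF *(3), of "\<lambda>p. poly p t"] a q by simp
        then have "r = 0"
          using min[of r] *(2,4) a(4) by force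
        then show ?thesis using * by auto
      qed

      \<comment> \<open>\<open>Q\<close> collects the polynomials over \<open>R\<close> whose value
        at \<open>t\<close> is a nonzero multiple of \<open>s\<close>. One of minimal degree will
        turn out to be a constant.\<close>
      define Q where "Q q \<longleftrightarrow> coeffs_in R q \<and> poly q t \<noteq> 0 \<and> (\<exists>u. coeffs_in R u \<and> poly q t = poly u t * s)" for q
      have "Q p"
        unfolding Q_def using p s by (auto intro!: exI[of _ "1 :: 'a poly"])
      define m where "m = (LEAST d. \<exists>q. Q q \<and> degree q = d)"
      have "\<exists>q. Q q \<and> degree q = m"
        unfolding m_def by (rule LeastI_ex) (use \<open>Q p\<close> in blast)
      then obtain q where q: "Q q" "degree q = m"
        by blast
      have min_q: "m \<le> degree q'" if "Q q'" for q'
        unfolding m_def by (rule Least_le) (use that in blast)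
      obtain u where u: "coeffs_in R u" "poly q t = poly u t * s"
        using q by (auto simp: Q_def)
      have "q \<noteq> 0" using q by (auto simp: Q_def)
      have "degree q < deg"
      proof (rule ccontr)
        \<comment> \<open>Reducing \<open>q\<close> modulo \<open>a\<close> multiplies its value at
          \<open>t\<close> by a power of \<open>lead_coeff a\<close> only, so the remainder would
          satisfy \<open>Q\<close> with smaller degree.\<close>
        assume "\<not> degree q < deg"
        obtain k w r where *: "coeffs_in R w" "coeffs_in R r"
          "smult (lead_coeff a ^ k) q = a * w + r" "r = 0 \<or> degree r < degree a"
          using R.pseudo_division[of q a] a q by (auto simp: Q_def)
        have r: "poly r t = lead_coeff a ^ k * poly q t"
          using arg_cong[OF *(3), of "\<lambda>p. poly p t"] a by simp
        also have "\<dots> = poly (smult (lead_coeff a ^ k) u) t * s"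
          using u by simp
        finally have "Q r"
          using r *(2) a(1,2) q(1) u(1) R.coeffs_in_smult R.power_mem R.lead_coeff_mem
          unfolding Q_def by (metis mult_eq_0_iff leading_coeff_0_iff power_not_zero)
        then have "m \<le> degree r" "r \<noteq> 0"
          using min_q by (auto simp: Q_def)
        then show False
          using *(4) a(4) q(2) \<open>\<not> degree q < deg\<close> by linarith
      qed
      \<comment> \<open>Dividing \<open>a\<close> by \<open>q\<close>, the value of the remainder at
        \<open>t\<close> is again a multiple of \<open>s\<close>; minimality of \<open>q\<close>
        makes it vanish, and minimality of \<open>a\<close> then makes the remainder itself 0. The
        quotient \<open>w\<close> kills \<open>t\<close>, and its degree would be smaller than that
        of \<open>a\<close> if \<open>q\<close> were not constant.\<close>
      have "degree q = 0"
      proof (rule ccontr)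
        assume deg_q: "degree q \<noteq> 0"
        obtain k w r where *: "coeffs_in R w" "coeffs_in R r"
          "smult (lead_coeff q ^ k) a = q * w + r" "r = 0 \<or> degree r < degree q"
          using R.pseudo_division[OF a(2) _ \<open>q \<noteq> 0\<close>] q by (auto simp: Q_def)
        have r: "poly r t = poly (0 - u * w) t * s"
          using arg_cong[OF *(3), of "\<lambda>p. poly p t"] a u by (simp add: algebra_simps eq_neg_iff_add_eq_0)
        have "poly r t = 0"
        proof (rule ccontr)
          assume "poly r t \<noteq> 0"
          moreover have "coeffs_in R (0 - u * w)"
            using u * by (intro R.coeffs_in_diff R.coeffs_in_mult) auto
          ultimately have "Q r" using *(2) r unfolding Q_def by blast
          then show False
            using min_q[of r] *(4) q(2) \<open>poly r t \<noteq> 0\<close> by auto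
        qed
        then have "r = 0"
          using min[of r] *(2,4) \<open>degree q < deg\<close> by force
        have "poly w t = 0"
          using arg_cong[OF *(3), of "\<lambda>p. poly p t"] a q \<open>r = 0\<close> by (auto simp: Q_def)
        have "w \<noteq> 0"
          using *(3) \<open>r = 0\<close> a(1) \<open>q \<noteq> 0\<close> by auto
        have "degree a = degree q + degree w"
          using *(3) \<open>r = 0\<close> \<open>w \<noteq> 0\<close> \<open>q \<noteq> 0\<close>
          by (metis add_0_right degree_mult_eq degree_smult_eq leading_coeff_0_iff power_not_zero)
        then show False
          using min[OF \<open>w \<noteq> 0\<close> *(1) \<open>poly w t = 0\<close>] deg_q a(4) by simp
      qed
      then obtain c where c: "q = [:c:]"
        by (rule degree_eq_zeroE)
      have "c \<in> R" "c \<noteq> 0"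
        using q(1) c by (auto simp: Q_def)
      \<comment> \<open>One nonvanishing condition on the product saves both the degree of
        \<open>a\<close>, hence a root \<open>\<xi>\<close>, and the constant \<open>c\<close>,
        hence \<open>s\<close>.\<close>
      then have "lead_coeff a * c \<in> R - {0}"
        using a R.lead_coeff_mem R.mult_mem by auto
      then obtain \<phi> where \<phi>: "specialization L R \<phi>" "\<phi> (lead_coeff a * c) \<noteq> 0"
        using assms unfolding separates_def by blast
      interpret specialization L R \<phi> by (rule \<phi>)
      have \<phi>_ne: "\<phi> (lead_coeff a) \<noteq> 0" "\<phi> c \<noteq> 0"
        using \<phi>(2) map_mult[OF R.lead_coeff_mem[OF a(2)] \<open>c \<in> R\<close>] by auto
      have "degree a > 0"
      proof (rule ccontr)
        assume "\<not> degree a > 0"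
        then show False using a(1,3) by (auto elim!: degree_eq_zeroE)
      qed
      moreover have "degree (map_poly \<phi> a) \<ge> degree a"
        using \<phi>_ne by (intro le_degree) (simp add: coeff_map_poly)
      ultimately obtain \<xi> where \<xi>: "\<xi> \<in> L" "poly (map_poly \<phi> a) \<xi> = 0"
        using root_mem[OF coeffs_in_map[OF a(2)]] by auto
      have "poly (map_poly \<phi> q') \<xi> = 0" if q': "coeffs_in R q'" "poly q' t = 0" for q'
      proof -
        obtain k w where kw: "coeffs_in R w" "smult (lead_coeff a ^ k) q' = a * w"
          using div_a[OF q'] by blast
        have "smult (\<phi> (lead_coeff a) ^ k) (map_poly \<phi> q') = map_poly \<phi> a * map_poly \<phi> w"
          using arg_cong[OF kw(2), of "map_poly \<phi>"] q' a(2) kw(1)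
          by (simp add: map_poly_smult map_poly_mult map_power R.power_mem R.lead_coeff_mem)
        from arg_cong[OF this, of "\<lambda>p. poly p \<xi>"] show ?thesis
          using \<xi> \<phi>_ne by simp
      qed
      then obtain \<phi>' where \<phi>': "specialization L (adjoin R t) \<phi>'"
        "\<And>p. coeffs_in R p \<Longrightarrow> \<phi>' (poly p t) = poly (map_poly \<phi> p) \<xi>"
        using extend_to_adjoin[OF \<xi>(1), of t] by blast
      interpret \<phi>': specialization L "adjoin R t" \<phi>' by (rule \<phi>')
      have "poly u t \<in> adjoin R t"
        using u by (auto simp: adjoin_def)
      then have "\<phi>' (poly u t) * \<phi>' s = \<phi>' (poly q t)"
        using \<phi>'.map_mult[OF _ s(1)] u(2) by simp
      also have "\<dots> = \<phi> c"
        using \<phi>'(2)[of q] c \<open>c \<in> R\<close> by (simp add: map_poly_pCons)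
      finally have "\<phi>' s \<noteq> 0"
        using \<phi>_ne(2) by auto
      then show ?thesis
        using \<phi>'(1) by blast
    qed
  qed
  then show ?thesis
    using subset_trans[OF _ R.adjoin_superset] R.adjoin_subring[of t] assms
    by (simp add: separates_def del: Diff_iff) blast
qed

lemma exists_specialization:
  assumes "finite E"
  shows "\<exists>R \<phi>. specialization L R \<phi> \<and> E \<subseteq> R \<and> (\<forall>e\<in>E. e \<noteq> 0 \<longrightarrow> \<phi> e \<noteq> 0)"
proof -
  have "\<exists>R. separates L R \<and> E \<subseteq> R"
    using assms
  proof induction
    case empty
    then show ?case using separates_self by blast
  next
    case (insert t E)
    then obtain R where R: "separates L R" "E \<subseteq> R" by blast
    then interpret subring_set R by (simp add: separates_def)
    show ?case
      using separates_adjoin[OF R(1)] R(2) adjoin_mem adjoin_superset by blast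
  qed
  then obtain R where R: "separates L R" "E \<subseteq> R" by blast
  then interpret R: subring_set R by (simp add: separates_def)
  \<comment> \<open>The product turns finitely many nonvanishing conditions into a single
    one.\<close>
  have "\<Prod>(E - {0}) \<in> R - {0}"
    using R assms by (auto intro!: R.prod_mem)
  then obtain \<phi> where \<phi>: "specialization L R \<phi>" "\<phi> (\<Prod>(E - {0})) \<noteq> 0"
    using R unfolding separates_def by blast
  interpret specialization L R \<phi> by (rule \<phi>)
  have "\<phi> (\<Prod>(E - {0})) = (\<Prod>e\<in>E - {0}. \<phi> e)"
    using R(2) by (intro map_prod) auto
  then have "\<forall>e\<in>E. e \<noteq> 0 \<longrightarrow> \<phi> e \<noteq> 0"
    using \<phi>(2) assms by auto
  then show ?thesis using \<phi>(1) R(2) by blast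
qed

end

section \<open>The algebraic closure of \<open>K0\<close> inside the field\<close>

context
  fixes R :: "'a::field ring"
  defines "R \<equiv> ring_of_type_algebra"
begin

interpretation R: field R
  unfolding R_def by (rule field_from_type_algebra)

lemma ring_of_type_algebra_simps:
  "carrier R = UNIV" "x \<otimes>\<^bsub>R\<^esub> y = x * y" "x \<oplus>\<^bsub>R\<^esub> y = x + y" "\<zero>\<^bsub>R\<^esub> = 0" "\<one>\<^bsub>R\<^esub> = 1"
  by (simp_all add: R_def ring_of_type_algebra_def)

lemma ring_of_type_algebra_pow: "x [^]\<^bsub>R\<^esub> (n::nat) = x ^ n"
  by (induction n) (auto simp: ring_of_type_algebra_simps mult.commute)

lemma ring_of_type_algebra_uminus: "\<ominus>\<^bsub>R\<^esub> x = - x"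
  by (rule R.add.inv_equality) (auto simp: ring_of_type_algebra_simps)

lemma ring_of_type_algebra_eval: "R.eval xs x = poly (Poly (rev xs)) x"
  by (induction xs)
    (auto simp: ring_of_type_algebra_simps ring_of_type_algebra_pow Poly_append poly_monom algebra_simps)

text \<open>Gives access to the theory of finite extensions. Polynomials there are coefficient lists
  with the leading coefficient first, hence the reversals.\<close>

lemma closure_in_iff_algebraic:
  assumes "subfield K0 R"
  shows "z \<in> closure_in K0 \<longleftrightarrow> (R.algebraic over K0) z"
proof
  assume "z \<in> closure_in K0"
  then obtain p where p: "p \<noteq> 0" "\<And>i. coeff p i \<in> K0" "poly p z = 0"
    by (auto simp: closure_in_def)
  have "rev (coeffs p) \<in> carrier (K0[X]\<^bsub>R\<^esub>)"
    using p by (auto simp: univ_poly_def polynomial_def ring_of_type_algebra_simps hd_rev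
        last_coeffs_eq_coeff_degree coeffs_def)
  then show "(R.algebraic over K0) z"
    using p by (intro R.algebraicI[of "rev (coeffs p)"]) 
      (auto simp: ring_of_type_algebra_eval ring_of_type_algebra_simps)
next
  assume "(R.algebraic over K0) z"
  then obtain p where p: "p \<in> carrier (K0[X]\<^bsub>R\<^esub>)" "p \<noteq> []" "R.eval p z = \<zero>\<^bsub>R\<^esub>"
    using R.algebraicE[OF subfieldE(1)[OF assms]] ring_of_type_algebra_simps(1) by blast
  have "0 \<in> K0"
    using subringE(2)[OF subfieldE(1)[OF assms]] by (simp add: ring_of_type_algebra_simps)
  have "set p \<subseteq> K0" "hd p \<noteq> 0"
    using p by (auto simp: univ_poly_def polynomial_def ring_of_type_algebra_simps)
  have "coeff (Poly (rev p)) i \<in> K0" for i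
    using \<open>set p \<subseteq> K0\<close> \<open>0 \<in> K0\<close> nth_mem[of i "rev p"] by (auto simp: nth_default_def)
  moreover have "Poly (rev p) \<noteq> 0"
  proof
    assume "Poly (rev p) = 0"
    then have "coeff (Poly (rev p)) (length p - 1) = 0" by simp
    then show False
      using p(2) \<open>hd p \<noteq> 0\<close> by (simp add: nth_default_def rev_nth hd_conv_nth)
  qed
  ultimately show "z \<in> closure_in K0"
    using p(3) by (auto simp: closure_in_def ring_of_type_algebra_eval ring_of_type_algebra_simps)
qed

lemma closure_in_superset:
  assumes "subfield K0 R"
  shows "K0 \<subseteq> closure_in K0"
  using R.algebraic_self[OF subfieldE(1)[OF assms]] closure_in_iff_algebraic[OF assms] by blast

text \<open>The coefficients of \<open>p\<close> generate a finite extension \<open>F\<close> of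
  \<open>K0\<close>, and \<open>z\<close> is algebraic over \<open>F\<close>; by the tower law
  \<open>F(z)\<close> is finite over \<open>K0\<close>.\<close>

lemma closure_in_root:
  assumes "subfield K0 R" "coeffs_in (closure_in K0) p" "p \<noteq> 0" "poly p z = 0"
  shows "z \<in> closure_in K0"
proof -
  define F where "F = R.finite_extension K0 (coeffs p)"
  have set_p: "\<And>x. x \<in> set (coeffs p) \<Longrightarrow> (R.algebraic over K0) x" "set (coeffs p) \<subseteq> carrier R"
    using assms(2) closure_in_iff_algebraic[OF assms(1)]
    by (auto simp: coeffs_in_def coeffs_def ring_of_type_algebra_simps split: if_splits)
  have F: "subfield F R" "R.finite_dimension K0 F"
    using R.finite_extension_is_subfield[OF assms(1) set_p(2,1)]
      R.finite_extension_finite_dimension(1)[OF assms(1) set_p(2,1)] by (simp_all add: F_def)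
  have "set (coeffs p) \<subseteq> F"
    unfolding F_def using set_p assms(1) by (intro R.finite_extension_mem subfieldE(1))
  moreover have "0 \<in> F"
    using subringE(2)[OF subfieldE(1)[OF F(1)]] by (simp add: ring_of_type_algebra_simps)
  ultimately have "coeff p i \<in> F" for i
    by (cases "i \<le> degree p") (auto simp: coeffs_def coeff_eq_0 \<open>p \<noteq> 0\<close> image_subset_iff)
  then have "z \<in> closure_in F"
    using assms(3,4) by (auto simp: closure_in_def)
  then have z: "(R.algebraic over F) z"
    using closure_in_iff_algebraic[OF F(1)] by blast
  have "R.finite_dimension K0 (R.simple_extension F z)"
    using R.telescopic_base_dim(1)[OF assms(1) F] R.finite_dimension_simple_extension[OF F(1)] z
    by (simp add: ring_of_type_algebra_simps)
  moreover have "z \<in> R.simple_extension F z" "subring (R.simple_extension F z) R"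
    using R.simple_extension_mem R.simple_extension_is_subring subfieldE(1)[OF F(1)]
    by (auto simp: ring_of_type_algebra_simps)
  ultimately show ?thesis
    using R.finite_dimension_imp_algebraic[OF assms(1)] closure_in_iff_algebraic[OF assms(1)] by blast
qed

end

lemma alg_closed_subfield_closure_in:
  fixes K0 :: "'a::alg_closed_field set"
  assumes "subfield K0 ring_of_type_algebra"
  shows "alg_closed_subfield (closure_in K0)"
proof -
  interpret R: field "ring_of_type_algebra :: 'a ring"
    by (rule field_from_type_algebra)
  have eq: "closure_in K0 = {x \<in> carrier ring_of_type_algebra. (R.algebraic over K0) x}"
    using closure_in_iff_algebraic[OF assms] by (auto simp: ring_of_type_algebra_simps)
  have L: "subfield (closure_in K0) ring_of_type_algebra"
    unfolding eq by (rule R.subfield_of_algebraics[OF assms])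
  note sr = subringE[OF subfieldE(1)[OF L]]
  show ?thesis
  proof
    show "1 \<in> closure_in K0"
      using sr(3) by (simp add: ring_of_type_algebra_simps)
    fix x y assume xy: "x \<in> closure_in K0" "y \<in> closure_in K0"
    have "x + (- y) \<in> closure_in K0"
      using sr(7)[OF xy(1) sr(5)[OF xy(2)]] 
      by (simp add: ring_of_type_algebra_simps ring_of_type_algebra_uminus)
    then show "x - y \<in> closure_in K0" by simp
    show "x * y \<in> closure_in K0"
      using sr(6)[OF xy] by (simp add: ring_of_type_algebra_simps)
  next
    fix x assume "x \<in> closure_in K0"
    then show "inverse x \<in> closure_in K0"
    proof (cases "x = 0")
      case False
      then have x: "x \<in> closure_in K0 - {\<zero>\<^bsub>ring_of_type_algebra\<^esub>}"
        using \<open>x \<in> closure_in K0\<close> by (simp add: ring_of_type_algebra_simps)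
      have "x * inv\<^bsub>ring_of_type_algebra\<^esub> x = 1"
        using R.subfield_m_inv(2)[OF L x] by (simp add: ring_of_type_algebra_simps)
      then show ?thesis
        using R.subfield_m_inv(1)[OF L x] inverse_unique by fastforce
    qed simp
  next
    fix p :: "'a poly" assume p: "coeffs_in (closure_in K0) p" "degree p > 0"
    then obtain z where "poly p z = 0"
      using alg_closed_imp_poly_has_root by blast
    then show "\<exists>z\<in>closure_in K0. poly p z = 0"
      using closure_in_root[OF assms p(1)] p(2) by force
  qed
qed

subsection \<open>Local rings of plane curves \<open>v\<^sup>2 = F(u)\<close>\<close>

text \<open>
  The map \<open>\<psi>\<close> is the evaluation of polynomials at the coordinate function \<open>u\<close>.
\<close>

locale chart =
  fixes \<psi> :: "'a::field poly \<Rightarrow> 'b::field" and v :: 'b and F :: "'a poly"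
  assumes \<psi>_1 [simp]: "\<psi> 1 = 1"
    and \<psi>_add [simp]: "\<psi> (p + q) = \<psi> p + \<psi> q"
    and \<psi>_mult [simp]: "\<psi> (p * q) = \<psi> p * \<psi> q"
    and independent: "\<psi> p + \<psi> q * v = 0 \<Longrightarrow> p = 0 \<and> q = 0"
    and square: "v ^ 2 = \<psi> F"
    and two_neq_0: "(2 :: 'a) \<noteq> 0"
begin

definition lin :: "'a poly \<Rightarrow> 'a poly \<Rightarrow> 'b" where
  "lin p q = \<psi> p + \<psi> q * v"

definition ev :: "'a \<Rightarrow> 'a \<Rightarrow> 'a poly \<Rightarrow> 'a poly \<Rightarrow> 'a" where
  "ev a b p q = poly p a + poly q a * b"

definition regular_at :: "'a \<Rightarrow> 'a \<Rightarrow> 'b set" where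
  "regular_at a b = {lin p q / lin r s | p q r s. ev a b r s \<noteq> 0}"

definition vanishing_at :: "'a \<Rightarrow> 'a \<Rightarrow> 'b set" where
  "vanishing_at a b = {lin p q / lin r s | p q r s. ev a b p q = 0 \<and> ev a b r s \<noteq> 0}"

definition unit_at :: "'a \<Rightarrow> 'a \<Rightarrow> 'b \<Rightarrow> bool" where
  "unit_at a b u \<longleftrightarrow> (\<exists>p q r s. u = lin p q / lin r s \<and> ev a b p q \<noteq> 0 \<and> ev a b r s \<noteq> 0)"

text \<open>A uniformizer at \<open>(a, b)\<close>. Where \<open>b = 0\<close> the projection to the
  \<open>u\<close>-line ramifies: \<open>u - a\<close> has a double zero there and \<open>v\<close>
  a simple one.\<close>

definition param :: "'a \<Rightarrow> 'a \<Rightarrow> 'b" where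
  "param a b = (if b = 0 then v else \<psi> [:- a, 1:])"

text \<open>The Jacobian criterion for \<open>v^2 = F(u)\<close>: as 2 is invertible, singularities
  occur only at \<open>b = 0\<close> over a multiple root of \<open>F\<close>.\<close>

definition smooth_point :: "'a \<Rightarrow> 'a \<Rightarrow> bool" where
  "smooth_point a b \<longleftrightarrow> b ^ 2 = poly F a \<and>
     (b = 0 \<longrightarrow> (\<exists>F1. F = [:- a, 1:] * F1 \<and> poly F1 a \<noteq> 0))"

lemma \<psi>_0 [simp]: "\<psi> 0 = 0"
  by (metis \<psi>_add add_0 add_cancel_right_right)

lemma \<psi>_uminus [simp]: "\<psi> (- p) = - \<psi> p"
  using \<psi>_add[of p "- p"] by (simp add: eq_neg_iff_add_eq_0 add.commute)

lemma \<psi>_diff [simp]: "\<psi> (p - q) = \<psi> p - \<psi> q"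
  using \<psi>_add[of p "- q"] by simp

lemma \<psi>_power [simp]: "\<psi> (p ^ n) = \<psi> p ^ n"
  by (induction n) auto

lemma lin_0_right [simp]: "lin p 0 = \<psi> p"
  by (simp add: lin_def)

lemma lin_0_1 [simp]: "lin 0 1 = v"
  by (simp add: lin_def)

lemma lin_eq_0_iff [simp]: "lin p q = 0 \<longleftrightarrow> p = 0 \<and> q = 0"
  using independent by (auto simp: lin_def)

lemma lin_eq_iff: "lin p q = lin r s \<longleftrightarrow> p = r \<and> q = s"
proof
  assume "lin p q = lin r s"
  then have "lin (p - r) (q - s) = 0" by (simp add: lin_def algebra_simps)
  then show "p = r \<and> q = s" by simp
qed simp

lemma \<psi>_eq_0_iff [simp]: "\<psi> p = 0 \<longleftrightarrow> p = 0"
  using lin_eq_0_iff[of p 0] by simp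

lemma v_neq_0 [simp]: "v \<noteq> 0"
  using lin_eq_0_iff[of 0 1] by (simp del: lin_eq_0_iff)

lemma lin_mult: "lin p q * lin r s = lin (p * r + q * s * F) (p * s + q * r)"
  by (simp add: lin_def algebra_simps power2_eq_square flip: square)

lemma lin_conj: "lin p q * lin p (- q) = \<psi> (p ^ 2 - q ^ 2 * F)"
  by (simp add: lin_mult power2_eq_square algebra_simps)

text \<open>The automorphism \<open>v \<mapsto> -v\<close>, expressed on identities between products
  so that it can be applied to fractions after clearing denominators.\<close>

lemma lin_conj_eq:
  assumes "lin p q * lin r s = lin p' q' * lin r' s'"
  shows "lin p (- q) * lin r (- s) = lin p' (- q') * lin r' (- s')"
  using assms by (simp add: lin_mult lin_eq_iff algebra_simps)

lemma unit_at_neq_0: "unit_at a b u \<Longrightarrow> u \<noteq> 0"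
  by (auto simp: unit_at_def ev_def)

lemma param_neq_0 [simp]: "param a b \<noteq> 0"
  by (simp add: param_def)

lemma unit_at_lin: "ev a b p q \<noteq> 0 \<Longrightarrow> unit_at a b (lin p q)"
  unfolding unit_at_def
  by (rule exI[of _ p], rule exI[of _ q], rule exI[of _ 1], rule exI[of _ 0]) (simp add: ev_def)

lemma unit_at_inverse: "unit_at a b u \<Longrightarrow> unit_at a b (inverse u)"
  unfolding unit_at_def by (metis inverse_divide)

lemma unit_at_uminus: "unit_at a b u \<Longrightarrow> unit_at a b (- u)"
proof -
  assume "unit_at a b u"
  then obtain p q r s where u: "u = lin p q / lin r s" "ev a b p q \<noteq> 0" "ev a b r s \<noteq> 0"
    by (auto simp: unit_at_def)
  have "lin (- p) (- q) = - lin p q" "ev a b (- p) (- q) = - ev a b p q"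
    by (simp_all add: lin_def ev_def)
  then show "unit_at a b (- u)"
    using u unfolding unit_at_def by (metis minus_divide_left neg_equal_0_iff_equal)
qed

lemma regular_at_lin: "lin p q \<in> regular_at a b"
proof -
  have "lin p q = lin p q / lin 1 0" "ev a b 1 0 \<noteq> 0" by (simp_all add: ev_def)
  then show ?thesis unfolding regular_at_def by blast
qed

lemma vanishing_at_lin: "ev a b p q = 0 \<Longrightarrow> lin p q \<in> vanishing_at a b"
proof -
  assume "ev a b p q = 0"
  moreover have "lin p q = lin p q / lin 1 0" "ev a b 1 0 \<noteq> 0" by (simp_all add: ev_def)
  ultimately show ?thesis unfolding vanishing_at_def by blast
qed

lemma vanishing_subset_regular: "vanishing_at a b \<subseteq> regular_at a b"
  by (auto simp: vanishing_at_def regular_at_def)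

lemma unit_at_regular: "unit_at a b u \<Longrightarrow> u \<in> regular_at a b"
  by (auto simp: unit_at_def regular_at_def)

lemma regular_at_cases: "h \<in> regular_at a b \<Longrightarrow> unit_at a b h \<or> h \<in> vanishing_at a b"
  unfolding unit_at_def regular_at_def vanishing_at_def by blast

context
  fixes a b
  assumes smooth: "smooth_point a b"
begin

lemma ev_mult: "ev a b p q * ev a b r s = ev a b (p * r + q * s * F) (p * s + q * r)"
proof -
  have "b * b = poly F a"
    using smooth by (simp add: smooth_point_def power2_eq_square)
  moreover have "ev a b p q * ev a b r s =
      poly p a * poly r a + poly q a * poly s a * (b * b) + (poly p a * poly s a + poly q a * poly r a) * b"
    by (simp add: ev_def algebra_simps)
  ultimately show ?thesis by (simp add: ev_def)
qed

text \<open>Evaluation at a point of the curve is well defined on the coordinate ring; this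
  separates units from the maximal ideal.\<close>

lemma ev_cong:
  assumes "lin p q * lin r s = lin p' q' * lin r' s'"
  shows "ev a b p q * ev a b r s = ev a b p' q' * ev a b r' s'"
  using assms by (simp add: lin_mult lin_eq_iff ev_mult)

lemma lin_divide_mult:
  "lin p q / lin r s * (lin p' q' / lin r' s') =
     lin (p * p' + q * q' * F) (p * q' + q * p') / lin (r * r' + s * s' * F) (r * s' + s * r')"
  by (simp add: lin_mult)

lemma unit_at_mult: "unit_at a b u \<Longrightarrow> unit_at a b w \<Longrightarrow> unit_at a b (u * w)"
  unfolding unit_at_def by (metis lin_divide_mult ev_mult mult_eq_0_iff)

lemma regular_at_mult:
  assumes "h \<in> regular_at a b" "k \<in> regular_at a b"
  shows "h * k \<in> regular_at a b"
proof -
  obtain p q r s p' q' r' s' where "h = lin p q / lin r s" "ev a b r s \<noteq> 0"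
      "k = lin p' q' / lin r' s'" "ev a b r' s' \<noteq> 0"
    using assms by (auto simp: regular_at_def)
  then have "h * k = lin (p * p' + q * q' * F) (p * q' + q * p') / lin (r * r' + s * s' * F) (r * s' + s * r')"
    "ev a b (r * r' + s * s' * F) (r * s' + s * r') \<noteq> 0"
    by (simp_all only: lin_divide_mult flip: ev_mult) simp_all
  then show ?thesis unfolding regular_at_def by blast
qed

lemma vanishing_at_mult:
  assumes "h \<in> vanishing_at a b" "k \<in> regular_at a b"
  shows "h * k \<in> vanishing_at a b"
proof -
  obtain p q r s p' q' r' s' where "h = lin p q / lin r s" "ev a b p q = 0" "ev a b r s \<noteq> 0"
      "k = lin p' q' / lin r' s'" "ev a b r' s' \<noteq> 0"
    using assms by (auto simp: regular_at_def vanishing_at_def)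
  then have "h * k = lin (p * p' + q * q' * F) (p * q' + q * p') / lin (r * r' + s * s' * F) (r * s' + s * r')"
    "ev a b (p * p' + q * q' * F) (p * q' + q * p') = 0"
    "ev a b (r * r' + s * s' * F) (r * s' + s * r') \<noteq> 0"
    by (simp_all only: lin_divide_mult flip: ev_mult) simp_all
  then show ?thesis unfolding vanishing_at_def by blast
qed

lemma regular_at_add:
  assumes "h \<in> regular_at a b" "k \<in> regular_at a b"
  shows "h + k \<in> regular_at a b"
proof -
  obtain p q r s p' q' r' s' where hk: "h = lin p q / lin r s" "ev a b r s \<noteq> 0"
      "k = lin p' q' / lin r' s'" "ev a b r' s' \<noteq> 0"
    using assms by (auto simp: regular_at_def)
  then have "lin r s \<noteq> 0" "lin r' s' \<noteq> 0"
    by (auto simp: ev_def)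
  then have "h + k = (lin p q * lin r' s' + lin p' q' * lin r s) / (lin r s * lin r' s')"
    using hk by (simp add: add_frac_eq del: lin_eq_0_iff)
  also have "\<dots> = lin (p * r' + q * s' * F + (p' * r + q' * s * F)) (p * s' + q * r' + (p' * s + q' * r)) /
      lin (r * r' + s * s' * F) (r * s' + s * r')"
    unfolding lin_mult by (simp add: lin_def algebra_simps)
  finally show ?thesis
    using hk ev_mult[of r s r' s'] unfolding regular_at_def by force
qed

lemma unit_not_vanishing: "unit_at a b u \<Longrightarrow> u \<notin> vanishing_at a b"
proof
  assume "unit_at a b u" "u \<in> vanishing_at a b"
  then obtain p q r s p' q' r' s' where *: "u = lin p q / lin r s" "ev a b p q \<noteq> 0" "ev a b r s \<noteq> 0"
      "u = lin p' q' / lin r' s'" "ev a b p' q' = 0" "ev a b r' s' \<noteq> 0"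
    unfolding unit_at_def vanishing_at_def by blast
  then have "lin r s \<noteq> 0" "lin r' s' \<noteq> 0"
    by (auto simp: ev_def)
  then have "lin p q * lin r' s' = lin p' q' * lin r s"
    using * by (simp add: frac_eq_eq del: lin_eq_0_iff)
  from ev_cong[OF this] show False
    using * by simp
qed

lemma unit_at_iff: "unit_at a b u \<longleftrightarrow> u \<in> regular_at a b - vanishing_at a b"
  using unit_not_vanishing unit_at_regular regular_at_cases by blast

text \<open>Induction on the order at \<open>a\<close> of the norm \<open>p^2 - q^2 F\<close>: a
  function that vanishes at the point is either related to its norm by a unit or divisible by
  \<open>param\<close> with a quotient of smaller norm order.\<close>

lemma lin_order_exists:
  "lin p q \<noteq> 0 \<Longrightarrow> \<exists>n u. unit_at a b u \<and> lin p q = param a b ^ n * u"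
proof (induction "order a (p ^ 2 - q ^ 2 * F)" arbitrary: p q rule: less_induct)
  case less
  define N where "N = p ^ 2 - q ^ 2 * F"
  have "\<psi> N \<noteq> 0"
    using less.prems unfolding N_def lin_conj[symmetric] by simp
  then have "N \<noteq> 0" by auto
  consider "ev a b p q \<noteq> 0" | "ev a b p q = 0" "b \<noteq> 0" "ev a b p (- q) \<noteq> 0"
    | "ev a b p q = 0" "b \<noteq> 0" "ev a b p (- q) = 0" | "ev a b p q = 0" "b = 0"
    by blast
  then show ?case
  proof cases
    case 1
    then show ?thesis
      using unit_at_lin by (intro exI[of _ 0] exI[of _ "lin p q"]) simp
  next
    \<comment> \<open>The conjugate factor is a unit at \<open>(a, b)\<close>, so the function has
      there the same order as its norm, a polynomial in \<open>u\<close>.\<close>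
    case 2
    obtain N' where N': "N = [:- a, 1:] ^ order a N * N'" "poly N' a \<noteq> 0"
      using order_decomp[OF \<open>N \<noteq> 0\<close>, of a] by (auto simp: poly_eq_0_iff_dvd)
    have "unit_at a b (\<psi> N' * inverse (lin p (- q)))"
      using 2 N'(2) unit_at_lin[of a b N' 0]
      by (intro unit_at_mult unit_at_inverse unit_at_lin) (auto simp: ev_def)
    moreover have "lin p q = \<psi> N * inverse (lin p (- q))"
      using less.prems unfolding N_def lin_conj[symmetric] by simp
    then have "lin p q = param a b ^ order a N * (\<psi> N' * inverse (lin p (- q)))"
      by (subst (asm) N'(1)) (use 2 in \<open>simp add: param_def\<close>)
    ultimately show ?thesis by blast
  next
    \<comment> \<open>Vanishing at both points over \<open>a\<close> forces \<open>p\<close> and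
      \<open>q\<close> to vanish at \<open>a\<close>; removing \<open>u - a\<close> from both lowers
      the norm order by 2.\<close>
    case 3
    then have "2 * poly p a = 0" "2 * b * poly q a = 0"
      by (simp_all add: ev_def algebra_simps)
    then have "poly p a = 0" "poly q a = 0"
      using two_neq_0 3 by auto
    then obtain p1 q1 where pq: "p = [:- a, 1:] * p1" "q = [:- a, 1:] * q1"
      by (auto simp: poly_eq_0_iff_dvd elim!: dvdE)
    have N: "N = [:- a, 1:] ^ 2 * (p1 ^ 2 - q1 ^ 2 * F)"
      unfolding N_def pq by (simp only: power_mult_distrib right_diff_distrib mult.assoc)
    have "order a N = 2 + order a (p1 ^ 2 - q1 ^ 2 * F)"
      using \<open>N \<noteq> 0\<close> unfolding N
      by (subst order_mult) (auto simp: order_power_n_n simp del: power2_eq_square)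
    moreover have lin: "lin p q = \<psi> [:- a, 1:] * lin p1 q1"
      by (simp only: pq lin_def \<psi>_mult distrib_left mult.assoc)
    ultimately obtain n u where "unit_at a b u" "lin p1 q1 = param a b ^ n * u"
      using less.hyps[of p1 q1] less.prems by (auto simp: N_def)
    then show ?thesis
      using 3 lin by (intro exI[of _ "Suc n"] exI[of _ u]) (simp add: param_def)
  next
    \<comment> \<open>With \<open>F = (u - a) F1\<close> one has \<open>u - a = v^2 / F1\<close>, so
      a factor \<open>v\<close> can be taken out: \<open>F1 (p + q v) = v (q F1 + p1 v)\<close>
      where \<open>p = (u - a) p1\<close>.\<close>
    case 4
    then have "poly p a = 0" by (simp add: ev_def)
    then obtain p1 where p: "p = [:- a, 1:] * p1"
      by (auto simp: poly_eq_0_iff_dvd elim!: dvdE)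
    obtain F1 where F1: "F = [:- a, 1:] * F1" "poly F1 a \<noteq> 0"
      using smooth 4 by (auto simp: smooth_point_def)
    then have "F1 \<noteq> 0" by auto
    define N' where "N' = (q * F1) ^ 2 - p1 ^ 2 * F"
    \<comment> \<open>With \<open>x = u - a\<close> this compares the norms: \<open>u - a\<close>
      times the new one is \<open>- F1\<close> times the old one. As \<open>F1\<close> does not
      vanish at \<open>a\<close>, the norm order drops by exactly 1.\<close>
    have "x * ((q * F1) ^ 2 - p1 ^ 2 * (x * F1)) = - (F1 * ((x * p1) ^ 2 - q ^ 2 * (x * F1)))" for x
      by (simp add: power2_eq_square algebra_simps)
    then have "[:- a, 1:] * N' = - (F1 * N)"
      unfolding N'_def N_def p F1(1) .
    then have ord: "order a ([:- a, 1:] * N') = order a (F1 * N)" and ne: "[:- a, 1:] * N' \<noteq> 0"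
      using \<open>N \<noteq> 0\<close> \<open>F1 \<noteq> 0\<close> by (simp_all only: order_uminus neg_equal_0_iff_equal mult_eq_0_iff) simp
    have "F1 * N \<noteq> 0" "order a [:- a, 1:] = 1"
      using \<open>N \<noteq> 0\<close> \<open>F1 \<noteq> 0\<close> order_power_n_n[of a 1] by simp_all
    then have "1 + order a N' = order a F1 + order a N"
      using ord order_mult[OF ne] order_mult[of F1 N a] by simp
    moreover have "order a F1 = 0"
      using F1(2) by (rule order_0I)
    ultimately have "order a N' < order a N" by simp
    have v: "v * v = \<psi> [:- a, 1:] * \<psi> F1"
      using square F1(1) by (simp only: power2_eq_square flip: \<psi>_mult)
    have "lin p q * \<psi> F1 = (\<psi> [:- a, 1:] * \<psi> F1) * \<psi> p1 + \<psi> q * \<psi> F1 * v"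
      unfolding lin_def p by (simp only: \<psi>_mult) (simp only: algebra_simps)
    also have "\<dots> = v * lin (q * F1) p1"
      unfolding v[symmetric] by (simp add: lin_def algebra_simps)
    finally have lin: "lin p q = v * lin (q * F1) p1 * inverse (\<psi> F1)"
      using \<open>F1 \<noteq> 0\<close> by (simp add: field_simps)
    have "lin (q * F1) p1 \<noteq> 0"
      using lin less.prems by auto
    then obtain n u where u: "unit_at a b u" "lin (q * F1) p1 = param a b ^ n * u"
      using less.hyps[of "q * F1" p1] \<open>order a N' < order a N\<close> by (auto simp: N_def N'_def)
    moreover have "unit_at a b (inverse (\<psi> F1))"
      using unit_at_inverse[OF unit_at_lin[of a b F1 0]] F1(2) by (simp add: ev_def)
    ultimately have "unit_at a b (u * inverse (\<psi> F1))"
      by (simp add: unit_at_mult)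
    then show ?thesis
      using 4 lin u by (intro exI[of _ "Suc n"] exI[of _ "u * inverse (\<psi> F1)"]) (simp add: param_def)
  qed
qed

lemma param_vanishing: "param a b \<in> vanishing_at a b"
  using vanishing_at_lin[of a b 0 1] vanishing_at_lin[of a b "[:- a, 1:]" 0]
  by (auto simp: param_def ev_def)

lemma param_power_vanishing: "n > 0 \<Longrightarrow> param a b ^ n \<in> vanishing_at a b"
proof (induction n)
  case (Suc n)
  have "param a b ^ n \<in> regular_at a b"
    using Suc.IH regular_at_lin[of 1 0] vanishing_subset_regular[of a b] by (cases "n = 0") auto
  then show ?case
    using vanishing_at_mult[OF param_vanishing] by simp
qed simp

lemma vanishing_at_eq: "vanishing_at a b = (\<lambda>u. param a b * u) ` regular_at a b"
proof
  show "(\<lambda>u. param a b * u) ` regular_at a b \<subseteq> vanishing_at a b"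
    using vanishing_at_mult[OF param_vanishing] by blast
  show "vanishing_at a b \<subseteq> (\<lambda>u. param a b * u) ` regular_at a b"
  proof
    fix h assume "h \<in> vanishing_at a b"
    then obtain p q r s where h: "h = lin p q / lin r s" "ev a b p q = 0" "ev a b r s \<noteq> 0"
      by (auto simp: vanishing_at_def)
    show "h \<in> (\<lambda>u. param a b * u) ` regular_at a b"
    proof (cases "lin p q = 0")
      case True
      then show ?thesis
        using h regular_at_lin[of 0 0] by (intro image_eqI[of _ _ 0]) auto
    next
      case False
      then obtain n u where u: "unit_at a b u" "lin p q = param a b ^ n * u"
        using lin_order_exists by blast
      have "n \<noteq> 0"
        using u unit_not_vanishing vanishing_at_lin[OF h(2)] by (intro notI) auto
      then obtain m where m: "n = Suc m" by (cases n) auto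
      have "param a b ^ m \<in> regular_at a b"
        using param_power_vanishing[of m] regular_at_lin[of 1 0] vanishing_subset_regular[of a b] by (cases "m = 0") auto
      then have "param a b ^ m * (u * inverse (lin r s)) \<in> regular_at a b"
        using regular_at_mult[OF _ unit_at_regular[OF unit_at_mult[OF u(1) unit_at_inverse[OF unit_at_lin[OF h(3)]]]]]
        by blast
      moreover have "h = param a b * (param a b ^ m * (u * inverse (lin r s)))"
        using h u m by (simp add: field_simps)
      ultimately show ?thesis by blast
    qed
  qed
qed

lemma param_powi_unique:
  assumes "unit_at a b u" "unit_at a b w" "param a b powi m * u = param a b powi n * w"
  shows "m = n"
proof -
  have False if "unit_at a b u" "unit_at a b w" "param a b powi m * u = param a b powi n * w" "m < n" for m n u w
  proof -
    define k where "k = nat (n - m)"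
    have "param a b powi n = param a b powi m * param a b ^ k"
      using that(4) by (simp add: k_def power_int_diff flip: power_int_of_nat)
    then have "u = param a b ^ k * w"
      using that(3) by simp
    moreover have "param a b ^ k \<in> vanishing_at a b"
      using that(4) by (intro param_power_vanishing) (simp add: k_def)
    ultimately show False
      using vanishing_at_mult unit_at_regular unit_not_vanishing that(1,2) by metis
  qed
  from this[OF assms] this[OF assms(2,1) assms(3)[symmetric]] show ?thesis by (meson linorder_neqE)
qed

text \<open>The definite description is \<open>vanishing_order\<close> unfolded for a chart. It does
  not depend on the uniformizer because two generators \<open>t\<close> and \<open>param a b\<close>
  of the maximal ideal divide each other, so they differ by a unit \<open>z\<close>, whose powers
  are absorbed into \<open>w\<close>.\<close>

lemma order_at_eq:
  assumes u: "unit_at a b u"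
  shows "(THE n. \<exists>t w. vanishing_at a b = (\<lambda>z. t * z) ` regular_at a b \<and>
           w \<in> regular_at a b - vanishing_at a b \<and> param a b powi m * u = t powi n * w) = m"
proof (rule the_equality)
  show "\<exists>t w. vanishing_at a b = (\<lambda>z. t * z) ` regular_at a b \<and>
           w \<in> regular_at a b - vanishing_at a b \<and> param a b powi m * u = t powi m * w"
    using vanishing_at_eq u unit_at_iff by blast
next
  fix n
  assume "\<exists>t w. vanishing_at a b = (\<lambda>z. t * z) ` regular_at a b \<and>
           w \<in> regular_at a b - vanishing_at a b \<and> param a b powi m * u = t powi n * w"
  then obtain t w where t: "vanishing_at a b = (\<lambda>z. t * z) ` regular_at a b"
    and w: "unit_at a b w" "param a b powi m * u = t powi n * w"
    using unit_at_iff by blast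
  obtain y where y: "y \<in> regular_at a b" "param a b = t * y"
    using param_vanishing t by auto
  have "t \<in> vanishing_at a b"
    using t regular_at_lin[of 1 0] by (auto intro!: image_eqI[of _ _ 1])
  then obtain z where z: "z \<in> regular_at a b" "t = param a b * z"
    using vanishing_at_eq by auto
  have "z * y = 1"
    using y(2) z(2) param_neq_0[of a b] by (metis mult.assoc mult_cancel_left1)
  have "unit_at a b z"
  proof (rule ccontr)
    assume "\<not> unit_at a b z"
    then have "z \<in> vanishing_at a b" using z regular_at_cases by blast
    then have "1 \<in> vanishing_at a b"
      using vanishing_at_mult[OF _ y(1)] \<open>z * y = 1\<close> by metis
    then show False
      using unit_not_vanishing[OF unit_at_lin[of a b 1 0]] by (simp add: ev_def)
  qed
  have "unit_at a b (z ^ k)" for k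
    using unit_at_lin[of a b 1 0] by (induction k) (auto simp: ev_def intro: unit_at_mult \<open>unit_at a b z\<close>)
  then have "unit_at a b (z powi n)"
    by (auto simp: power_int_def power_inverse intro: unit_at_inverse)
  then have "unit_at a b (z powi n * w)"
    using w by (simp add: unit_at_mult)
  moreover have "param a b powi m * u = param a b powi n * (z powi n * w)"
    using w(2) z(2) by (simp add: power_int_mult_distrib mult.assoc)
  ultimately show "n = m"
    using param_powi_unique[OF u] by blast
qed

text \<open>The involution \<open>v \<mapsto> -v\<close> carries the local ring at
  \<open>(a, b)\<close> to the one at \<open>(a, -b)\<close> and the uniformizer to itself up to
  sign.\<close>

lemma conj_order:
  assumes "unit_at a b u" "lin p q = param a b ^ n * u"
  shows "\<exists>w. unit_at a (- b) w \<and> lin p (- q) = param a (- b) ^ n * w"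
proof -
  obtain p1 q1 r s where u: "u = lin p1 q1 / lin r s" "ev a b p1 q1 \<noteq> 0" "ev a b r s \<noteq> 0"
    using assms(1) by (auto simp: unit_at_def)
  have "lin r s \<noteq> 0" using u by (auto simp: ev_def)
  \<comment> \<open>The sign can be negative only for \<open>b = 0\<close>, where the uniformizer is
    \<open>v\<close>; it is put into the unit at the end.\<close>
  have "\<exists>c d. param a b ^ n = lin c d \<and> (lin c (- d) = param a b ^ n \<or> lin c (- d) = - (param a b ^ n))"
  proof (induction n)
    case 0
    have "lin 1 0 = 1" by simp
    then show ?case by (metis minus_zero power_0)
  next
    case (Suc n)
    then obtain c d where cd: "param a b ^ n = lin c d"
      "lin c (- d) = param a b ^ n \<or> lin c (- d) = - (param a b ^ n)"
      by blast
    obtain c' d' where cd': "param a b = lin c' d'" "lin c' (- d') = param a b \<or> lin c' (- d') = - param a b"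
    proof (cases "b = 0")
      case True
      then show ?thesis by (intro that[of 0 1]) (auto simp: param_def lin_def)
    next
      case False
      then show ?thesis by (intro that[of "[:- a, 1:]" 0]) (auto simp: param_def)
    qed
    have "param a b ^ Suc n = lin (c' * c + d' * d * F) (c' * d + d' * c)"
      by (simp flip: cd(1) cd'(1) lin_mult)
    moreover have "lin (c' * c + d' * d * F) (- (c' * d + d' * c)) = lin c' (- d') * lin c (- d)"
      by (simp add: lin_mult algebra_simps)
    then have "lin (c' * c + d' * d * F) (- (c' * d + d' * c)) = param a b ^ Suc n \<or>
        lin (c' * c + d' * d * F) (- (c' * d + d' * c)) = - (param a b ^ Suc n)"
      using cd(2) cd'(2) by auto
    ultimately show ?case by blast
  qed
  then obtain c d where cd: "param a b ^ n = lin c d"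
      "lin c (- d) = param a b ^ n \<or> lin c (- d) = - (param a b ^ n)"
    by blast
  have "lin p q * lin r s = lin c d * lin p1 q1"
    using assms(2) u(1) cd(1) \<open>lin r s \<noteq> 0\<close> by (simp del: lin_eq_0_iff)
  from lin_conj_eq[OF this] have eq: "lin p (- q) * lin r (- s) = lin c (- d) * lin p1 (- q1)" .
  define w where "w = lin p1 (- q1) / lin r (- s)"
  have "ev a (- b) p1 (- q1) \<noteq> 0" "ev a (- b) r (- s) \<noteq> 0"
    using u by (simp_all add: ev_def)
  then have w: "unit_at a (- b) w"
    unfolding unit_at_def w_def by blast
  have "lin r (- s) \<noteq> 0"
    using \<open>lin r s \<noteq> 0\<close> by simp
  then have "lin p (- q) = lin c (- d) * w"
    using eq by (simp add: w_def field_simps del: lin_eq_0_iff)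
  moreover have "param a (- b) = param a b"
    by (simp add: param_def)
  ultimately show ?thesis
    using cd(2) w unit_at_uminus by (metis minus_mult_commute)
qed

end

end

subsection \<open>The function field\<close>

definition of_poly :: "'a::field poly \<Rightarrow> 'a ff" where
  "of_poly p = to_ac (to_fract p)"

definition of_poly_inf :: "'a::field poly \<Rightarrow> 'a ff" where
  "of_poly_inf p = poly (map_poly ff_const p) (1 / ff_x)"

fun hyp_inv :: "'a::field curve_point \<Rightarrow> 'a curve_point" where
  "hyp_inv (Affine a b) = Affine a (- b)"
| "hyp_inv Infinity = Infinity"

lemma of_poly_simps [simp]:
  "of_poly 0 = 0" "of_poly 1 = 1" "of_poly (p + q) = of_poly p + of_poly q"
  "of_poly (p - q) = of_poly p - of_poly q" "of_poly (- p) = - of_poly p"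
  "of_poly (p * q) = of_poly p * of_poly q" "of_poly p = 0 \<longleftrightarrow> p = 0"
  by (simp_all add: of_poly_def)

lemma of_poly_power [simp]: "of_poly (p ^ n) = of_poly p ^ n"
  by (induction n) auto

lemma of_poly_eq_iff [simp]: "of_poly p = of_poly q \<longleftrightarrow> p = q"
  by (simp add: of_poly_def)

lemma ff_const_simps [simp]:
  "ff_const 0 = 0" "ff_const 1 = 1" "ff_const (c + d) = ff_const c + ff_const d"
  "ff_const (c * d) = ff_const c * ff_const d"  "ff_const c = 0 \<longleftrightarrow> c = 0"
  by (simp_all add: ff_const_def flip: of_poly_def)
    (simp_all flip: of_poly_simps(2,3,6) add: one_pCons)

lemma of_poly_const: "of_poly [:c:] = ff_const c" and of_poly_x: "of_poly [:0, 1:] = ff_x"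
  by (simp_all add: of_poly_def ff_const_def ff_x_def)

lemma ff_x_neq_0 [simp]: "ff_x \<noteq> 0"
  by (simp flip: of_poly_x)

lemma of_poly_eval: "of_poly p = poly (map_poly ff_const p) ff_x"
proof (induction p)
  case (pCons c p)
  have "pCons c p = [:c:] + [:0, 1:] * p" by simp
  then have "of_poly (pCons c p) = of_poly [:c:] + of_poly [:0, 1:] * of_poly p"
    by (metis of_poly_simps(3,6))
  then show ?case
    using pCons by (simp add: map_poly_pCons of_poly_const of_poly_x)
qed simp

lemma map_poly_ff_const_mult: "map_poly ff_const (p * q) = map_poly ff_const p * map_poly ff_const q"
proof -
  have "ff_const (sum g A) = (\<Sum>i\<in>A. ff_const (g i))" for g :: "nat \<Rightarrow> 'a" and A
    by (induction A rule: infinite_finite_induct) auto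
  then show ?thesis
    by (intro poly_eqI) (simp add: coeff_map_poly coeff_mult)
qed

lemma map_poly_ff_const_add: "map_poly ff_const (p + q) = map_poly ff_const p + map_poly ff_const q"
  by (intro poly_eqI) (simp add: coeff_map_poly)

lemma of_poly_inf_simps [simp]:
  "of_poly_inf 1 = 1" "of_poly_inf (p + q) = of_poly_inf p + of_poly_inf q"
  "of_poly_inf (p * q) = of_poly_inf p * of_poly_inf q"
  by (simp_all add: of_poly_inf_def map_poly_ff_const_mult map_poly_ff_const_add map_poly_1')

lemma of_poly_inf_x: "of_poly_inf [:0, 1:] = 1 / ff_x"
  by (simp add: of_poly_inf_def map_poly_pCons)

lemma of_poly_reflect: "of_poly_inf (reflect_poly p) * ff_x ^ degree p = of_poly p"
proof -
  have "map_poly ff_const (reflect_poly p) = reflect_poly (map_poly ff_const p)"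
    by (intro poly_eqI) (simp add: coeff_map_poly coeff_reflect_poly degree_map_poly)
  then show ?thesis
    using poly_reflect_poly_nz[of "1 / ff_x" "map_poly ff_const p"]
    by (simp add: of_poly_inf_def of_poly_eval field_simps degree_map_poly)
qed

lemma of_poly_inf_reflect: "of_poly_inf p * ff_x ^ degree p = of_poly (reflect_poly p)"
proof -
  have "map_poly ff_const (reflect_poly p) = reflect_poly (map_poly ff_const p)"
    by (intro poly_eqI) (simp add: coeff_map_poly coeff_reflect_poly degree_map_poly)
  then show ?thesis
    using poly_reflect_poly_nz[of "ff_x" "map_poly ff_const p"]
    by (simp add: of_poly_inf_def of_poly_eval field_simps degree_map_poly)
qed

text \<open>Reduction modulo \<open>v^2 = F\<close>: a bivariate polynomial becomes linear in
  \<open>v\<close> without changing its value at points of the curve. This identifies the rings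
  defined by quotients of bivariate polynomials with \<open>regular_at\<close> and
  \<open>vanishing_at\<close>.\<close>

lemma (in chart) eval2_eq:
  assumes \<psi>: "\<psi> = (\<lambda>p. poly (map_poly h p) u)"
  obtains p q where "eval2 h G (u, v) = lin p q"
    "\<And>a b. b ^ 2 = poly F a \<Longrightarrow> eval2 id G (a, b) = ev a b p q"
proof -
  have "\<exists>p q. poly (map_poly \<psi> G) v = lin p q \<and>
      (\<forall>a b. b ^ 2 = poly F a \<longrightarrow> poly (map_poly (\<lambda>p. poly p a) G) b = ev a b p q)"
  proof (induction G)
    case 0
    show ?case by (intro exI[of _ 0]) (simp add: ev_def)
  next
    case (pCons c G)
    then obtain p q where pq: "poly (map_poly \<psi> G) v = lin p q"
      "\<And>a b. b ^ 2 = poly F a \<Longrightarrow> poly (map_poly (\<lambda>p. poly p a) G) b = ev a b p q"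
      by blast
    have "poly (map_poly \<psi> (pCons c G)) v = lin (c + q * F) p"
      using pq(1) square by (simp add: map_poly_pCons lin_def algebra_simps power2_eq_square)
    moreover have "poly (map_poly (\<lambda>p. poly p a) (pCons c G)) b = ev a b (c + q * F) p"
      if "b ^ 2 = poly F a" for a b
      using pq(2)[OF that] that[symmetric]
      by (simp add: map_poly_pCons ev_def algebra_simps power2_eq_square)
    ultimately show ?case by blast
  qed
  then show ?thesis
    using that by (auto simp: eval2_def \<psi> map_poly_id)
qed

lemma (in chart) eval2_lin:
  assumes \<psi>: "\<psi> = (\<lambda>p. poly (map_poly h p) u)"
  shows "eval2 h [:p, q:] (u, v) = lin p q" "eval2 id [:p, q:] (a, b) = ev a b p q"
proof -
  have "map_poly \<psi> [:p, q:] = [:\<psi> p, \<psi> q:]"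
    by (simp add: map_poly_pCons)
  moreover have "map_poly (\<lambda>p. poly p a) [:p, q:] = [:poly p a, poly q a:]"
    by (simp add: map_poly_pCons)
  ultimately show "eval2 h [:p, q:] (u, v) = lin p q" "eval2 id [:p, q:] (a, b) = ev a b p q"
    by (simp_all add: eval2_def map_poly_id lin_def ev_def flip: \<psi>)
qed

lemma (in chart) eval2_quotients:
  assumes \<psi>: "\<psi> = (\<lambda>p. poly (map_poly h p) u)" and b: "b ^ 2 = poly F a"
  shows "{eval2 h G (u, v) / eval2 h H (u, v) | G H. eval2 id H (a, b) \<noteq> 0} = regular_at a b"
    "{eval2 h G (u, v) / eval2 h H (u, v) | G H. eval2 id G (a, b) = 0 \<and> eval2 id H (a, b) \<noteq> 0} =
       vanishing_at a b"
proof -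
  have *: "\<exists>p q. eval2 h G (u, v) = lin p q \<and> eval2 id G (a, b) = ev a b p q" for G
    using eval2_eq[OF \<psi>, of G] b by metis
  have **: "\<exists>G. eval2 h G (u, v) = lin p q \<and> eval2 id G (a, b) = ev a b p q" for p q
    using eval2_lin[OF \<psi>] by blast
  have "(\<exists>G H. x = eval2 h G (u, v) / eval2 h H (u, v) \<and> eval2 id H (a, b) \<noteq> 0) \<longleftrightarrow>
      (\<exists>p q r s. x = lin p q / lin r s \<and> ev a b r s \<noteq> 0)" for x
    by (metis * **)
  then show "{eval2 h G (u, v) / eval2 h H (u, v) | G H. eval2 id H (a, b) \<noteq> 0} = regular_at a b"
    by (simp add: regular_at_def)
  have "(\<exists>G H. x = eval2 h G (u, v) / eval2 h H (u, v) \<and> eval2 id G (a, b) = 0 \<and> eval2 id H (a, b) \<noteq> 0) \<longleftrightarrow>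
      (\<exists>p q r s. x = lin p q / lin r s \<and> ev a b p q = 0 \<and> ev a b r s \<noteq> 0)" for x
    by (metis * **)
  then show "{eval2 h G (u, v) / eval2 h H (u, v) | G H. eval2 id G (a, b) = 0 \<and> eval2 id H (a, b) \<noteq> 0} =
       vanishing_at a b"
    by (simp add: vanishing_at_def)
qed

locale hyperelliptic =
  fixes f :: "'a::alg_closed_field poly"
  assumes odd_degree: "odd (degree f)"
    and simple_roots: "poly f a = 0 \<Longrightarrow> \<exists>f1. f = [:- a, 1:] * f1 \<and> poly f1 a \<noteq> 0"
    and char_neq_2: "(2 :: 'a) \<noteq> 0"
begin

lemma f_neq_0: "f \<noteq> 0"
  using odd_degree by auto

lemma degree_f: "degree f = 2 * genus f + 1"
  using odd_degree by (auto simp: genus_def elim!: oddE)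

lemma ff_y_square: "ff_y f ^ 2 = of_poly f"
proof -
  have "\<exists>y. y ^ 2 = to_ac (to_fract f)"
    by (rule nth_root_exists) simp
  then show ?thesis
    unfolding ff_y_def of_poly_def by (rule someI_ex)
qed

text \<open>\<open>f\<close> has odd degree, so it is not a square of a rational function: in
  \<open>p^2 = q^2 f\<close> the degrees have different parity unless both sides are 0.\<close>

lemma ff_y_independent:
  assumes "of_poly p + of_poly q * ff_y f = 0"
  shows "p = 0 \<and> q = 0"
proof -
  have "of_poly p = - (of_poly q * ff_y f)"
    using assms by (simp add: eq_neg_iff_add_eq_0)
  then have "of_poly p ^ 2 = of_poly q ^ 2 * ff_y f ^ 2"
    by (simp add: power_mult_distrib)
  then have "of_poly (p ^ 2) = of_poly (q ^ 2 * f)"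
    by (simp add: ff_y_square)
  then have eq: "p ^ 2 = q ^ 2 * f"
    by (simp only: of_poly_eq_iff)
  have "q = 0"
  proof (rule ccontr)
    assume "q \<noteq> 0"
    then have "2 * degree p = 2 * degree q + degree f"
      using arg_cong[OF eq, of degree] f_neq_0
      by (cases "p = 0") (auto simp: degree_mult_eq degree_power_eq)
    then show False using odd_degree by presburger
  qed
  then show ?thesis using eq by simp
qed

sublocale affine: chart of_poly "ff_y f" f
  by unfold_locales (auto dest: ff_y_independent simp: ff_y_square char_neq_2)

definition y_inf :: "'a ff" where
  "y_inf = ff_y f / ff_x ^ (genus f + 1)"

text \<open>The equation of the second chart: since \<open>degree f = 2g + 1\<close>, the polynomial
  \<open>t^(2g+2) f(1/t)\<close> is \<open>t\<close> times the reflected polynomial of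
  \<open>f\<close>.\<close>

sublocale infinite: chart of_poly_inf y_inf "pCons 0 (reflect_poly f)"
proof
  fix p q :: "'a poly"
  assume "of_poly_inf p + of_poly_inf q * y_inf = 0"
  then have *: "of_poly_inf p + of_poly_inf q * (ff_y f / ff_x ^ (genus f + 1)) = 0"
    unfolding y_inf_def .
  \<comment> \<open>Large enough for \<open>x^N\<close> to clear all negative powers of
    \<open>x\<close> on both summands, which reduces the claim to independence over polynomials in
    \<open>x\<close>.\<close>
  define N where "N = degree p + degree q + genus f + 1"
  have "of_poly_inf p * ff_x ^ N = of_poly_inf p * ff_x ^ degree p * ff_x ^ (degree q + genus f + 1)"
    by (simp add: N_def power_add)
  also have "\<dots> = of_poly (reflect_poly p * [:0, 1:] ^ (degree q + genus f + 1))"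
    by (simp only: of_poly_inf_reflect of_poly_simps of_poly_power of_poly_x)
  finally have 1: "of_poly_inf p * ff_x ^ N = of_poly (reflect_poly p * [:0, 1:] ^ (degree q + genus f + 1))" .
  have "of_poly_inf q * (ff_y f / ff_x ^ (genus f + 1)) * ff_x ^ N =
      of_poly_inf q * ff_x ^ degree q * ff_x ^ degree p * ff_y f"
    by (simp add: N_def power_add)
  also have "\<dots> = of_poly (reflect_poly q * [:0, 1:] ^ degree p) * ff_y f"
    by (simp only: of_poly_inf_reflect of_poly_simps of_poly_power of_poly_x)
  finally have 2: "of_poly_inf q * (ff_y f / ff_x ^ (genus f + 1)) * ff_x ^ N =
      of_poly (reflect_poly q * [:0, 1:] ^ degree p) * ff_y f" .
  have "of_poly (reflect_poly p * [:0, 1:] ^ (degree q + genus f + 1)) +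
      of_poly (reflect_poly q * [:0, 1:] ^ degree p) * ff_y f = 0"
    unfolding 1[symmetric] 2[symmetric] distrib_right[symmetric] * by simp
  from ff_y_independent[OF this] show "p = 0 \<and> q = 0"
    by simp
next
  have "of_poly_inf (pCons 0 (reflect_poly f)) = of_poly_inf ([:0, 1:] * reflect_poly f)"
    by simp
  also have "\<dots> = of_poly_inf (reflect_poly f) / ff_x"
    by (simp only: of_poly_inf_simps of_poly_inf_x) simp
  also have "\<dots> = of_poly f / ff_x ^ (degree f + 1)"
    by (simp add: field_simps flip: of_poly_reflect)
  also have "degree f + 1 = (genus f + 1) * 2"
    using degree_f by simp
  also have "of_poly f / ff_x ^ ((genus f + 1) * 2) = (ff_y f / ff_x ^ (genus f + 1)) ^ 2"
    by (simp only: power_divide ff_y_square power_mult)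
  finally show "y_inf ^ 2 = of_poly_inf (pCons 0 (reflect_poly f))"
    unfolding y_inf_def by (rule sym)
qed (auto simp: char_neq_2)

lemma affine_smooth: "Affine a b \<in> curve f \<Longrightarrow> affine.smooth_point a b"
  using simple_roots[of a] by (auto simp: curve_def affine.smooth_point_def)

text \<open>The reflected polynomial takes the value \<open>lead_coeff f\<close> at 0. So 0 is a
  simple root and infinity is a ramification point with uniformizer \<open>y_inf\<close>.\<close>

lemma infinite_smooth: "infinite.smooth_point 0 0"
  using f_neq_0 by (auto simp: infinite.smooth_point_def intro!: exI[of _ "reflect_poly f"])

lemma local_ring_affine:
  assumes "Affine a b \<in> curve f"
  shows "local_ring f (Affine a b) = affine.regular_at a b"
    "max_ideal f (Affine a b) = affine.vanishing_at a b"
  unfolding local_ring_def max_ideal_def chart_functions.simps chart_values.simps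
  using affine.eval2_quotients[OF ext[of of_poly, OF of_poly_eval]] assms
  by (simp_all add: curve_def)

lemma local_ring_infinite:
  "local_ring f Infinity = infinite.regular_at 0 0"
  "max_ideal f Infinity = infinite.vanishing_at 0 0"
  unfolding local_ring_def max_ideal_def chart_functions.simps chart_values.simps y_inf_def[symmetric]
  by (rule infinite.eval2_quotients[OF ext[of of_poly_inf, OF of_poly_inf_def]]; simp)+

subsection \<open>Orders of vanishing\<close>

definition unit_of :: "'a curve_point \<Rightarrow> 'a ff \<Rightarrow> bool" where
  "unit_of P u \<longleftrightarrow> u \<in> local_ring f P - max_ideal f P"

fun param_of :: "'a curve_point \<Rightarrow> 'a ff" where
  "param_of (Affine a b) = affine.param a b"
| "param_of Infinity = infinite.param 0 0"

lemma hyp_inv_curve: "P \<in> curve f \<Longrightarrow> hyp_inv P \<in> curve f"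
  by (cases P) (auto simp: curve_def)

lemma Infinity_curve [simp]: "Infinity \<in> curve f"
  by (simp add: curve_def)

lemma unit_of_affine:
  assumes "Affine a b \<in> curve f"
  shows "unit_of (Affine a b) u \<longleftrightarrow> affine.unit_at a b u"
  using affine.unit_at_iff[OF affine_smooth[OF assms]] local_ring_affine[OF assms]
  by (simp add: unit_of_def)

lemma unit_of_infinite: "unit_of Infinity u \<longleftrightarrow> infinite.unit_at 0 0 u"
  using infinite.unit_at_iff[OF infinite_smooth] local_ring_infinite by (simp add: unit_of_def)

lemma unit_of_mult: "P \<in> curve f \<Longrightarrow> unit_of P u \<Longrightarrow> unit_of P w \<Longrightarrow> unit_of P (u * w)"
  by (cases P) (auto simp: unit_of_affine unit_of_infinite affine_smooth infinite_smooth
      intro: affine.unit_at_mult infinite.unit_at_mult)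

lemma unit_of_inverse: "P \<in> curve f \<Longrightarrow> unit_of P u \<Longrightarrow> unit_of P (inverse u)"
  by (cases P) (auto simp: unit_of_affine unit_of_infinite
      intro: affine.unit_at_inverse infinite.unit_at_inverse)

lemma unit_of_1: "P \<in> curve f \<Longrightarrow> unit_of P 1"
  using affine.unit_at_lin[of _ _ 1 0] infinite.unit_at_lin[of 0 0 1 0]
  by (cases P) (auto simp: unit_of_affine unit_of_infinite affine.ev_def infinite.ev_def)

lemma unit_of_neq_0: "P \<in> curve f \<Longrightarrow> unit_of P u \<Longrightarrow> u \<noteq> 0"
  by (cases P) (auto simp: unit_of_affine unit_of_infinite
      dest: affine.unit_at_neq_0 infinite.unit_at_neq_0)

lemma param_of_neq_0 [simp]: "param_of P \<noteq> 0"
  by (cases P) (auto simp del: affine.lin_eq_0_iff)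

lemma vanishing_order_eq:
  assumes "P \<in> curve f" "unit_of P u" "h = param_of P powi n * u"
  shows "vanishing_order f P h = n"
proof (cases P)
  case (Affine a b)
  then show ?thesis
    using affine.order_at_eq[OF affine_smooth, of a b u n] assms local_ring_affine[of a b]
    by (simp add: vanishing_order_def uniformizer_def unit_of_affine)
next
  case Infinity
  then show ?thesis
    using infinite.order_at_eq[OF infinite_smooth, of u n] assms local_ring_infinite
    by (simp add: vanishing_order_def uniformizer_def unit_of_infinite)
qed

lemma local_ring_mult:
  "P \<in> curve f \<Longrightarrow> h \<in> local_ring f P \<Longrightarrow> k \<in> local_ring f P \<Longrightarrow> h * k \<in> local_ring f P"
  by (cases P) (auto simp: local_ring_affine local_ring_infinite affine_smooth infinite_smooth
      intro: affine.regular_at_mult infinite.regular_at_mult)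

lemma local_ring_add:
  "P \<in> curve f \<Longrightarrow> h \<in> local_ring f P \<Longrightarrow> k \<in> local_ring f P \<Longrightarrow> h + k \<in> local_ring f P"
  by (cases P) (auto simp: local_ring_affine local_ring_infinite affine_smooth infinite_smooth
      intro: affine.regular_at_add infinite.regular_at_add)

lemma max_ideal_mult:
  "P \<in> curve f \<Longrightarrow> h \<in> max_ideal f P \<Longrightarrow> k \<in> local_ring f P \<Longrightarrow> h * k \<in> max_ideal f P"
  by (cases P) (auto simp: local_ring_affine local_ring_infinite affine_smooth infinite_smooth
      intro: affine.vanishing_at_mult infinite.vanishing_at_mult)

lemma param_of_power_max_ideal: "P \<in> curve f \<Longrightarrow> n > 0 \<Longrightarrow> param_of P ^ n \<in> max_ideal f P"
  by (cases P) (auto simp: local_ring_affine local_ring_infinite affine_smooth infinite_smooth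
      intro: affine.param_power_vanishing infinite.param_power_vanishing)

lemma max_ideal_subset: "P \<in> curve f \<Longrightarrow> max_ideal f P \<subseteq> local_ring f P"
  by (cases P) (auto simp: local_ring_affine local_ring_infinite
      dest: subsetD[OF affine.vanishing_subset_regular] subsetD[OF infinite.vanishing_subset_regular])

lemma function_field_iff:
  "h \<in> function_field f \<longleftrightarrow> (\<exists>p q r. r \<noteq> 0 \<and> h = affine.lin p q / of_poly r)"
proof
  assume "h \<in> function_field f"
  then obtain A B where h: "h = to_ac A + to_ac B * ff_y f"
    by (auto simp: function_field_def)
  obtain a b where A: "A = Fract a b" "b \<noteq> 0" by (cases A)
  obtain c d where B: "B = Fract c d" "d \<noteq> 0" by (cases B)
  have "to_ac A = of_poly a / of_poly b" "to_ac B = of_poly c / of_poly d"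
    using A(1) B(1) by (simp_all add: Fract_conv_to_fract of_poly_def)
  then have "h = affine.lin (a * d) (c * b) / of_poly (b * d)"
    using A(2) B(2) by (simp add: h affine.lin_def add_divide_distrib)
  then show "\<exists>p q r. r \<noteq> 0 \<and> h = affine.lin p q / of_poly r"
    using A B by (metis mult_eq_0_iff)
next
  assume "\<exists>p q r. r \<noteq> 0 \<and> h = affine.lin p q / of_poly r"
  then obtain p q r where "r \<noteq> 0" "h = affine.lin p q / of_poly r" by blast
  then have "h = to_ac (to_fract p / to_fract r) + to_ac (to_fract q / to_fract r) * ff_y f"
    by (simp add: affine.lin_def field_simps flip: of_poly_def)
  then show "h \<in> function_field f"
    unfolding function_field_def by blast
qed

lemma lin_function_field: "affine.lin p q \<in> function_field f"
  unfolding function_field_iff by (intro exI[of _ p] exI[of _ q] exI[of _ 1]) simp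

lemma of_poly_function_field: "of_poly p \<in> function_field f"
  using lin_function_field[of p 0] by simp

lemma function_field_mult:
  assumes "h \<in> function_field f" "k \<in> function_field f"
  shows "h * k \<in> function_field f"
proof -
  obtain p q r p' q' r' where "r \<noteq> 0" "h = affine.lin p q / of_poly r"
      "r' \<noteq> 0" "k = affine.lin p' q' / of_poly r'"
    using assms by (auto simp: function_field_iff)
  then have "r * r' \<noteq> 0" "h * k = affine.lin (p * p' + q * q' * f) (p * q' + q * p') / of_poly (r * r')"
    by (simp_all flip: affine.lin_mult)
  then show ?thesis unfolding function_field_iff by blast
qed

lemma function_field_inverse:
  assumes "h \<in> function_field f"
  shows "inverse h \<in> function_field f"
proof (cases "h = 0")
  case True
  then show ?thesis using assms by simp
next
  case False
  obtain p q r where r: "r \<noteq> 0" "h = affine.lin p q / of_poly r"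
    using assms by (auto simp: function_field_iff)
  define N where "N = p ^ 2 - q ^ 2 * f"
  have ne: "affine.lin p q \<noteq> 0" "affine.lin p (- q) \<noteq> 0"
    using r False by auto
  then have "of_poly N \<noteq> 0"
    unfolding N_def affine.lin_conj[symmetric] by (simp del: affine.lin_eq_0_iff)
  moreover have "inverse h = of_poly r * affine.lin p (- q) / of_poly N"
    using ne r(2) unfolding N_def affine.lin_conj[symmetric] by (simp del: affine.lin_eq_0_iff)
  moreover have "of_poly r * affine.lin p (- q) = affine.lin (r * p) (- (r * q))"
    by (simp add: affine.lin_def algebra_simps)
  ultimately show ?thesis
    unfolding function_field_iff by (metis of_poly_simps(7))
qed

text \<open>The same power of \<open>1 / ff_x\<close> moves a function and its conjugate to the
  chart at infinity, so that their orders there can be compared.\<close>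

lemma lin_at_infinity:
  obtains N p' q' where
    "affine.lin p q * of_poly_inf [:0, 1:] ^ N = infinite.lin p' q'"
    "affine.lin p (- q) * of_poly_inf [:0, 1:] ^ N = infinite.lin p' (- q')"
proof -
  define t :: "'a poly" where "t = [:0, 1:]"
  define N where "N = degree p + degree q + genus f + 1"
  define p' where "p' = reflect_poly p * t ^ (degree q + genus f + 1)"
  define q' where "q' = reflect_poly q * t ^ degree p"
  have x: "of_poly_inf t = 1 / ff_x" unfolding t_def by (rule of_poly_inf_x)
  have 1: "of_poly p * of_poly_inf t ^ N = of_poly_inf p'"
    unfolding of_poly_reflect[of p, symmetric] p'_def
    by (simp add: N_def x power_add power_divide)
  have 2: "of_poly q * ff_y f * of_poly_inf t ^ N = of_poly_inf q' * y_inf"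
    unfolding of_poly_reflect[of q, symmetric] q'_def y_inf_def
    by (simp add: N_def x power_add power_divide)
  have "affine.lin p q * of_poly_inf t ^ N = infinite.lin p' q'"
    unfolding affine.lin_def infinite.lin_def distrib_right 1 2 by simp
  moreover have "affine.lin p (- q) * of_poly_inf t ^ N = infinite.lin p' (- q')"
    unfolding affine.lin_def infinite.lin_def
    by (simp only: of_poly_simps infinite.\<psi>_uminus distrib_right 1 2 mult_minus_left)
  ultimately show ?thesis
    unfolding t_def by (rule that)
qed

abbreviation vord :: "'a curve_point \<Rightarrow> 'a ff \<Rightarrow> int" where
  "vord P h \<equiv> vanishing_order f P h"

lemma infinite_lin_form:
  assumes "infinite.lin p q \<noteq> 0"
  shows "\<exists>n u. unit_of Infinity u \<and> infinite.lin p q = param_of Infinity ^ n * u"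
  using infinite.lin_order_exists[OF infinite_smooth] assms by (simp add: unit_of_infinite)

text \<open>A witnessed form of \<open>vord\<close>: orders of products, inverses and powers are
  computed on the witnesses, and \<open>vord_eqI\<close> passes to the definite description.\<close>

definition has_order :: "'a curve_point \<Rightarrow> 'a ff \<Rightarrow> int \<Rightarrow> bool" where
  "has_order P h n \<longleftrightarrow> (\<exists>u. unit_of P u \<and> h = param_of P powi n * u)"

lemma vord_eqI: "P \<in> curve f \<Longrightarrow> has_order P h n \<Longrightarrow> vord P h = n"
  using vanishing_order_eq by (auto simp: has_order_def)

lemma has_order_unit: "unit_of P u \<Longrightarrow> has_order P u 0"
  unfolding has_order_def by (intro exI[of _ u]) simp

lemma has_order_mult:
  assumes "P \<in> curve f" "has_order P h m" "has_order P k n"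
  shows "has_order P (h * k) (m + n)"
proof -
  obtain u w where "unit_of P u" "h = param_of P powi m * u" "unit_of P w" "k = param_of P powi n * w"
    using assms by (auto simp: has_order_def)
  then have "unit_of P (u * w)" "h * k = param_of P powi (m + n) * (u * w)"
    using assms(1) by (simp_all add: unit_of_mult power_int_add)
  then show ?thesis unfolding has_order_def by blast
qed

lemma has_order_inverse:
  assumes "P \<in> curve f" "has_order P h m"
  shows "has_order P (inverse h) (- m)"
proof -
  obtain u where "unit_of P u" "h = param_of P powi m * u"
    using assms by (auto simp: has_order_def)
  then have "unit_of P (inverse u)" "inverse h = param_of P powi (- m) * inverse u"
    using assms(1) by (simp_all add: unit_of_inverse power_int_minus)
  then show ?thesis unfolding has_order_def by blast
qed

lemma has_order_power:
  assumes "P \<in> curve f" "has_order P h m"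
  shows "has_order P (h ^ n) (int n * m)"
proof (induction n)
  case 0
  then show ?case using has_order_unit[OF unit_of_1] assms by simp
next
  case (Suc n)
  then show ?case
    using has_order_mult[OF assms Suc] by (simp add: distrib_right)
qed

lemma has_order_lin:
  assumes "P \<in> curve f" "affine.lin p q \<noteq> 0"
  shows "\<exists>n. has_order P (affine.lin p q) n \<and> has_order (hyp_inv P) (affine.lin p (- q)) n"
proof (cases P)
  case (Affine a b)
  obtain n u where u: "affine.unit_at a b u" "affine.lin p q = affine.param a b ^ n * u"
    using affine.lin_order_exists[OF affine_smooth assms(2)] assms(1) Affine by blast
  obtain w where w: "affine.unit_at a (- b) w" "affine.lin p (- q) = affine.param a (- b) ^ n * w"
    using affine.conj_order[OF affine_smooth u] assms(1) Affine by blast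
  have "Affine a (- b) \<in> curve f"
    using hyp_inv_curve assms(1) Affine by force
  then show ?thesis
    using u w assms Affine unfolding has_order_def
    by (intro exI[of _ "int n"]) (auto simp: unit_of_affine)
next
  case Infinity
  obtain N p' q' where *: "affine.lin p q * of_poly_inf [:0, 1:] ^ N = infinite.lin p' q'"
    "affine.lin p (- q) * of_poly_inf [:0, 1:] ^ N = infinite.lin p' (- q')"
    by (rule lin_at_infinity)
  have ne: "of_poly_inf [:0, 1:] \<noteq> 0"
    by (simp add: of_poly_inf_x)
  obtain m where "has_order Infinity (infinite.lin [:0, 1:] 0) m"
    using infinite_lin_form[of "[:0, 1:]" 0] ne unfolding has_order_def
    by (metis infinite.lin_0_right power_int_of_nat)
  then have m: "has_order Infinity (inverse (of_poly_inf [:0, 1:] ^ N)) (- (int N * m))"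
    by (intro has_order_inverse has_order_power) simp_all
  have "infinite.lin p' q' \<noteq> 0"
    unfolding *(1)[symmetric] using ne assms(2) by simp
  then obtain n u where u: "infinite.unit_at 0 0 u" "infinite.lin p' q' = infinite.param 0 0 ^ n * u"
    using infinite.lin_order_exists[OF infinite_smooth] by blast
  obtain w where w: "infinite.unit_at 0 (- 0) w" "infinite.lin p' (- q') = infinite.param 0 (- 0) ^ n * w"
    using infinite.conj_order[OF infinite_smooth u] by blast
  have 1: "has_order Infinity (infinite.lin p' q') n" "has_order Infinity (infinite.lin p' (- q')) n"
    using u w unfolding has_order_def by (auto simp: unit_of_infinite)
  have "affine.lin p q = infinite.lin p' q' * inverse (of_poly_inf [:0, 1:] ^ N)"
    "affine.lin p (- q) = infinite.lin p' (- q') * inverse (of_poly_inf [:0, 1:] ^ N)"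
    unfolding *[symmetric] using ne by (simp_all add: field_simps)
  then show ?thesis
    using has_order_mult[OF _ 1(1) m] has_order_mult[OF _ 1(2) m] Infinity by auto
qed

lemma has_order_vord:
  assumes "P \<in> curve f" "h \<in> function_field f" "h \<noteq> 0"
  shows "has_order P h (vord P h)"
proof -
  obtain p q r where h: "r \<noteq> 0" "h = affine.lin p q / of_poly r"
    using assms(2) by (auto simp: function_field_iff)
  obtain m n where "has_order P (affine.lin p q) m" "has_order P (affine.lin r 0) n"
    using has_order_lin[OF assms(1), of p q] has_order_lin[OF assms(1), of r 0] h assms(3) by auto
  then have "has_order P h (m + - n)"
    using has_order_mult[OF assms(1) _ has_order_inverse[OF assms(1)]]
    unfolding h(2) divide_inverse affine.lin_0_right by blast
  then show ?thesis
    using vord_eqI[OF assms(1)] by metis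
qed

lemma vord_mult:
  assumes "P \<in> curve f" "h \<in> function_field f" "h \<noteq> 0" "k \<in> function_field f" "k \<noteq> 0"
  shows "vord P (h * k) = vord P h + vord P k"
  using assms by (intro vord_eqI has_order_mult has_order_vord)

lemma vord_inverse:
  assumes "P \<in> curve f" "h \<in> function_field f" "h \<noteq> 0"
  shows "vord P (inverse h) = - vord P h"
  using assms by (intro vord_eqI has_order_inverse has_order_vord)

lemma vord_divide:
  assumes "P \<in> curve f" "h \<in> function_field f" "h \<noteq> 0" "k \<in> function_field f" "k \<noteq> 0"
  shows "vord P (h / k) = vord P h - vord P k"
  using assms by (simp add: divide_inverse vord_mult vord_inverse function_field_inverse)

lemma vord_power:
  assumes "P \<in> curve f" "h \<in> function_field f" "h \<noteq> 0"
  shows "vord P (h ^ n) = int n * vord P h"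
  using assms by (intro vord_eqI has_order_power has_order_vord)

lemma vord_hyp_inv:
  assumes "P \<in> curve f" "affine.lin p q \<noteq> 0"
  shows "vord (hyp_inv P) (affine.lin p (- q)) = vord P (affine.lin p q)"
  using has_order_lin[OF assms] vord_eqI assms(1) hyp_inv_curve by metis

lemma one_local_ring: "P \<in> curve f \<Longrightarrow> 1 \<in> local_ring f P"
  using unit_of_1 by (simp add: unit_of_def)

lemma vord_nonneg_iff:
  assumes "P \<in> curve f" "h \<in> function_field f" "h \<noteq> 0"
  shows "0 \<le> vord P h \<longleftrightarrow> h \<in> local_ring f P"
proof
  define n where "n = vord P h"
  obtain u where u: "unit_of P u" "h = param_of P powi n * u"
    using has_order_vord[OF assms] by (auto simp: has_order_def n_def)
  {
    assume "0 \<le> vord P h"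
    then have "0 \<le> n" by (simp add: n_def)
    then have "h = param_of P ^ nat (n) * u"
      using u(2) by (simp add: power_int_def)
    moreover have "param_of P ^ nat (n) \<in> local_ring f P"
      using param_of_power_max_ideal[OF assms(1), of "nat (n)"] max_ideal_subset[OF assms(1)]
        one_local_ring[OF assms(1)] by (cases "nat (n) = 0") auto
    ultimately show "h \<in> local_ring f P"
      using local_ring_mult[OF assms(1)] u(1) by (metis DiffD1 unit_of_def)
  }
  {
    assume h: "h \<in> local_ring f P"
    show "0 \<le> vord P h"
    proof (rule ccontr)
      assume "\<not> 0 \<le> vord P h"
      then have neg: "\<not> 0 \<le> n" by (simp add: n_def)
      then have "h = inverse (param_of P ^ nat (- n)) * u"
        using u(2) by (simp add: power_int_def power_inverse)
      then have "u = param_of P ^ nat (- n) * h"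
        by simp
      moreover have "param_of P ^ nat (- n) \<in> max_ideal f P"
        using neg by (intro param_of_power_max_ideal assms(1)) simp
      ultimately show False
        using max_ideal_mult[OF assms(1) _ h] u(1) by (auto simp: unit_of_def)
    qed
  }
qed

lemma vord_affine_lin:
  assumes "Affine a b \<in> curve f" "affine.lin p q \<noteq> 0"
  shows "0 \<le> vord (Affine a b) (affine.lin p q)"
    "vord (Affine a b) (affine.lin p q) = 0 \<longleftrightarrow> poly p a + poly q a * b \<noteq> 0"
proof -
  show "0 \<le> vord (Affine a b) (affine.lin p q)"
    using vord_nonneg_iff[OF assms(1) lin_function_field assms(2)] local_ring_affine[OF assms(1)]
      affine.regular_at_lin by simp
  have "unit_of (Affine a b) (affine.lin p q)" if "vord (Affine a b) (affine.lin p q) = 0"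
    using has_order_vord[OF assms(1) lin_function_field assms(2)] that by (auto simp: has_order_def)
  moreover have "vord (Affine a b) (affine.lin p q) = 0" if "unit_of (Affine a b) (affine.lin p q)"
    using vord_eqI[OF assms(1) has_order_unit] that by blast
  moreover have "unit_of (Affine a b) (affine.lin p q) \<longleftrightarrow> affine.ev a b p q \<noteq> 0"
    using affine.unit_at_lin affine.vanishing_at_lin affine.unit_not_vanishing[OF affine_smooth[OF assms(1)]]
    unfolding unit_of_affine[OF assms(1)] by blast
  ultimately show "vord (Affine a b) (affine.lin p q) = 0 \<longleftrightarrow> poly p a + poly q a * b \<noteq> 0"
    unfolding affine.ev_def by blast
qed

lemma vord_of_poly:
  assumes "Affine a b \<in> curve f" "p \<noteq> 0"
  shows "0 \<le> vord (Affine a b) (of_poly p)"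
    "vord (Affine a b) (of_poly p) = 0 \<longleftrightarrow> poly p a \<noteq> 0"
  using vord_affine_lin[OF assms(1), of p 0] assms(2) by auto

text \<open>At a ramification point \<open>f = (x - a) f1\<close> and \<open>y^2 = f\<close> give
  \<open>x - a = y^2 / f1\<close>, with \<open>f1\<close> a unit and \<open>y\<close> the
  uniformizer; hence the order 2.\<close>

lemma vord_linear:
  assumes "Affine a b \<in> curve f"
  shows "vord (Affine a b) (of_poly [:- c, 1:]) = (if c \<noteq> a then 0 else if b = 0 then 2 else 1)"
proof -
  consider "c \<noteq> a" | "c = a" "b \<noteq> 0" | "c = a" "b = 0" by blast
  then show ?thesis
  proof cases
    case 1
    then show ?thesis
      using vord_of_poly(2)[OF assms, of "[:- c, 1:]"] by auto
  next
    case 2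
    then have "of_poly [:- c, 1:] = param_of (Affine a b) powi 1 * 1"
      by (simp add: affine.param_def)
    from vanishing_order_eq[OF assms unit_of_1[OF assms] this] show ?thesis
      using 2 by simp
  next
    case 3
    have "poly f a = 0"
      using assms 3 by (simp add: curve_def)
    then obtain f1 where f1: "f = [:- a, 1:] * f1" "poly f1 a \<noteq> 0"
      using simple_roots by blast
    have u: "unit_of (Affine a b) (inverse (of_poly f1))"
      using affine.unit_at_inverse[OF affine.unit_at_lin[of a b f1 0]] f1(2) assms
      by (simp add: unit_of_affine affine.ev_def)
    have "ff_y f ^ 2 = of_poly [:- a, 1:] * of_poly f1"
      using ff_y_square by (subst (asm) (2) f1(1)) (simp only: of_poly_simps)
    then have "of_poly [:- c, 1:] = param_of (Affine a b) powi 2 * inverse (of_poly f1)"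
      using 3 f1(2) by (auto simp: affine.param_def field_simps)
    from vanishing_order_eq[OF assms u this] show ?thesis
      using 3 by simp
  qed
qed

text \<open>The square of the uniformizer \<open>y_inf\<close> is \<open>1 / ff_x\<close> times a
  unit, so \<open>x\<close> has a double pole; and \<open>p\<close> is \<open>x ^ degree p\<close>
  times a unit at infinity.\<close>

lemma vord_infinite_of_poly:
  assumes "p \<noteq> 0"
  shows "vord Infinity (of_poly p) = - 2 * int (degree p)"
proof -
  have u: "unit_of Infinity (of_poly_inf (reflect_poly p))" if "p \<noteq> 0" for p :: "'a poly"
    using infinite.unit_at_lin[of 0 0 "reflect_poly p" 0] that by (simp add: unit_of_infinite infinite.ev_def)
  have "y_inf ^ 2 = of_poly_inf ([:0, 1:] * reflect_poly f)"
    using infinite.square by simp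
  then have "1 / ff_x * of_poly_inf (reflect_poly f) = y_inf ^ 2"
    by (simp only: of_poly_inf_simps of_poly_inf_x)
  then have "ff_x = inverse (y_inf ^ 2) * of_poly_inf (reflect_poly f)"
    using unit_of_neq_0[OF _ u[OF f_neq_0]] by (simp add: field_simps)
  then have "ff_x = param_of Infinity powi (- 2) * of_poly_inf (reflect_poly f)"
    by (simp add: infinite.param_def power_int_minus)
  then have "has_order Infinity ff_x (- 2)"
    using u[OF f_neq_0] unfolding has_order_def by blast
  from has_order_mult[OF _ has_order_unit[OF u[OF assms]] has_order_power[OF _ this, of "degree p"]]
  have "has_order Infinity (of_poly p) (0 + int (degree p) * - 2)"
    by (simp add: of_poly_reflect)
  then show ?thesis
    using vord_eqI by force
qed

subsection \<open>Functions regular outside infinity\<close>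

lemma vord_ff_y:
  assumes "Affine a b \<in> curve f"
  shows "vord (Affine a b) (ff_y f) = (if b = 0 then 1 else 0)"
proof (cases "b = 0")
  case True
  have "ff_y f = param_of (Affine a b) powi 1 * 1"
    using True by (simp add: affine.param_def)
  from vanishing_order_eq[OF assms unit_of_1[OF assms] this] show ?thesis
    using True by simp
next
  case False
  then show ?thesis
    using vord_affine_lin(2)[OF assms, of 0 1] by simp
qed

lemma vord_infinite_ff_y: "vord Infinity (ff_y f) = - (2 * int (genus f) + 1)"
proof -
  have "2 * vord Infinity (ff_y f) = vord Infinity (ff_y f ^ 2)"
    using vord_power[OF Infinity_curve, of "ff_y f" 2] lin_function_field[of 0 1] by simp
  also have "\<dots> = - 2 * int (degree f)"
    unfolding ff_y_square by (rule vord_infinite_of_poly[OF f_neq_0])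
  finally show ?thesis using degree_f by simp
qed

lemma ff_y_function_field: "ff_y f \<in> function_field f"
  using lin_function_field[of 0 1] by simp

lemma local_ring_diff:
  assumes "P \<in> curve f" "h \<in> local_ring f P" "k \<in> local_ring f P"
  shows "h - k \<in> local_ring f P"
proof -
  have "of_poly (- 1) \<in> local_ring f P"
    using vord_nonneg_iff[OF assms(1) of_poly_function_field[of "- 1"]] vord_of_poly(1)[of _ _ "- 1"]
      vord_infinite_of_poly[of "- 1"] assms(1) by (cases P) auto
  then have "h + of_poly (- 1) * k \<in> local_ring f P"
    using assms by (intro local_ring_add local_ring_mult)
  then show ?thesis by simp
qed

lemma double_neq_0: "(p :: 'a poly) \<noteq> 0 \<Longrightarrow> p + p \<noteq> 0"
  using char_neq_2 by (metis mult_2 mult_eq_0_iff numeral_poly pCons_eq_0_iff)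

lemma lin_add_conj: "affine.lin p q + affine.lin p (- q) = of_poly (p + p)"
  by (simp only: affine.lin_def of_poly_simps) simp

lemma lin_diff_conj: "affine.lin p q - affine.lin p (- q) = of_poly (q + q) * ff_y f"
  by (simp only: affine.lin_def of_poly_simps) (simp add: algebra_simps)

text \<open>The coordinate ring of the smooth affine curve is integrally closed. Concretely, a
  denominator of minimal degree has no root: at a root \<open>c\<close>, adding and subtracting the
  conjugate shows that \<open>2 p / (x - c)\<close> and \<open>2 q y / (x - c)\<close> are regular,
  so \<open>x - c\<close> cancels.\<close>

lemma regular_imp_lin:
  assumes "h \<in> function_field f" "h \<noteq> 0"
    and reg: "\<And>a b. Affine a b \<in> curve f \<Longrightarrow> 0 \<le> vord (Affine a b) h"
  shows "\<exists>p q. h = affine.lin p q"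
proof -
  define Q where "Q n \<longleftrightarrow> (\<exists>p q r. r \<noteq> 0 \<and> h = affine.lin p q / of_poly r \<and> degree r = n)" for n
  have "\<exists>n. Q n"
    using assms(1) by (auto simp: function_field_iff Q_def)
  then have "Q (LEAST n. Q n)" by (rule LeastI_ex)
  then obtain p q r where h: "r \<noteq> 0" "h = affine.lin p q / of_poly r" and deg: "degree r = (LEAST n. Q n)"
    by (auto simp: Q_def)
  have ne: "affine.lin p q \<noteq> 0" "affine.lin p (- q) \<noteq> 0"
    using h assms(2) by auto
  have "poly r c \<noteq> 0" for c
  proof
    assume "poly r c = 0"
    then obtain r1 where r: "r = [:- c, 1:] * r1"
      by (auto simp: poly_eq_0_iff_dvd elim!: dvdE)
    define s where "s = [:- c, 1:]"
    have s: "r = s * r1" "s \<noteq> 0" "r1 \<noteq> 0" "of_poly s \<noteq> 0"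
      using r h(1) by (auto simp: s_def)
    obtain e where e: "e ^ 2 = poly f c"
      using nth_root_exists[of 2] by auto
    then have P: "Affine c e \<in> curve f" and P': "Affine c (- e) \<in> curve f"
      by (auto simp: curve_def)
    have nonneg: "0 \<le> vord (Affine c b) (affine.lin p q / of_poly s)" if "Affine c b \<in> curve f" for b
    proof -
      have "affine.lin p q / of_poly s = h * of_poly r1"
        using h s by (simp add: field_simps)
      then show ?thesis
        using vord_mult[OF that assms(1,2) of_poly_function_field[of r1]] reg[OF that] vord_of_poly(1)[OF that s(3)] s
        by simp
    qed
    \<comment> \<open>Regularity of the conjugate at one point over \<open>c\<close> is regularity
      of the function at the other point over \<open>c\<close>.\<close>
    have "vord (Affine c e) (affine.lin p (- q) / of_poly s) = vord (Affine c (- e)) (affine.lin p q / of_poly s)"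
      using vord_hyp_inv[OF P' ne(1)] vord_hyp_inv[OF P', of s 0] ne s P P'
      by (simp add: vord_divide lin_function_field of_poly_function_field)
    then have k: "affine.lin p q / of_poly s \<in> local_ring f (Affine c e)"
      "affine.lin p (- q) / of_poly s \<in> local_ring f (Affine c e)"
      using nonneg P P' ne s
      by (simp_all add: divide_inverse function_field_mult function_field_inverse lin_function_field
          of_poly_function_field flip: vord_nonneg_iff)
    \<comment> \<open>The orders of \<open>x - c\<close> and \<open>y\<close> are 1 and 0 off the
      ramification points, 2 and 1 at them. Either way dividing \<open>y\<close> by
      \<open>x - c\<close> produces a pole unless \<open>q\<close> vanishes at
      \<open>c\<close>.\<close>
    have pos: "vord (Affine c e) (of_poly s) > vord (Affine c e) (ff_y f)" "vord (Affine c e) (of_poly s) > 0"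
      using vord_linear[OF P, of c] vord_ff_y[OF P] by (auto simp: s_def)
    have "poly p c = 0"
    proof (rule ccontr)
      assume pc: "poly p c \<noteq> 0"
      then have p: "p + p \<noteq> 0"
        by (intro double_neq_0) auto
      have "affine.lin p q / of_poly s + affine.lin p (- q) / of_poly s = of_poly (p + p) / of_poly s"
        by (simp only: lin_add_conj flip: add_divide_distrib)
      then have "of_poly (p + p) / of_poly s \<in> local_ring f (Affine c e)"
        using local_ring_add[OF P k] by simp
      then have "0 \<le> vord (Affine c e) (of_poly (p + p) / of_poly s)"
        using p s by (subst vord_nonneg_iff[OF P])
          (simp_all only: divide_inverse function_field_mult function_field_inverse of_poly_function_field
            of_poly_simps(7) mult_eq_0_iff inverse_nonzero_iff_nonzero simp_thms)
      then have "vord (Affine c e) (of_poly (p + p)) > 0"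
        using vord_divide[OF P of_poly_function_field[of "p + p"] _ of_poly_function_field[of s]] pos p s
        by (simp only: of_poly_simps(7))
      then show False
        using vord_of_poly(2)[OF P p] pc char_neq_2 by (simp flip: mult_2)
    qed
    moreover have "poly q c = 0"
    proof (rule ccontr)
      assume qc: "poly q c \<noteq> 0"
      then have q: "q + q \<noteq> 0"
        by (intro double_neq_0) auto
      have qy: "of_poly (q + q) * ff_y f \<in> function_field f" "of_poly (q + q) * ff_y f \<noteq> 0"
        using q by (auto simp del: of_poly_simps(3) intro: function_field_mult of_poly_function_field ff_y_function_field)
      have "affine.lin p q / of_poly s - affine.lin p (- q) / of_poly s = of_poly (q + q) * ff_y f / of_poly s"
        by (simp only: lin_diff_conj flip: diff_divide_distrib)
      then have "of_poly (q + q) * ff_y f / of_poly s \<in> local_ring f (Affine c e)"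
        using local_ring_diff[OF P k] by simp
      then have "0 \<le> vord (Affine c e) (of_poly (q + q) * ff_y f / of_poly s)"
        using qy s by (subst vord_nonneg_iff[OF P])
          (simp_all only: divide_inverse function_field_mult[OF _ function_field_inverse] of_poly_function_field
            of_poly_simps(7) mult_eq_0_iff inverse_nonzero_iff_nonzero simp_thms)
      then have "vord (Affine c e) (of_poly (q + q)) > 0"
        using vord_divide[OF P qy of_poly_function_field[of s]] pos q s
          vord_mult[OF P of_poly_function_field[of "q + q"] _ ff_y_function_field]
        by (simp only: of_poly_simps(7)) simp
      then show False
        using vord_of_poly(2)[OF P q] qc char_neq_2 by (simp flip: mult_2)
    qed
    ultimately obtain p1 q1 where pq: "p = s * p1" "q = s * q1"
      unfolding s_def by (auto simp: poly_eq_0_iff_dvd elim!: dvdE)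
    have "affine.lin p q = of_poly s * affine.lin p1 q1"
      unfolding pq by (simp add: affine.lin_def algebra_simps)
    then have "h = affine.lin p1 q1 / of_poly r1"
      using h(2) s by (simp del: affine.lin_eq_0_iff)
    then have "Q (degree r1)"
      using s unfolding Q_def by blast
    then have "degree r \<le> degree r1"
      unfolding deg by (rule Least_le)
    then show False
      using s(3) by (simp add: r degree_mult_eq del: mult_pCons_left)
  qed
  then have "degree r = 0"
    using alg_closed_imp_poly_has_root by blast
  then obtain c where c: "r = [:c:]" by (rule degree_eq_zeroE)
  then have "c \<noteq> 0" using h by simp
  then have "1 = r * [:inverse c:]"
    using c by (simp add: one_pCons)
  then have "inverse (of_poly r) = of_poly [:inverse c:]"
    by (metis inverse_unique of_poly_simps(2,6))
  moreover have "affine.lin (p * t) (q * t) = affine.lin p q * of_poly t" for t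
    by (simp add: affine.lin_def algebra_simps)
  ultimately have "h = affine.lin (p * [:inverse c:]) (q * [:inverse c:])"
    using h(2) by (metis divide_inverse)
  then show ?thesis by blast
qed

text \<open>Infinity is fixed by the involution, so the conjugate has the same pole order. Then
  \<open>2 q y\<close>, the difference, has a pole of order at most 2g, although its order is
  \<open>2 * degree q + 2g + 1\<close> for \<open>q \<noteq> 0\<close>.\<close>

lemma small_pole_imp_polynomial:
  assumes "affine.lin p q \<noteq> 0" "- 2 * int (genus f) \<le> vord Infinity (affine.lin p q)"
  shows "q = 0"
proof (rule ccontr)
  assume "q \<noteq> 0"
  \<comment> \<open>Dividing by \<open>x^g\<close>, whose pole has order exactly 2g, turns the bound
    on the pole into membership in the local ring, which is closed under differences.\<close>
  define s :: "'a poly" where "s = [:0, 1:] ^ genus f"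
  have s: "s \<noteq> 0" "vord Infinity (of_poly s) = - 2 * int (genus f)"
    using vord_infinite_of_poly[of s] by (simp_all add: s_def degree_power_eq)
  have ne: "affine.lin p (- q) \<noteq> 0"
    using assms(1) by simp
  have "vord Infinity (affine.lin p (- q)) = vord Infinity (affine.lin p q)"
    using vord_hyp_inv[OF Infinity_curve assms(1)] by simp
  then have k: "affine.lin p q / of_poly s \<in> local_ring f Infinity"
      "affine.lin p (- q) / of_poly s \<in> local_ring f Infinity"
    using assms ne s vord_divide[OF Infinity_curve lin_function_field _ of_poly_function_field[of s]]
    by (simp_all add: divide_inverse function_field_mult function_field_inverse lin_function_field
          of_poly_function_field flip: vord_nonneg_iff)
  have q: "q + q \<noteq> 0"
    using \<open>q \<noteq> 0\<close> by (rule double_neq_0)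
  have qy: "of_poly (q + q) * ff_y f \<in> function_field f" "of_poly (q + q) * ff_y f \<noteq> 0"
    using q by (auto simp del: of_poly_simps(3) intro: function_field_mult of_poly_function_field ff_y_function_field)
  have "affine.lin p q / of_poly s - affine.lin p (- q) / of_poly s = of_poly (q + q) * ff_y f / of_poly s"
    by (simp only: lin_diff_conj flip: diff_divide_distrib)
  then have "of_poly (q + q) * ff_y f / of_poly s \<in> local_ring f Infinity"
    using local_ring_diff[OF Infinity_curve k] by simp
  then have "0 \<le> vord Infinity (of_poly (q + q) * ff_y f / of_poly s)"
    using qy s by (subst vord_nonneg_iff[OF Infinity_curve])
      (simp_all only: divide_inverse function_field_mult[OF _ function_field_inverse] of_poly_function_field
        of_poly_simps(7) mult_eq_0_iff inverse_nonzero_iff_nonzero simp_thms)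
  moreover have "vord Infinity (of_poly (q + q) * ff_y f / of_poly s) =
      - 2 * int (degree (q + q)) - (2 * int (genus f) + 1) + 2 * int (genus f)"
    using vord_divide[OF Infinity_curve qy of_poly_function_field[of s]] q s
      vord_mult[OF Infinity_curve of_poly_function_field[of "q + q"] _ ff_y_function_field]
      vord_infinite_of_poly[OF q] vord_infinite_ff_y
    by (simp only: of_poly_simps(7)) simp
  ultimately show False by simp
qed

end

subsection \<open>Divisors\<close>

text \<open>Each point is normalized separately, so the degree is 0 and copies of
  \<open>Infinity\<close> in \<open>M\<close> contribute nothing.\<close>

definition eff :: "'a curve_point multiset \<Rightarrow> 'a curve_point \<Rightarrow>\<^sub>0 int" where
  "eff M = (\<Sum>P\<in>#M. frag_of P - frag_of Infinity)"

lemma eff_simps [simp]: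
  "eff {#} = 0" "eff (M + N) = eff M + eff N"
  "eff (add_mset P M) = frag_of P - frag_of Infinity + eff M"
  by (simp_all add: eff_def)

lemma lookup_eff:
  "Poly_Mapping.lookup (eff M) P = (if P = Infinity then int (count M Infinity) - int (size M) else int (count M P))"
  by (induction M) (auto simp: lookup_add lookup_minus)

lemma keys_eff: "Poly_Mapping.keys (eff M) \<subseteq> insert Infinity (set_mset M)"
  by (auto simp: in_keys_iff lookup_eff split: if_splits)

lemma div_degree_superset:
  assumes "finite S" "Poly_Mapping.keys D \<subseteq> S"
  shows "div_degree D = (\<Sum>P\<in>S. Poly_Mapping.lookup D P)"
  unfolding div_degree_def using assms by (intro sum.mono_neutral_left) (auto simp: in_keys_iff)

lemma div_degree_add: "div_degree (D + E) = div_degree D + div_degree E"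
proof -
  define S where "S = Poly_Mapping.keys D \<union> Poly_Mapping.keys E"
  have "finite S" "Poly_Mapping.keys D \<subseteq> S" "Poly_Mapping.keys E \<subseteq> S" "Poly_Mapping.keys (D + E) \<subseteq> S"
    using keys_add[of D E] by (auto simp: S_def)
  then show ?thesis
    by (simp add: div_degree_superset[of S] lookup_add sum.distrib)
qed

lemma div_degree_0 [simp]: "div_degree 0 = 0"
  by (simp add: div_degree_def)

lemma div_degree_uminus: "div_degree (- D) = - div_degree D"
  using div_degree_add[of D "- D"] by simp

lemma div_degree_diff: "div_degree (D - E) = div_degree D - div_degree E"
  using div_degree_add[of D "- E"] div_degree_uminus[of E] by simp

lemma div_degree_frag_of: "div_degree (frag_of P) = 1"
  by (simp add: div_degree_def)

lemma div_degree_eff: "div_degree (eff M) = 0"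
  by (induction M) (auto simp: div_degree_add div_degree_diff div_degree_frag_of)

lemma div_degree_frag_cmul: "div_degree (frag_cmul c D) = c * div_degree D"
proof -
  have "div_degree (frag_cmul c D) = (\<Sum>P\<in>Poly_Mapping.keys D. c * Poly_Mapping.lookup D P)"
    using keys_cmul[of c D] by (subst div_degree_superset[of "Poly_Mapping.keys D"]) auto
  then show ?thesis
    by (simp add: div_degree_def sum_distrib_left)
qed

lemma frag_cmul_eff: "frag_cmul (int n) (eff M) = eff (repeat_mset n M)"
  by (induction n) (auto simp: frag_cmul_distrib)

lemma hyp_inv_hyp_inv [simp]: "hyp_inv (hyp_inv P) = P"
  by (cases P) auto

lemma hyp_inv_eq_Infinity_iff [simp]: "hyp_inv P = Infinity \<longleftrightarrow> P = Infinity"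
  by (cases P) auto

context hyperelliptic
begin

definition principal :: "('a curve_point \<Rightarrow>\<^sub>0 int) \<Rightarrow> bool" where
  "principal D \<longleftrightarrow> D \<in> principal_divisors f"

lemma principalI:
  assumes "Poly_Mapping.keys D \<subseteq> curve f" "h \<in> function_field f" "h \<noteq> 0"
    "\<And>P. P \<in> curve f \<Longrightarrow> Poly_Mapping.lookup D P = vord P h"
  shows "principal D"
  using assms by (auto simp: principal_def principal_divisors_def)

lemma principalE:
  assumes "principal D"
  obtains h where "Poly_Mapping.keys D \<subseteq> curve f" "h \<in> function_field f" "h \<noteq> 0"
    "\<And>P. P \<in> curve f \<Longrightarrow> Poly_Mapping.lookup D P = vord P h"
  using assms by (auto simp: principal_def principal_divisors_def)

lemma principal_add:
  assumes "principal D" "principal E"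
  shows "principal (D + E)"
proof -
  obtain h k where h: "Poly_Mapping.keys D \<subseteq> curve f" "h \<in> function_field f" "h \<noteq> 0"
      "\<And>P. P \<in> curve f \<Longrightarrow> Poly_Mapping.lookup D P = vord P h"
    and k: "Poly_Mapping.keys E \<subseteq> curve f" "k \<in> function_field f" "k \<noteq> 0"
      "\<And>P. P \<in> curve f \<Longrightarrow> Poly_Mapping.lookup E P = vord P k"
    using assms by (metis principalE)
  show ?thesis
    by (rule principalI[of _ "h * k"])
      (use h k keys_add[of D E] in \<open>auto simp: function_field_mult lookup_add vord_mult\<close>)
qed

lemma principal_uminus:
  assumes "principal D"
  shows "principal (- D)"
proof -
  obtain h where h: "Poly_Mapping.keys D \<subseteq> curve f" "h \<in> function_field f" "h \<noteq> 0"
      "\<And>P. P \<in> curve f \<Longrightarrow> Poly_Mapping.lookup D P = vord P h"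
    using assms by (metis principalE)
  show ?thesis
    by (rule principalI[of _ "inverse h"])
      (use h in \<open>auto simp: function_field_inverse vord_inverse\<close>)
qed

lemma principal_diff: "principal D \<Longrightarrow> principal E \<Longrightarrow> principal (D - E)"
  using principal_add[of D "- E"] principal_uminus by simp

lemma principal_0: "principal 0"
proof -
  have "vord P 1 = 0" if "P \<in> curve f" for P
    using vord_eqI[OF that has_order_unit[OF unit_of_1[OF that]]] .
  then show ?thesis
    using of_poly_function_field[of 1] by (intro principalI[of _ 1]) auto
qed

lemma principal_frag_cmul: "principal D \<Longrightarrow> principal (frag_cmul c D)"
  by (rule frag_closure_minus_cmul) (auto intro: principal_0 principal_diff)

lemma uminus_neq:
  assumes "(b :: 'a) \<noteq> 0"
  shows "- b \<noteq> b" "b \<noteq> - b"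
proof -
  show "- b \<noteq> b"
  proof
    assume "- b = b"
    then have "b + b = 0" by (metis add.right_inverse)
    then have "2 * b = 0" by (simp only: mult_2)
    then show False using assms char_neq_2 by (metis mult_eq_0_iff)
  qed
  then show "b \<noteq> - b" by (rule not_sym)
qed

lemma vord_linear_pair:
  assumes "Affine a b \<in> curve f" "P \<in> curve f"
  shows "Poly_Mapping.lookup (eff {#Affine a b, Affine a (- b)#}) P = vord P (of_poly [:- a, 1:])"
proof (cases P)
  case (Affine c e)
  have "e = b \<or> e = - b" if "c = a"
  proof -
    have "e ^ 2 = poly f a" "b ^ 2 = poly f a"
      using assms Affine that by (simp_all add: curve_def)
    then have "e ^ 2 = b ^ 2" by (rule trans[OF _ sym])
    then show ?thesis by (simp only: power2_eq_iff)
  qed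
  then show ?thesis
    using vord_linear[of c e a] assms(2) Affine uminus_neq[of b]
    by (cases "b = 0") (auto simp: lookup_add lookup_minus)
next
  case Infinity
  then show ?thesis
    using vord_infinite_of_poly[of "[:- a, 1:]"] by (simp add: lookup_add lookup_minus)
qed

lemma principal_pair:
  assumes "P \<in> curve f"
  shows "principal (eff {#P, hyp_inv P#})"
proof (cases P)
  case (Affine a b)
  have "Poly_Mapping.keys (eff {#P, hyp_inv P#}) \<subseteq> curve f"
    using keys_eff[of "{#P, hyp_inv P#}"] assms hyp_inv_curve by auto
  then show ?thesis
    using vord_linear_pair[of a b] assms Affine of_poly_function_field[of "[:- a, 1:]"]
    by (intro principalI[of _ "of_poly [:- a, 1:]"]) auto
next
  case Infinity
  then show ?thesis using principal_0 by simp
qed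

lemma principal_eff_hyp_inv:
  assumes "set_mset M \<subseteq> curve f"
  shows "principal (eff (M + image_mset hyp_inv M))"
  using assms
proof (induction M)
  case empty
  then show ?case by (simp add: principal_0)
next
  case (add P M)
  then have "principal (eff (M + image_mset hyp_inv M))" "principal (eff {#P, hyp_inv P#})"
    using principal_pair by auto
  from principal_add[OF this] show ?case
    by (simp add: algebra_simps)
qed

text \<open>A function with at most a pole of order \<open>2g\<close> at infinity is a polynomial in \<open>x\<close>, as \<open>y\<close> has a pole of order \<open>2g + 1\<close>.\<close>

lemma small_principal_symmetric:
  assumes "principal D" "\<And>P. P \<noteq> Infinity \<Longrightarrow> 0 \<le> Poly_Mapping.lookup D P"
    "- 2 * int (genus f) \<le> Poly_Mapping.lookup D Infinity" "P \<in> curve f"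
  shows "Poly_Mapping.lookup D (hyp_inv P) = Poly_Mapping.lookup D P"
proof -
  obtain h where h: "Poly_Mapping.keys D \<subseteq> curve f" "h \<in> function_field f" "h \<noteq> 0"
      "\<And>P. P \<in> curve f \<Longrightarrow> Poly_Mapping.lookup D P = vord P h"
    using principalE[OF assms(1)] by metis
  have "0 \<le> vord (Affine a b) h" if "Affine a b \<in> curve f" for a b
    using h(4)[OF that] assms(2)[of "Affine a b"] by simp
  from regular_imp_lin[OF h(2,3) this] obtain p q where pq: "h = affine.lin p q"
    by blast
  have "q = 0"
    using small_pole_imp_polynomial[of p q] h(3,4) assms(3) pq by simp
  then show ?thesis
    using vord_hyp_inv[OF assms(4), of p q] h(3,4) assms(4) hyp_inv_curve pq by simp
qed

subsection \<open>The Jacobian\<close>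

lemma mem_divisor_class: "E \<in> divisor_class f D \<longleftrightarrow> principal (E - D)"
proof -
  have "divisor_class f D = {H + D | H. principal H}"
    by (auto simp: divisor_class_def r_coset_def Div0_def principal_def)
  then show ?thesis by (auto intro: exI[of _ "E - D"])
qed

lemma divisor_class_eq_iff: "divisor_class f D = divisor_class f E \<longleftrightarrow> principal (D - E)"
proof
  assume "divisor_class f D = divisor_class f E"
  then have "D \<in> divisor_class f E"
    using mem_divisor_class[of D D] principal_0 by simp
  then show "principal (D - E)" by (simp add: mem_divisor_class)
next
  assume p: "principal (D - E)"
  have "principal (B - D) \<longleftrightarrow> principal (B - E)" for B
    using principal_add[of "B - D" "D - E"] principal_diff[of "B - E" "D - E"] p by auto
  then show "divisor_class f D = divisor_class f E"
    by (auto simp: mem_divisor_class)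
qed

lemma carrier_Div0: "D \<in> carrier (Div0 f) \<longleftrightarrow> Poly_Mapping.keys D \<subseteq> curve f \<and> div_degree D = 0"
  by (simp add: Div0_def)

lemma carrier_Jac: "carrier (Jac f) = divisor_class f ` carrier (Div0 f)"
  by (auto simp: Jac_def FactGroup_def RCOSETS_def divisor_class_def)

lemma one_Jac: "\<one>\<^bsub>Jac f\<^esub> = divisor_class f 0"
  by (auto simp: Jac_def FactGroup_def mem_divisor_class principal_def)

lemma mult_Jac: "divisor_class f D \<otimes>\<^bsub>Jac f\<^esub> divisor_class f E = divisor_class f (D + E)"
proof -
  have "divisor_class f D \<otimes>\<^bsub>Jac f\<^esub> divisor_class f E =
      {h + k | h k. h \<in> divisor_class f D \<and> k \<in> divisor_class f E}"
    by (auto simp: Jac_def FactGroup_def set_mult_def Div0_def)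
  also have "\<dots> = divisor_class f (D + E)"
  proof (rule subset_antisym; rule subsetI)
    fix B assume "B \<in> {h + k | h k. h \<in> divisor_class f D \<and> k \<in> divisor_class f E}"
    then show "B \<in> divisor_class f (D + E)"
      using principal_add by (force simp: mem_divisor_class algebra_simps)
  next
    fix B assume "B \<in> divisor_class f (D + E)"
    then have "principal (B - E - D)" "principal (E - E)" "B = B - E + E"
      by (simp_all add: mem_divisor_class principal_0 algebra_simps)
    then show "B \<in> {h + k | h k. h \<in> divisor_class f D \<and> k \<in> divisor_class f E}"
      unfolding mem_divisor_class by blast
  qed
  finally show ?thesis .
qed

lemma Div0_closed:
  "0 \<in> carrier (Div0 f)"
  "D \<in> carrier (Div0 f) \<Longrightarrow> E \<in> carrier (Div0 f) \<Longrightarrow> D + E \<in> carrier (Div0 f)"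
  "D \<in> carrier (Div0 f) \<Longrightarrow> frag_cmul c D \<in> carrier (Div0 f)"
  using keys_add[of D E] keys_cmul[of c D] by (auto simp: carrier_Div0 div_degree_add div_degree_frag_cmul)

lemma comm_group_Jac: "comm_group (Jac f)"
proof (rule comm_groupI)
  fix x y z assume "x \<in> carrier (Jac f)" "y \<in> carrier (Jac f)" "z \<in> carrier (Jac f)"
  then show "x \<otimes>\<^bsub>Jac f\<^esub> y \<otimes>\<^bsub>Jac f\<^esub> z = x \<otimes>\<^bsub>Jac f\<^esub> (y \<otimes>\<^bsub>Jac f\<^esub> z)"
    by (auto simp: carrier_Jac mult_Jac Div0_closed add.assoc)
next
  fix x y assume "x \<in> carrier (Jac f)" "y \<in> carrier (Jac f)"
  then show "x \<otimes>\<^bsub>Jac f\<^esub> y = y \<otimes>\<^bsub>Jac f\<^esub> x"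
    by (auto simp: carrier_Jac mult_Jac add.commute)
  show "x \<otimes>\<^bsub>Jac f\<^esub> y \<in> carrier (Jac f)"
    using \<open>x \<in> carrier (Jac f)\<close> \<open>y \<in> carrier (Jac f)\<close> by (auto simp: carrier_Jac mult_Jac Div0_closed)
next
  fix x assume "x \<in> carrier (Jac f)"
  then obtain D where D: "D \<in> carrier (Div0 f)" "x = divisor_class f D"
    by (auto simp: carrier_Jac)
  then show "\<one>\<^bsub>Jac f\<^esub> \<otimes>\<^bsub>Jac f\<^esub> x = x"
    by (simp add: one_Jac mult_Jac)
  have "divisor_class f (- D) \<in> carrier (Jac f)"
    using Div0_closed(3)[OF D(1), of "- 1"] by (auto simp: carrier_Jac)
  then show "\<exists>y\<in>carrier (Jac f). y \<otimes>\<^bsub>Jac f\<^esub> x = \<one>\<^bsub>Jac f\<^esub>"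
    by (rule bexI[rotated]) (simp add: D one_Jac mult_Jac)
qed (auto simp: one_Jac carrier_Jac Div0_closed)

sublocale Jac: comm_group "Jac f"
  by (rule comm_group_Jac)

lemma divisor_class_closed: "D \<in> carrier (Div0 f) \<Longrightarrow> divisor_class f D \<in> carrier (Jac f)"
  by (simp add: carrier_Jac)

lemma pow_Jac: "divisor_class f D [^]\<^bsub>Jac f\<^esub> (n::nat) = divisor_class f (frag_cmul (int n) D)"
  by (induction n) (auto simp: one_Jac mult_Jac frag_cmul_distrib add.commute)

lemma inv_Jac:
  assumes "D \<in> carrier (Div0 f)"
  shows "inv\<^bsub>Jac f\<^esub> divisor_class f D = divisor_class f (- D)"
  using assms Div0_closed(3)[OF assms, of "- 1"]
  by (intro Jac.inv_equality) (auto simp: mult_Jac one_Jac divisor_class_closed)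

lemma ord_dvd_iff:
  assumes "D \<in> carrier (Div0 f)"
  shows "group.ord (Jac f) (divisor_class f D) dvd n \<longleftrightarrow> principal (frag_cmul (int n) D)"
  using Jac.pow_eq_id[OF divisor_class_closed[OF assms], of n]
  by (simp add: pow_Jac one_Jac divisor_class_eq_iff)

lemma eff_carrier: "set_mset M \<subseteq> curve f \<Longrightarrow> eff M \<in> carrier (Div0 f)"
  using keys_eff[of M] by (auto simp: carrier_Div0 div_degree_eff)

lemma finprod_point_class:
  assumes "finite A" "\<And>i. i \<in> A \<Longrightarrow> Q i \<in> curve f"
  shows "finprod (Jac f) (\<lambda>i. point_class f (Q i)) A = divisor_class f (eff (image_mset Q (mset_set A)))"
  using assms
proof induction
  case empty
  then show ?case by (simp add: one_Jac)
next
  case (insert i A)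
  have "point_class f (Q j) \<in> carrier (Jac f)" if "j \<in> insert i A" for j
    using divisor_class_closed[OF eff_carrier[of "{#Q j#}"]] insert.prems[OF that] by (simp add: point_class_def)
  then show ?case
    using insert by (subst Jac.finprod_insert) (auto simp: point_class_def mult_Jac)
qed

text \<open>Weaker than the usual notion for Mumford representations: a point fixed by
  \<open>hyp_inv\<close> may occur with any multiplicity.\<close>

definition semireduced :: "'a curve_point multiset \<Rightarrow> bool" where
  "semireduced M \<longleftrightarrow> (\<forall>P\<in>#M. hyp_inv P \<in># M \<longrightarrow> hyp_inv P = P)"

text \<open>A representative of least size works: discarding a copy of \<open>Infinity\<close> or a
  pair \<open>P\<close>, \<open>hyp_inv P\<close> does not change the class.\<close>

lemma Theta_semireduced:
  assumes "a \<in> Theta f d"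
  obtains M where "set_mset M \<subseteq> curve f - {Infinity}" "size M \<le> d" "semireduced M"
    "a = divisor_class f (eff M)"
proof -
  define R where "R n \<longleftrightarrow> (\<exists>M. set_mset M \<subseteq> curve f \<and> a = divisor_class f (eff M) \<and> size M = n)" for n
  obtain Q where Q: "\<And>i. i \<in> {1..d} \<Longrightarrow> Q i \<in> curve f" "a = finprod (Jac f) (\<lambda>i. point_class f (Q i)) {1..d}"
    using assms unfolding Theta_def by blast
  have "a = divisor_class f (eff (image_mset Q (mset_set {1..d})))"
    unfolding Q(2) using finprod_point_class[OF finite_atLeastAtMost Q(1)] by simp
  then have "R d"
    unfolding R_def using Q(1) by (intro exI[of _ "image_mset Q (mset_set {1..d})"]) auto
  then have "R (LEAST n. R n)" "(LEAST n. R n) \<le> d"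
    by (auto intro: LeastI Least_le)
  then obtain M where M: "set_mset M \<subseteq> curve f" "a = divisor_class f (eff M)" "size M = (LEAST n. R n)"
    by (auto simp: R_def)
  have minimal: "size M \<le> size N" if "set_mset N \<subseteq> curve f" "principal (eff M - eff N)" for N
    unfolding M(3) using that M(2) by (intro Least_le) (auto simp: R_def divisor_class_eq_iff)
  have "Infinity \<notin># M"
  proof
    assume "Infinity \<in># M"
    then obtain N where "M = add_mset Infinity N" by (metis multi_member_split)
    then show False using minimal[of N] M(1) principal_0 by simp
  qed
  moreover have "semireduced M"
    unfolding semireduced_def
  proof (intro ballI impI, rule ccontr)
    fix P assume P: "P \<in># M" "hyp_inv P \<in># M" "hyp_inv P \<noteq> P"
    then obtain N where "M = add_mset P (add_mset (hyp_inv P) N)"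
      by (metis insert_noteq_member multi_member_split)
    then show False
      using minimal[of N] M(1) principal_pair[of P] by (simp add: algebra_simps)
  qed
  ultimately show ?thesis
    using that[of M] M \<open>(LEAST n. R n) \<le> d\<close> by auto
qed

lemma two_torsion:
  assumes "set_mset M \<subseteq> curve f" "\<forall>P\<in>#M. hyp_inv P = P"
  shows "principal (frag_cmul 2 (eff M))"
proof -
  have "image_mset hyp_inv M = M"
    using assms(2) by (metis multiset.map_cong0 multiset.map_ident)
  then show ?thesis
    using principal_eff_hyp_inv[OF assms(1)] frag_cmul_distrib[of 1 1 "eff M"] by simp
qed

subsection \<open>Specialization of torsion points\<close>

text \<open>The value at \<open>Infinity\<close> is a dummy; the products below run over multisets
  that avoid this point.\<close>

fun x_of :: "'a curve_point \<Rightarrow> 'a" where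
  "x_of (Affine a b) = a"
| "x_of Infinity = 0"

lemma lookup_eff_image_hyp_inv:
  "Poly_Mapping.lookup (eff (image_mset hyp_inv M)) P = Poly_Mapping.lookup (eff M) (hyp_inv P)"
proof -
  have "count (image_mset hyp_inv M) P = count M (hyp_inv P)" for P
    by (induction M) auto
  then show ?thesis
    by (cases P) (simp_all add: lookup_eff)
qed

text \<open>The product has divisor n times the sum of \<open>eff M\<close> and its image under
  \<open>hyp_inv\<close>, since each \<open>x - a\<close> cuts out a point together with its
  conjugate.\<close>

lemma vord_prod:
  assumes "set_mset M \<subseteq> curve f - {Infinity}" "P \<in> curve f"
  shows "vord P (of_poly (\<Prod>Q\<in>#M. [:- x_of Q, 1:] ^ n)) =
    int n * (Poly_Mapping.lookup (eff M) P + Poly_Mapping.lookup (eff M) (hyp_inv P))"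
  using assms(1)
proof (induction M)
  case empty
  then show ?case
    using vord_eqI[OF assms(2) has_order_unit[OF unit_of_1[OF assms(2)]]] by simp
next
  case (add Q M)
  then obtain a b where Q: "Q = Affine a b" "Affine a b \<in> curve f"
    by (cases Q) auto
  have ne: "of_poly (\<Prod>Q\<in>#M. [:- x_of Q, 1:] ^ n) \<noteq> 0" "of_poly ([:- a, 1:] ^ n) \<noteq> 0" "of_poly [:- a, 1:] \<noteq> 0"
    by (auto simp: prod_mset_zero_iff)
  have "vord P (of_poly (\<Prod>Q\<in>#add_mset Q M. [:- x_of Q, 1:] ^ n)) =
      vord P (of_poly ([:- a, 1:] ^ n) * of_poly (\<Prod>Q\<in>#M. [:- x_of Q, 1:] ^ n))"
    by (simp only: image_mset_add_mset prod_mset.add_mset Q(1) x_of.simps of_poly_simps(6))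
  also have "\<dots> = vord P (of_poly ([:- a, 1:] ^ n)) + vord P (of_poly (\<Prod>Q\<in>#M. [:- x_of Q, 1:] ^ n))"
    by (rule vord_mult[OF assms(2) of_poly_function_field ne(2) of_poly_function_field ne(1)])
  also have "vord P (of_poly ([:- a, 1:] ^ n)) = int n * vord P (of_poly [:- a, 1:])"
    unfolding of_poly_power by (rule vord_power[OF assms(2) of_poly_function_field ne(3)])
  also have "vord P (of_poly [:- a, 1:]) =
      Poly_Mapping.lookup (eff {#Q#} + eff (image_mset hyp_inv {#Q#})) P"
    using vord_linear_pair[OF Q(2) assms(2)] by (simp add: Q(1))
  finally show ?case
    using add unfolding lookup_add lookup_eff_image_hyp_inv
    by (simp add: lookup_add distrib_left)
qed

lemma vord_of_poly_order:
  assumes "Affine a b \<in> curve f" "p \<noteq> 0"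
  shows "vord (Affine a b) (of_poly p) = int (order a p) * (if b = 0 then 2 else 1)"
proof -
  obtain q where q: "p = [:- a, 1:] ^ order a p * q" "poly q a \<noteq> 0"
    using order_decomp[OF assms(2), of a] by (auto simp: poly_eq_0_iff_dvd)
  then have ne: "q \<noteq> 0" "of_poly ([:- a, 1:] ^ order a p) \<noteq> 0" "of_poly [:- a, 1:] \<noteq> 0"
    by auto
  have "vord (Affine a b) (of_poly p) = vord (Affine a b) (of_poly ([:- a, 1:] ^ order a p) * of_poly q)"
    by (subst q(1)) (simp only: of_poly_simps)
  also have "\<dots> = vord (Affine a b) (of_poly ([:- a, 1:] ^ order a p)) + vord (Affine a b) (of_poly q)"
    using ne by (intro vord_mult assms(1) of_poly_function_field) auto
  also have "vord (Affine a b) (of_poly q) = 0"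
    using vord_of_poly(2)[OF assms(1) ne(1)] q(2) by simp
  also have "vord (Affine a b) (of_poly ([:- a, 1:] ^ order a p)) =
      int (order a p) * vord (Affine a b) (of_poly [:- a, 1:])"
    unfolding of_poly_power by (rule vord_power[OF assms(1) of_poly_function_field ne(3)])
  finally show ?thesis
    using vord_linear[OF assms(1), of a] by simp
qed

lemma proots_linear_factors: "proots (\<Prod>x\<in>#A. [:- x, 1:]) = (A :: 'a multiset)"
proof (induction A)
  case (add x A)
  have "(\<Prod>x\<in>#A. [:- x, 1:]) \<noteq> (0 :: 'a poly)"
    by (auto simp: prod_mset_zero_iff)
  then have "proots ([:- x, 1:] * (\<Prod>x\<in>#A. [:- x, 1:])) = {#x#} + A"
    using add by (subst proots_mult) (auto simp del: mult_pCons_left)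
  then show ?case by (simp del: mult_pCons_left)
qed simp

text \<open>Some point of the curve lies over every \<open>a\<close>, and the vanishing order there
  is the multiplicity of the root \<open>a\<close> times a factor that depends on the point only. So
  the roots agree with multiplicity.\<close>

lemma proportional_polys:
  assumes "p \<noteq> 0" "q \<noteq> 0" "\<And>P. P \<in> curve f \<Longrightarrow> vord P (of_poly p) = vord P (of_poly q)"
  obtains c where "c \<noteq> 0" "p = smult c q"
proof -
  have "proots p = proots q"
  proof (rule multiset_eqI)
    fix a
    obtain b where "b ^ 2 = poly f a"
      using nth_root_exists[of 2] by auto
    then have "Affine a b \<in> curve f" by (auto simp: curve_def)
    then show "count (proots p) a = count (proots q) a"
      using assms(3)[of "Affine a b"] vord_of_poly_order assms(1,2) by (auto split: if_splits)
  qed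
  moreover have "p = smult (lead_coeff p) (\<Prod>x\<in>#proots p. [:- x, 1:])" if "p \<noteq> 0" for p :: "'a poly"
  proof -
    obtain A where A: "p = smult (lead_coeff p) (\<Prod>x\<in>#A. [:- x, 1:])"
      using alg_closed_imp_factorization[OF \<open>p \<noteq> 0\<close>] by blast
    have "proots p = A"
      using \<open>p \<noteq> 0\<close> by (subst A) (simp add: proots_linear_factors)
    then show ?thesis using A by simp
  qed
  ultimately have "p = smult (lead_coeff p / lead_coeff q) q"
    using assms(1,2) by (metis nonzero_divide_eq_eq leading_coeff_0_iff smult_smult)
  then show ?thesis
    using that[of "lead_coeff p / lead_coeff q"] assms(1,2) by simp
qed

text \<open>
  For a semireduced \<open>M\<close> the equality \<open>div h = n M - n deg M \<infinity>\<close> amounts to an equation for the norm of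
  \<open>h\<close> together with the nonvanishing of \<open>h\<close> at the conjugates of the points of \<open>M\<close>.
\<close>

lemma torsion_certificate:
  assumes M: "set_mset M \<subseteq> curve f - {Infinity}" "semireduced M"
    and "principal (frag_cmul (int n) (eff M))"
  obtains p q c where "c \<noteq> 0" "p ^ 2 - q ^ 2 * f = smult c (\<Prod>Q\<in>#M. [:- x_of Q, 1:] ^ n)"
    "\<And>a b. Affine a b \<in># M \<Longrightarrow> b \<noteq> 0 \<Longrightarrow> poly p a - poly q a * b \<noteq> 0"
proof -
  obtain h where h: "h \<in> function_field f" "h \<noteq> 0"
    "\<And>P. P \<in> curve f \<Longrightarrow> int n * Poly_Mapping.lookup (eff M) P = vord P h"
    using principalE[OF assms(3)] by (metis lookup_frag_cmul)
  have "0 \<le> vord (Affine a b) h" if "Affine a b \<in> curve f" for a b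
  proof -
    have "vord (Affine a b) h = int (n * count M (Affine a b))"
      using h(3)[OF that] by (simp add: lookup_eff)
    then show ?thesis by simp
  qed
  from regular_imp_lin[OF h(1,2) this] obtain p q where pq: "h = affine.lin p q"
    by blast
  define N where "N = p ^ 2 - q ^ 2 * f"
  have ne: "affine.lin p q \<noteq> 0" "affine.lin p (- q) \<noteq> 0"
    using h(2) pq by auto
  have N: "of_poly N = affine.lin p q * affine.lin p (- q)"
    by (simp only: N_def affine.lin_conj)
  then have "N \<noteq> 0" using ne of_poly_simps(7) by (metis mult_eq_0_iff)
  have "vord P (of_poly N) = vord P (of_poly (\<Prod>Q\<in>#M. [:- x_of Q, 1:] ^ n))" if P: "P \<in> curve f" for P
  proof -
    have "vord (hyp_inv P) (affine.lin p q) = vord P (affine.lin p (- q))"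
      using vord_hyp_inv[OF P ne(2)] by simp
    then have "vord P (of_poly N) = vord P h + vord (hyp_inv P) h"
      unfolding N pq using vord_mult[OF P lin_function_field ne(1) lin_function_field ne(2)] by simp
    then show ?thesis
      using vord_prod[OF M(1) P, of n] h(3)[OF P] h(3)[OF hyp_inv_curve[OF P]] by (simp add: distrib_left)
  qed
  moreover have "(\<Prod>Q\<in>#M. [:- x_of Q, 1:] ^ n) \<noteq> 0"
    by (auto simp: prod_mset_zero_iff)
  ultimately obtain c where c: "c \<noteq> 0" "N = smult c (\<Prod>Q\<in>#M. [:- x_of Q, 1:] ^ n)"
    using proportional_polys[OF \<open>N \<noteq> 0\<close>] by metis
  have "poly p a - poly q a * b \<noteq> 0" if ab: "Affine a b \<in># M" "b \<noteq> 0" for a b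
  proof -
    have P: "Affine a (- b) \<in> curve f"
      using M(1) ab(1) hyp_inv_curve[of "Affine a b"] by auto
    \<comment> \<open>Semireducedness keeps the conjugate point out of the divisor of
      \<open>h\<close>, so \<open>h\<close> takes a nonzero value there, namely
      \<open>poly p a - poly q a * b\<close>.\<close>
    have "Affine a (- b) \<notin># M"
      using M(2) ab uminus_neq[OF ab(2)] by (auto simp: semireduced_def)
    then have "vord (Affine a (- b)) h = 0"
      using h(3)[OF P] by (simp add: lookup_eff not_in_iff)
    then show ?thesis
      using vord_affine_lin(2)[OF P ne(1)] pq by simp
  qed
  then show ?thesis
    using that[OF c(1)] c(2) unfolding N_def by blast
qed

text \<open>The norm only determines the sum of the orders of \<open>lin p q\<close> at
  \<open>P\<close> and \<open>hyp_inv P\<close>; the nonvanishing condition puts all of it on the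
  point in \<open>M\<close>. If both points of a non-fixed pair were in \<open>M\<close>, both
  orders would be 0 against a positive sum, so semireducedness is a conclusion here. This matters
  because points may collide under specialization.\<close>

lemma certificate_imp_torsion:
  assumes M: "set_mset M \<subseteq> curve f - {Infinity}" and n: "n > 0" and c: "c \<noteq> 0"
    and norm: "p ^ 2 - q ^ 2 * f = smult c (\<Prod>Q\<in>#M. [:- x_of Q, 1:] ^ n)"
    and nonzero: "\<And>a b. Affine a b \<in># M \<Longrightarrow> b \<noteq> 0 \<Longrightarrow> poly p a - poly q a * b \<noteq> 0"
  shows "semireduced M" "principal (frag_cmul (int n) (eff M))"
proof -
  define N where "N = p ^ 2 - q ^ 2 * f"
  define N' where "N' = (\<Prod>Q\<in>#M. [:- x_of Q, 1:] ^ n)"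
  have N': "N' \<noteq> 0" by (auto simp: N'_def prod_mset_zero_iff)
  have "N \<noteq> 0" unfolding N_def norm using c N' by (simp add: N'_def)
  have N: "of_poly N = affine.lin p q * affine.lin p (- q)"
    by (simp only: N_def affine.lin_conj)
  have ne: "affine.lin p q \<noteq> 0" "affine.lin p (- q) \<noteq> 0"
    using N \<open>N \<noteq> 0\<close> of_poly_simps(7)[of N] by (metis mult_eq_0_iff)+
  define w where "w P = vord P (affine.lin p q)" for P
  have w_sum: "w P + w (hyp_inv P) =
      int n * (Poly_Mapping.lookup (eff M) P + Poly_Mapping.lookup (eff M) (hyp_inv P))" if P: "P \<in> curve f" for P
  proof -
    have "w (hyp_inv P) = vord P (affine.lin p (- q))"
      unfolding w_def using vord_hyp_inv[OF P ne(2)] by simp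
    then have "w P + w (hyp_inv P) = vord P (of_poly N)"
      unfolding N w_def using vord_mult[OF P lin_function_field ne(1) lin_function_field ne(2)] by simp
    also have "of_poly N = of_poly [:c:] * of_poly N'"
      unfolding of_poly_simps(6)[symmetric] N_def norm N'_def by simp
    also have "vord P \<dots> = vord P (of_poly [:c:]) + vord P (of_poly N')"
      using c N' by (intro vord_mult P of_poly_function_field) auto
    also have "vord P (of_poly [:c:]) = 0"
      using c P vord_of_poly(2)[of _ _ "[:c:]"] vord_infinite_of_poly[of "[:c:]"] by (cases P) auto
    finally show ?thesis
      unfolding N'_def vord_prod[OF M P] by simp
  qed
  have w_nonneg: "0 \<le> w P" if "P \<in> curve f" "P \<noteq> Infinity" for P
    using that vord_affine_lin(1)[OF _ ne(1)] by (cases P) (auto simp: w_def)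
  have w_conj: "w (hyp_inv P) = 0" if P: "P \<in># M" "hyp_inv P \<noteq> P" for P
  proof -
    obtain a b where ab: "P = Affine a b" "b \<noteq> 0"
      using P by (cases P) auto
    have "Affine a (- b) \<in> curve f"
      using M P(1) ab hyp_inv_curve[of "Affine a b"] by auto
    from vord_affine_lin(2)[OF this ne(1)] show ?thesis
      using nonzero P ab by (simp add: w_def)
  qed
  have curve: "P \<in> curve f \<and> P \<noteq> Infinity" if "P \<in># M" for P
    using M that by auto
  have disjoint: "hyp_inv P \<notin># M" if P: "P \<in># M" "hyp_inv P \<noteq> P" for P
  proof
    assume "hyp_inv P \<in># M"
    then have "w P = 0"
      using w_conj[of "hyp_inv P"] P by simp
    then have "int n * (int (count M P) + int (count M (hyp_inv P))) = 0"
      using w_sum[of P] w_conj[OF P] curve[OF P(1)] by (simp add: lookup_eff)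
    then show False
      using n count_greater_zero_iff[of M P] P(1) by (simp del: count_greater_zero_iff)
  qed
  then show "semireduced M"
    by (auto simp: semireduced_def)
  have "int n * Poly_Mapping.lookup (eff M) P = w P" if P: "P \<in> curve f" for P
  proof (cases "hyp_inv P = P")
    case True
    then show ?thesis using w_sum[OF P] by simp
  next
    case False
    then have fin: "P \<noteq> Infinity" "hyp_inv P \<noteq> Infinity" by (cases P; auto)+
    have sum: "w P + w (hyp_inv P) = int n * int (count M P) + int n * int (count M (hyp_inv P))"
      using w_sum[OF P] fin by (simp add: lookup_eff distrib_left)
    consider "P \<in># M" | "hyp_inv P \<in># M" | "P \<notin># M" "hyp_inv P \<notin># M" by blast
    then have "int n * int (count M P) = w P"
    proof cases
      case 1
      then show ?thesis
        using sum w_conj[OF 1 False] disjoint[OF 1 False] by (simp add: not_in_iff)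
    next
      case 2
      then have "P \<notin># M" "w P = 0"
        using disjoint[of "hyp_inv P"] w_conj[of "hyp_inv P"] False by auto
      then show ?thesis by (simp add: not_in_iff)
    next
      \<comment> \<open>Away from infinity both orders are nonnegative, so a zero sum makes both
        0.\<close>
      case 3
      then have "w P + w (hyp_inv P) = 0"
        using sum by (simp add: not_in_iff)
      then show ?thesis
        using 3(1) w_nonneg[OF P fin(1)] w_nonneg[OF hyp_inv_curve[OF P] fin(2)]
        by (simp add: not_in_iff)
    qed
    then show ?thesis using fin by (simp add: lookup_eff)
  qed
  moreover have "Poly_Mapping.keys (frag_cmul (int n) (eff M)) \<subseteq> curve f"
    using keys_cmul[of "int n" "eff M"] keys_eff[of M] M by auto
  ultimately show "principal (frag_cmul (int n) (eff M))"
    using ne by (intro principalI[OF _ lin_function_field ne(1)]) (auto simp: w_def)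
qed

text \<open>The set \<open>E\<close> gathers the finitely many elements in the certificate.
  \<open>\<phi>\<close> fixes the coefficients of \<open>f\<close>, so the norm equation and the
  curve equation are preserved, and the values required to be nonzero stay nonzero.\<close>

lemma torsion_specialization:
  assumes L: "alg_closed_subfield L" "coeffs_in L f"
    and M: "set_mset M \<subseteq> curve f - {Infinity}" "semireduced M"
    and n: "n > 0" "principal (frag_cmul (int n) (eff M))"
  obtains M' where "set_mset M' \<subseteq> curve_over L f - {Infinity}" "size M' = size M" "semireduced M'"
    "principal (frag_cmul (int n) (eff M'))"
    "\<forall>P\<in>#M'. hyp_inv P = P \<Longrightarrow> \<forall>P\<in>#M. hyp_inv P = P"
proof -
  obtain p q c where c: "c \<noteq> 0"
    and norm: "p ^ 2 - q ^ 2 * f = smult c (\<Prod>Q\<in>#M. [:- x_of Q, 1:] ^ n)"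
    and nonzero: "\<And>a b. Affine a b \<in># M \<Longrightarrow> b \<noteq> 0 \<Longrightarrow> poly p a - poly q a * b \<noteq> 0"
    using torsion_certificate[OF M n(2)] by metis
  define E where "E = insert c (set (coeffs p) \<union> set (coeffs q) \<union> (\<Union>P\<in>set_mset M. set_curve_point P) \<union>
    (\<lambda>P. case P of Affine a b \<Rightarrow> poly p a - poly q a * b | Infinity \<Rightarrow> 0) ` set_mset M)"
  have "finite (set_curve_point P)" for P :: "'a curve_point"
    by (cases P) auto
  then have "finite E" by (simp add: E_def)
  then obtain R \<phi> where \<phi>: "specialization L R \<phi>" "E \<subseteq> R" "\<And>e. e \<in> E \<Longrightarrow> e \<noteq> 0 \<Longrightarrow> \<phi> e \<noteq> 0"
    using alg_closed_subfield.exists_specialization[OF L(1)] by metis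
  interpret specialization L R \<phi> by (rule \<phi>)
  have coeffs: "coeffs_in R r" if "set (coeffs r) \<subseteq> E" for r
    unfolding coeffs_in_def
  proof
    fix i show "coeff r i \<in> R"
      using that \<phi>(2) zero_mem coeff_in_coeffs[of r i]
      by (cases "r = 0 \<or> degree r < i") (auto simp: coeff_eq_0)
  qed
  have p: "coeffs_in R p" and q: "coeffs_in R q"
    by (auto intro: coeffs simp: E_def)
  have f: "coeffs_in R f" "map_poly \<phi> f = f"
    using L(2) L_subset by (auto simp: coeffs_in_def map_poly_fixed)
  have "c \<in> R" using \<phi>(2) by (auto simp: E_def)
  have ab: "a \<in> R" "b \<in> R" if "Affine a b \<in># M" for a b
    using that \<phi>(2) by (force simp: E_def)+
  define M' where "M' = image_mset (map_curve_point \<phi>) M"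
  have M_affine: "\<exists>a b. P = Affine a b \<and> b ^ 2 = poly f a" if "P \<in># M" for P
    using M(1) that by (auto simp: curve_def)
  have M': "set_mset M' \<subseteq> curve_over L f - {Infinity}"
  proof
    fix P assume "P \<in># M'"
    then obtain Q where "Q \<in># M" "P = map_curve_point \<phi> Q"
      by (auto simp: M'_def)
    then obtain a b where *: "Affine a b \<in># M" "b ^ 2 = poly f a" "P = Affine (\<phi> a) (\<phi> b)"
      using M_affine by fastforce
    have "\<phi> b ^ 2 = poly f (\<phi> a)"
      using arg_cong[OF *(2), of \<phi>] ab[OF *(1)] f by (simp add: map_power map_poly_eval)
    then show "P \<in> curve_over L f - {Infinity}"
      using * ab[OF *(1)] by (auto simp: curve_over_def curve_def maps_to)
  qed
  have nonzero': "poly (map_poly \<phi> p) a - poly (map_poly \<phi> q) a * b \<noteq> 0"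
    if M'_ab: "Affine a b \<in># M'" "b \<noteq> 0" for a b
  proof -
    obtain Q where "Affine a b = map_curve_point \<phi> Q" "Q \<in># M"
      using M'_ab(1) by (auto simp: M'_def)
    then obtain a0 b0 where *: "Affine a0 b0 \<in># M" "a = \<phi> a0" "b = \<phi> b0"
      using M_affine by fastforce
    then have "b0 \<noteq> 0"
      using M'_ab(2) by auto
    then have "poly p a0 - poly q a0 * b0 \<noteq> 0"
      using nonzero *(1) by blast
    moreover have "poly p a0 - poly q a0 * b0 \<in> E"
      using *(1) unfolding E_def by (intro insertI2 UnI2) (rule rev_image_eqI, auto)
    ultimately have "\<phi> (poly p a0 - poly q a0 * b0) \<noteq> 0"
      using \<phi>(3) by blast
    then show ?thesis
      using p q ab[OF *(1)] by (simp add: * map_diff map_mult map_poly_eval poly_mem mult_mem)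
  qed
  have lin: "coeffs_in R [:- x_of Q, 1:] \<and> map_poly \<phi> [:- x_of Q, 1:] = [:- x_of (map_curve_point \<phi> Q), 1:]"
    if "Q \<in># M" for Q
    using M_affine[OF that] ab that by (auto simp: map_poly_pCons map_uminus uminus_mem one_mem)
  have prod: "coeffs_in R (\<Prod>Q\<in>#M. [:- x_of Q, 1:] ^ n)"
    "map_poly \<phi> (\<Prod>Q\<in>#M. [:- x_of Q, 1:] ^ n) = (\<Prod>Q\<in>#M'. [:- x_of Q, 1:] ^ n)"
  proof -
    have *: "coeffs_in R ([:- x_of Q, 1:] ^ n)"
      "map_poly \<phi> ([:- x_of Q, 1:] ^ n) = [:- x_of (map_curve_point \<phi> Q), 1:] ^ n" if "Q \<in># M" for Q
      using map_poly_power[of "[:- x_of Q, 1:]" n] lin[OF that] by auto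
    show "coeffs_in R (\<Prod>Q\<in>#M. [:- x_of Q, 1:] ^ n)"
      using map_poly_prod_mset[of M "\<lambda>Q. [:- x_of Q, 1:] ^ n"] *(1) by blast
    have "map_poly \<phi> (\<Prod>Q\<in>#M. [:- x_of Q, 1:] ^ n) = (\<Prod>Q\<in>#M. map_poly \<phi> ([:- x_of Q, 1:] ^ n))"
      using map_poly_prod_mset[of M "\<lambda>Q. [:- x_of Q, 1:] ^ n"] *(1) by blast
    also have "image_mset (\<lambda>Q. map_poly \<phi> ([:- x_of Q, 1:] ^ n)) M = image_mset (\<lambda>Q. [:- x_of Q, 1:] ^ n) M'"
      unfolding M'_def image_mset.compositionality o_def by (intro image_mset_cong *(2))
    finally show "map_poly \<phi> (\<Prod>Q\<in>#M. [:- x_of Q, 1:] ^ n) = (\<Prod>Q\<in>#M'. [:- x_of Q, 1:] ^ n)" .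
  qed
  have norm': "map_poly \<phi> p ^ 2 - map_poly \<phi> q ^ 2 * f = smult (\<phi> c) (\<Prod>Q\<in>#M'. [:- x_of Q, 1:] ^ n)"
    using arg_cong[OF norm, of "map_poly \<phi>"] p q f \<open>c \<in> R\<close> prod map_poly_power[OF p, of 2] map_poly_power[OF q, of 2]
    by (simp add: map_poly_diff map_poly_mult coeffs_in_mult map_poly_smult)
  have "\<phi> c \<noteq> 0"
    using \<phi>(3) c by (auto simp: E_def)
  have "set_mset M' \<subseteq> curve f - {Infinity}"
    using M' by (auto simp: curve_over_def)
  note torsion = certificate_imp_torsion[OF this n(1) \<open>\<phi> c \<noteq> 0\<close> norm' nonzero']
  show ?thesis
  proof (rule that[OF M' _ torsion])
    show "size M' = size M" by (simp add: M'_def)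
    assume *: "\<forall>P\<in>#M'. hyp_inv P = P"
    show "\<forall>P\<in>#M. hyp_inv P = P"
    proof
      fix P assume P: "P \<in># M"
      then obtain a b where ab': "P = Affine a b"
        using M_affine by blast
      have "hyp_inv (map_curve_point \<phi> P) = map_curve_point \<phi> P"
        using * P by (simp add: M'_def)
      then have "- \<phi> b = \<phi> b"
        using ab' by simp
      then have "\<phi> b = 0"
        using uminus_neq(1) by blast
      \<comment> \<open>The \<open>y\<close>-coordinates belong to \<open>E\<close> for this
        purpose: a point is fixed exactly when its \<open>y\<close>-coordinate is 0, so a non-fixed
        point of \<open>M\<close> stays non-fixed.\<close>
      moreover have "b \<in> E"
        using P ab' unfolding E_def by (intro insertI2 UnI1 UnI2 UN_I[of P]) auto
      ultimately show "hyp_inv P = P"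
        using \<phi>(3)[of b] ab' by auto
    qed
  qed
qed

end

subsection \<open>Galois conjugates\<close>

lemma GalD:
  assumes "\<sigma> \<in> Gal K0"
  shows "x \<in> closure_in K0 \<Longrightarrow> \<sigma> x \<in> closure_in K0"
    "x \<in> closure_in K0 \<Longrightarrow> y \<in> closure_in K0 \<Longrightarrow> \<sigma> (x + y) = \<sigma> x + \<sigma> y"
    "x \<in> closure_in K0 \<Longrightarrow> y \<in> closure_in K0 \<Longrightarrow> \<sigma> (x * y) = \<sigma> x * \<sigma> y"
    "c \<in> K0 \<Longrightarrow> \<sigma> c = c" "inj_on \<sigma> (closure_in K0)"
  using assms
  by (auto simp: Gal_def ring_iso_def ring_hom_def ring_of_type_algebra_def bij_betw_def)

locale hyperelliptic_over = hyperelliptic f for f :: "'a::alg_closed_field poly" +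
  fixes K0 :: "'a set"
  assumes subfield: "subfield K0 ring_of_type_algebra"
    and coeffs: "coeffs_in K0 f"
begin

abbreviation L :: "'a set" where "L \<equiv> closure_in K0"

sublocale L: alg_closed_subfield L
  by (rule alg_closed_subfield_closure_in[OF subfield])

lemma K0_subset: "K0 \<subseteq> L"
  by (rule closure_in_superset[OF subfield])

lemma zero_K0: "0 \<in> K0"
  using subringE(2)[OF subfieldE(1)[OF subfield]] by (simp add: ring_of_type_algebra_simps)

lemma coeffs_in_L: "coeffs_in L f"
  using coeffs K0_subset by (auto simp: coeffs_in_def)

context
  fixes \<sigma> assumes \<sigma>: "\<sigma> \<in> Gal K0"
begin

lemma Gal_zero: "\<sigma> 0 = 0"
  by (rule GalD(4)[OF \<sigma> zero_K0])

lemma Gal_uminus: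
  assumes "x \<in> L"
  shows "\<sigma> (- x) = - \<sigma> x"
  using GalD(2)[OF \<sigma> assms L.uminus_mem[OF assms]] by (simp add: Gal_zero eq_neg_iff_add_eq_0 add.commute)

lemma Gal_poly: "coeffs_in K0 p \<Longrightarrow> a \<in> L \<Longrightarrow> \<sigma> (poly p a) = poly p (\<sigma> a)"
proof (induction p)
  case (pCons c p)
  have c: "c \<in> K0" and p: "coeffs_in K0 p"
    using pCons.prems(1) unfolding coeffs_in_def by (metis coeff_pCons_0, metis coeff_pCons_Suc)
  then have "coeffs_in L p"
    using K0_subset by (auto simp: coeffs_in_def)
  then have "poly p a \<in> L" "c \<in> L"
    using L.poly_mem pCons.prems(2) c K0_subset by auto
  then show ?case
    using pCons p c by (simp add: GalD[OF \<sigma>] L.mult_mem)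
qed (simp add: Gal_zero)

lemma Gal_curve:
  assumes "P \<in> curve_over L f"
  shows "map_curve_point \<sigma> P \<in> curve_over L f"
    "hyp_inv (map_curve_point \<sigma> P) = map_curve_point \<sigma> (hyp_inv P)"
proof -
  have "\<sigma> b ^ 2 = poly f (\<sigma> a)" if "a \<in> L" "b \<in> L" "b ^ 2 = poly f a" for a b
    using Gal_poly[OF coeffs that(1)] GalD(3)[OF \<sigma> that(2,2)] that(3) by (simp add: power2_eq_square)
  then show "map_curve_point \<sigma> P \<in> curve_over L f"
    using assms GalD(1)[OF \<sigma>] by (cases P) (auto simp: curve_over_def curve_def)
  show "hyp_inv (map_curve_point \<sigma> P) = map_curve_point \<sigma> (hyp_inv P)"
    using assms Gal_uminus by (cases P) (auto simp: curve_over_def)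
qed

lemma Gal_inj: "inj_on (map_curve_point \<sigma>) (curve_over L f)"
proof (rule inj_onI)
  fix P Q assume "P \<in> curve_over L f" "Q \<in> curve_over L f" "map_curve_point \<sigma> P = map_curve_point \<sigma> Q"
  then show "P = Q"
    using inj_onD[OF GalD(5)[OF \<sigma>]] by (cases P; cases Q) (auto simp: curve_over_def)
qed

text \<open>\<open>Gal_act\<close> is a union over representatives of the class. The class of the
  image of \<open>D\<close> is one of its members, so this image lies in any class that equals the
  union.\<close>

lemma Gal_act_divisor_class:
  assumes "Poly_Mapping.keys D \<subseteq> curve_over L f" "Gal_act K0 f \<sigma> (divisor_class f D) = divisor_class f E"
  shows "principal (frag_extend (\<lambda>P. frag_of (map_curve_point \<sigma> P)) D - E)"
proof -
  let ?D = "frag_extend (\<lambda>P. frag_of (map_curve_point \<sigma> P)) D"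
  have "?D \<in> divisor_class f ?D" "D \<in> divisor_class f D"
    using principal_0 by (simp_all add: mem_divisor_class)
  then have "?D \<in> Gal_act K0 f \<sigma> (divisor_class f D)"
    using assms(1) unfolding Gal_act_def by blast
  then show ?thesis
    using assms(2) by (simp add: mem_divisor_class)
qed

end

lemma frag_extend_eff:
  "frag_extend (\<lambda>P. frag_of (map_curve_point \<sigma> P)) (eff M) = eff (image_mset (map_curve_point \<sigma>) M)"
  by (induction M) (auto simp: frag_extend_add frag_extend_diff)

lemma keys_frag_cmul_eff:
  assumes "set_mset M \<subseteq> curve_over L f"
  shows "Poly_Mapping.keys (frag_cmul u (eff M)) \<subseteq> curve_over L f"
proof -
  have "Infinity \<in> curve_over L f"
    by (simp add: curve_over_def)
  then show ?thesis
    using assms by (intro order_trans[OF keys_cmul] order_trans[OF keys_eff]) simp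
qed

lemma Gal_act_eff:
  assumes "\<sigma> \<in> Gal K0" "set_mset M \<subseteq> curve_over L f"
    "Gal_act K0 f \<sigma> (divisor_class f (frag_cmul u (eff M))) = divisor_class f E"
  shows "principal (frag_cmul u (eff (image_mset (map_curve_point \<sigma>) M)) - E)"
proof -
  from Gal_act_divisor_class[OF assms(1) keys_frag_cmul_eff[OF assms(2)] assms(3)] show ?thesis
    by (simp add: frag_extend_cmul frag_extend_eff)
qed

lemma eff_Jac_over:
  assumes "set_mset M \<subseteq> curve_over L f"
  shows "divisor_class f (frag_cmul u (eff M)) \<in> Jac_over L f"
proof -
  have "frag_cmul u (eff M) \<in> carrier (Div0 f)"
    using assms by (intro Div0_closed(3) eff_carrier) (auto simp: curve_over_def)
  then show ?thesis
    unfolding Jac_over_def using keys_frag_cmul_eff[OF assms] by blast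
qed

text \<open>
  The divisor in question is symmetric, and comparing its coefficients at \<open>q\<close> and \<open>hyp_inv q\<close>, where \<open>q\<close>
  is a point of maximal multiplicity among those of \<open>M\<close> that are not fixed by \<open>hyp_inv\<close>, shows that
  at least \<open>m\<close> conjugates are needed to compensate \<open>m M\<close>.
\<close>

lemma conjugates_imp_fixed:
  assumes M: "set_mset M \<subseteq> curve_over L f - {Infinity}" "semireduced M"
    and S: "set S \<subseteq> Gal K0" "length S < m" "(length S + m) * size M \<le> 2 * genus f"
    and rel: "principal ((\<Sum>\<sigma>\<leftarrow>S. eff (image_mset (map_curve_point \<sigma>) M)) - frag_cmul (int m) (eff M))"
  shows "\<forall>P\<in>#M. hyp_inv P = P"
proof (rule ccontr)
  define W where "W = {P. P \<in># M \<and> hyp_inv P \<noteq> P}"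
  assume "\<not> (\<forall>P\<in>#M. hyp_inv P = P)"
  then have "finite W" "W \<noteq> {}" by (auto simp: W_def)
  then have "Max (count M ` W) \<in> count M ` W" by (intro Max_in) auto
  then obtain q where "q \<in> W" "count M q = Max (count M ` W)" by auto
  then have q: "q \<in> W" "\<And>p. p \<in> W \<Longrightarrow> count M p \<le> count M q"
    using \<open>finite W\<close> by simp_all
  have curve: "set_mset M \<subseteq> curve f" "set_mset M \<subseteq> curve_over L f"
    using M by (auto simp: curve_over_def)
  \<comment> \<open>Replacing \<open>- m M\<close> by \<open>m\<close> times the conjugate divisor
    makes the relation effective, at the price of degree
    \<open>(length S + m) * size M\<close>.\<close>
  define T where "T = (\<Sum>\<sigma>\<leftarrow>S. image_mset (map_curve_point \<sigma>) M) + repeat_mset m (image_mset hyp_inv M)"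
  have "eff (\<Sum>\<sigma>\<leftarrow>S. image_mset (map_curve_point \<sigma>) M) = (\<Sum>\<sigma>\<leftarrow>S. eff (image_mset (map_curve_point \<sigma>) M))"
    by (induction S) auto
  then have "eff T = ((\<Sum>\<sigma>\<leftarrow>S. eff (image_mset (map_curve_point \<sigma>) M)) - frag_cmul (int m) (eff M)) +
      frag_cmul (int m) (eff (M + image_mset hyp_inv M))"
    by (simp add: T_def frag_cmul_distrib2 frag_cmul_eff)
  then have "principal (eff T)"
    using principal_add[OF rel principal_frag_cmul[OF principal_eff_hyp_inv[OF curve(1)]]] by simp
  moreover have "size (\<Sum>\<sigma>\<leftarrow>S. image_mset (map_curve_point \<sigma>) M) = length S * size M"
    by (induction S) auto
  then have "size T \<le> 2 * genus f"
    using S(3) by (simp add: T_def size_repeat_mset distrib_right)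
  moreover have "count (\<Sum>\<sigma>\<leftarrow>S. image_mset (map_curve_point \<sigma>) M) P =
      (\<Sum>\<sigma>\<leftarrow>S. count (image_mset (map_curve_point \<sigma>) M) P)" for P
    by (induction S) auto
  moreover have "count (image_mset hyp_inv M) P = count M (hyp_inv P)" for P
    by (induction M) auto
  ultimately have T: "count T P = (\<Sum>\<sigma>\<leftarrow>S. count (image_mset (map_curve_point \<sigma>) M) P) + m * count M (hyp_inv P)"
    "principal (eff T)" "size T \<le> 2 * genus f" for P
    by (simp_all add: T_def)
  have q': "q \<in># M" "q \<in> curve f" "q \<noteq> Infinity" "hyp_inv q \<noteq> q" "hyp_inv q \<notin># M"
    using q(1) M curve(1) by (auto simp: W_def semireduced_def)
  have "int (count T (hyp_inv q)) = int (count T q)"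
    using small_principal_symmetric[OF T(2) _ _ q'(2)] T(3) q'(3) by (simp add: lookup_eff)
  then have "count T (hyp_inv q) = count T q" by simp
  moreover have "count M (hyp_inv q) = 0" using q'(5) by (simp add: not_in_iff)
  \<comment> \<open>At \<open>hyp_inv q\<close> the part \<open>m * count M q\<close> of
    \<open>T\<close> is visible; at \<open>q\<close> only the Galois conjugates contribute, since
    \<open>hyp_inv q\<close> is not in \<open>M\<close>.\<close>
  ultimately have "m * count M q \<le> (\<Sum>\<sigma>\<leftarrow>S. count (image_mset (map_curve_point \<sigma>) M) q)"
    unfolding T(1) by (simp only: hyp_inv_hyp_inv)
  also have "\<dots> \<le> (\<Sum>\<sigma>\<leftarrow>S. count M q)"
  proof (rule sum_list_mono)
    fix \<sigma> assume "\<sigma> \<in> set S"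
    then have \<sigma>: "\<sigma> \<in> Gal K0" using S(1) by blast
    \<comment> \<open>By injectivity at most one point of \<open>M\<close> is sent to
      \<open>q\<close>. It is not fixed because \<open>\<sigma>\<close> commutes with
      \<open>hyp_inv\<close>, so the maximality of \<open>q\<close> bounds its multiplicity.\<close>
    let ?A = "map_curve_point \<sigma> -` {q} \<inter> set_mset M"
    show "count (image_mset (map_curve_point \<sigma>) M) q \<le> count M q"
    proof (cases "?A = {}")
      case True
      then show ?thesis by (simp add: count_image_mset)
    next
      case False
      then obtain p where p: "p \<in># M" "map_curve_point \<sigma> p = q" by auto
      then have "?A = {p}"
        using inj_onD[OF Gal_inj[OF \<sigma>]] curve(2) by blast
      moreover have "p \<in> W"
        using p q'(4) Gal_curve(2)[OF \<sigma>, of p] curve(2) by (auto simp: W_def)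
      ultimately show ?thesis
        using q(2) by (simp add: count_image_mset)
    qed
  qed
  also have "\<dots> = length S * count M q"
    by (simp add: sum_list_triv)
  finally have "m \<le> length S"
    using q'(1) by simp
  then show False using S(2) by simp
qed

text \<open>The common frame of the three cases. \<open>conj\<close> ranges over all multisets over
  \<open>L\<close> whose class is killed by \<open>n\<close>, because the specialized
  \<open>M'\<close> is known only by this property; the fixedness of its points is then pulled back
  to \<open>M\<close>.\<close>

lemma Theta_torsion:
  assumes "a \<in> Theta f d" "n > 0" "a [^]\<^bsub>Jac f\<^esub> (n::nat) = \<one>\<^bsub>Jac f\<^esub>"
    and conj: "\<And>M. set_mset M \<subseteq> curve_over L f \<Longrightarrow> principal (frag_cmul (int n) (eff M)) \<Longrightarrow>
      \<exists>S m. set S \<subseteq> Gal K0 \<and> length S < m \<and> (length S + m) * d \<le> 2 * genus f \<and>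
        principal ((\<Sum>\<sigma>\<leftarrow>S. eff (image_mset (map_curve_point \<sigma>) M)) - frag_cmul (int m) (eff M))"
  shows "group.ord (Jac f) a dvd 2"
proof -
  obtain M where M: "set_mset M \<subseteq> curve f - {Infinity}" "size M \<le> d" "semireduced M" "a = divisor_class f (eff M)"
    using Theta_semireduced[OF assms(1)] by metis
  have M_curve: "set_mset M \<subseteq> curve f" using M(1) by blast
  have "principal (frag_cmul (int n) (eff M))"
    using assms(3) by (simp add: M(4) pow_Jac one_Jac divisor_class_eq_iff)
  then obtain M' where M': "set_mset M' \<subseteq> curve_over L f - {Infinity}" "size M' = size M" "semireduced M'"
    "principal (frag_cmul (int n) (eff M'))"
    "\<forall>P\<in>#M'. hyp_inv P = P \<Longrightarrow> \<forall>P\<in>#M. hyp_inv P = P"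
    using torsion_specialization[OF L.alg_closed_subfield_axioms coeffs_in_L M(1,3) assms(2)] by metis
  have "set_mset M' \<subseteq> curve_over L f" using M'(1) by blast
  from conj[OF this M'(4)] obtain S m where S: "set S \<subseteq> Gal K0" "length S < m" "(length S + m) * d \<le> 2 * genus f"
    "principal ((\<Sum>\<sigma>\<leftarrow>S. eff (image_mset (map_curve_point \<sigma>) M')) - frag_cmul (int m) (eff M'))"
    by blast
  have "(length S + m) * size M' \<le> 2 * genus f"
    using order_trans[OF mult_le_mono2[of "size M'" d] S(3)] M(2) M'(2) by simp
  from M'(5)[OF conjugates_imp_fixed[OF M'(1,3) S(1,2) this S(4)]] show ?thesis
    using two_torsion[OF M_curve] ord_dvd_iff[OF eff_carrier[OF M_curve], of 2] M(4) by simp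
qed

section \<open>The three Galois properties\<close>

lemma Theta_M3:
  assumes "property_M3 K0 f" "a \<in> Theta f d" "4 * d \<le> 2 * genus f" "a \<in> carrier (Jac f)"
    "group.ord (Jac f) a = 2 ^ k"
  shows "group.ord (Jac f) a dvd 2"
proof (rule Theta_torsion[OF assms(2)])
  show "a [^]\<^bsub>Jac f\<^esub> ((2::nat) ^ k) = \<one>\<^bsub>Jac f\<^esub>"
    using Jac.pow_ord_eq_1[OF assms(4)] assms(5) by simp
next
  fix M assume M: "set_mset M \<subseteq> curve_over L f" "principal (frag_cmul (int (2 ^ k)) (eff M))"
  have D: "eff M \<in> carrier (Div0 f)"
    using M(1) by (intro eff_carrier) (auto simp: curve_over_def)
  \<comment> \<open>The order of the specialized class need not equal that of \<open>a\<close>, but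
    a divisor of a power of 2 is again one, which is all that (M3) asks for.\<close>
  have "group.ord (Jac f) (divisor_class f (eff M)) dvd 2 ^ k"
    using ord_dvd_iff[OF D] M(2) by blast
  then have "\<exists>k. group.ord (Jac f) (divisor_class f (eff M)) = 2 ^ k"
    using divides_primepow_nat[OF two_is_prime_nat] by blast
  then obtain \<sigma> where \<sigma>: "\<sigma> \<in> Gal K0"
    "Gal_act K0 f \<sigma> (divisor_class f (eff M)) = divisor_class f (eff M) [^]\<^bsub>Jac f\<^esub> (3::nat)"
    using assms(1) eff_Jac_over[OF M(1), of 1] by (auto simp: property_M3_def)
  have "principal (eff (image_mset (map_curve_point \<sigma>) M) - frag_cmul 3 (eff M))"
    using Gal_act_eff[OF \<sigma>(1) M(1), of 1] \<sigma>(2) by (simp add: pow_Jac)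
  then show "\<exists>S m. set S \<subseteq> Gal K0 \<and> length S < m \<and> (length S + m) * d \<le> 2 * genus f \<and>
        principal ((\<Sum>\<sigma>\<leftarrow>S. eff (image_mset (map_curve_point \<sigma>) M)) - frag_cmul (int m) (eff M))"
    \<comment> \<open>One conjugate against \<open>m = 3\<close>, whence the factor 4 in the bound
      on \<open>d\<close>.\<close>
    using \<sigma>(1) assms(3) by (intro exI[of _ "[\<sigma>]"] exI[of _ 3]) simp
qed simp

lemma Theta_M2:
  assumes "property_M2 K0 f" "b \<in> Theta f d" "3 * d \<le> 2 * genus f" "b \<in> carrier (Jac f)"
    "odd (group.ord (Jac f) b)"
  shows "b = \<one>\<^bsub>Jac f\<^esub>"
proof -
  let ?n = "group.ord (Jac f) b"
  have "?n dvd 2"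
  proof (rule Theta_torsion[OF assms(2)])
    show "?n > 0" using assms(5) by (rule odd_pos)
    show "b [^]\<^bsub>Jac f\<^esub> ?n = \<one>\<^bsub>Jac f\<^esub>"
      using Jac.pow_ord_eq_1[OF assms(4)] .
  next
    fix M assume M: "set_mset M \<subseteq> curve_over L f" "principal (frag_cmul (int ?n) (eff M))"
    have D: "eff M \<in> carrier (Div0 f)"
      using M(1) by (intro eff_carrier) (auto simp: curve_over_def)
    have "group.ord (Jac f) (divisor_class f (eff M)) dvd ?n"
      using ord_dvd_iff[OF D] M(2) by blast
    then have "odd (group.ord (Jac f) (divisor_class f (eff M)))"
      using assms(5) dvd_trans by blast
    then obtain \<sigma> where \<sigma>: "\<sigma> \<in> Gal K0"
      "Gal_act K0 f \<sigma> (divisor_class f (eff M)) = divisor_class f (eff M) [^]\<^bsub>Jac f\<^esub> (2::nat)"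
      using assms(1) eff_Jac_over[OF M(1), of 1] by (auto simp: property_M2_def)
    have "principal (eff (image_mset (map_curve_point \<sigma>) M) - frag_cmul 2 (eff M))"
      using Gal_act_eff[OF \<sigma>(1) M(1), of 1] \<sigma>(2) by (simp add: pow_Jac)
    then show "\<exists>S m. set S \<subseteq> Gal K0 \<and> length S < m \<and> (length S + m) * d \<le> 2 * genus f \<and>
          principal ((\<Sum>\<sigma>\<leftarrow>S. eff (image_mset (map_curve_point \<sigma>) M)) - frag_cmul (int m) (eff M))"
      using \<sigma>(1) assms(3) by (intro exI[of _ "[\<sigma>]"] exI[of _ 2]) simp
  qed
  then have "?n = 1"
    using assms(5) prime_nat_iff two_is_prime_nat by (metis dvd_refl)
  then show ?thesis
    using Jac.ord_eq_1[OF assms(4)] by simp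
qed

text \<open>
  A class \<open>c\<close> of order \<open>2\<^sup>k r\<close> with \<open>r\<close> odd is the sum of its \<open>2\<close>-primary part \<open>u c\<close> and its odd part
  \<open>w c\<close>, where \<open>u + w = 1\<close> holds in the integers. Then \<open>\<sigma>\<^sub>1 c + \<sigma>\<^sub>2 c = 4 c\<close>.
\<close>

lemma Theta_M:
  assumes "property_M K0 f" "c \<in> Theta f d" "6 * d \<le> 2 * genus f" "torsion (Jac f) c"
  shows "group.ord (Jac f) c dvd 2"
proof -
  obtain n :: nat where n: "n > 0" "c [^]\<^bsub>Jac f\<^esub> n = \<one>\<^bsub>Jac f\<^esub>"
    using assms(4) by (auto simp: torsion_def)
  define k where "k = multiplicity 2 n"
  obtain r where r: "n = 2 ^ k * r" "odd r"
    using multiplicity_decompose'[of n 2] n(1) unfolding k_def by auto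
  have "coprime (int r) (2 ^ k)"
    using r(2) by simp
  then obtain x y where "x * int r + y * 2 ^ k = 1"
    using bezout_int[of "int r" "2 ^ k"] by auto
  define u where "u = x * int r"
  define w where "w = y * 2 ^ k"
  have uw: "u + w = 1"
    using \<open>x * int r + y * 2 ^ k = 1\<close> by (simp add: u_def w_def)
  show ?thesis
  proof (rule Theta_torsion[OF assms(2) n])
    fix M assume M: "set_mset M \<subseteq> curve_over L f" "principal (frag_cmul (int n) (eff M))"
    have D: "frag_cmul v (eff M) \<in> carrier (Div0 f)" for v
      using M(1) by (intro Div0_closed(3) eff_carrier) (auto simp: curve_over_def)
    \<comment> \<open>Since \<open>n = 2^k r\<close>, the products \<open>2^k u\<close> and
      \<open>r w\<close> are the multiples \<open>x n\<close> and \<open>y n\<close> of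
      \<open>n\<close>; so \<open>u\<close> and \<open>w\<close> cut out the 2-primary and the odd
      part.\<close>
    have "frag_cmul (int (2 ^ k)) (frag_cmul u (eff M)) = frag_cmul x (frag_cmul (int n) (eff M))"
      "frag_cmul (int r) (frag_cmul w (eff M)) = frag_cmul y (frag_cmul (int n) (eff M))"
      by (simp_all add: r(1) u_def w_def mult_ac)
    then have "principal (frag_cmul (int (2 ^ k)) (frag_cmul u (eff M)))"
      "principal (frag_cmul (int r) (frag_cmul w (eff M)))"
      using principal_frag_cmul[OF M(2)] by metis+
    then have "group.ord (Jac f) (divisor_class f (frag_cmul u (eff M))) dvd 2 ^ k"
      "group.ord (Jac f) (divisor_class f (frag_cmul w (eff M))) dvd r"
      using ord_dvd_iff[OF D] by blast+
    then have "\<exists>k. group.ord (Jac f) (divisor_class f (frag_cmul u (eff M))) = 2 ^ k"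
      "odd (group.ord (Jac f) (divisor_class f (frag_cmul w (eff M))))"
      using divides_primepow_nat[OF two_is_prime_nat] r(2) dvd_trans by blast+
    then obtain \<sigma>\<^sub>1 \<sigma>\<^sub>2 where \<sigma>: "\<sigma>\<^sub>1 \<in> Gal K0" "\<sigma>\<^sub>2 \<in> Gal K0"
      and act: "Gal_act K0 f \<sigma>\<^sub>1 (divisor_class f (frag_cmul u (eff M))) =
          inv\<^bsub>Jac f\<^esub> divisor_class f (frag_cmul u (eff M))"
        "Gal_act K0 f \<sigma>\<^sub>1 (divisor_class f (frag_cmul w (eff M))) =
          divisor_class f (frag_cmul w (eff M)) [^]\<^bsub>Jac f\<^esub> (2::nat)"
        "Gal_act K0 f \<sigma>\<^sub>2 (divisor_class f (frag_cmul u (eff M))) =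
          divisor_class f (frag_cmul u (eff M)) [^]\<^bsub>Jac f\<^esub> (5::nat)"
        "Gal_act K0 f \<sigma>\<^sub>2 (divisor_class f (frag_cmul w (eff M))) =
          divisor_class f (frag_cmul w (eff M)) [^]\<^bsub>Jac f\<^esub> (2::nat)"
      using assms(1) eff_Jac_over[OF M(1)] unfolding property_M_def by meson
    define D1 where "D1 = eff (image_mset (map_curve_point \<sigma>\<^sub>1) M)"
    define D2 where "D2 = eff (image_mset (map_curve_point \<sigma>\<^sub>2) M)"
    have rels: "principal (frag_cmul u D1 - frag_cmul (- u) (eff M))"
      "principal (frag_cmul w D1 - frag_cmul (2 * w) (eff M))"
      "principal (frag_cmul u D2 - frag_cmul (5 * u) (eff M))"
      "principal (frag_cmul w D2 - frag_cmul (2 * w) (eff M))"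
      unfolding D1_def D2_def
      by (rule Gal_act_eff; use \<sigma> M(1) act in \<open>simp add: pow_Jac inv_Jac D\<close>)+
    have split: "D1 = frag_cmul u D1 + frag_cmul w D1" "D2 = frag_cmul u D2 + frag_cmul w D2"
      by (simp_all add: uw flip: frag_cmul_distrib)
    \<comment> \<open>The multipliers of the two automorphisms sum to \<open>-1 + 5\<close> on the
      2-primary part and to \<open>2 + 2\<close> on the odd part. Both are 4, so the two relations
      combine to one for the whole class.\<close>
    have "4 = - u + 2 * w + 5 * u + 2 * w"
      using uw by simp
    then have four: "frag_cmul 4 (eff M) = frag_cmul (- u) (eff M) + frag_cmul (2 * w) (eff M) +
        frag_cmul (5 * u) (eff M) + frag_cmul (2 * w) (eff M)"
      by (metis frag_cmul_distrib)
    have "principal (D1 + D2 - frag_cmul 4 (eff M))"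
      using principal_add[OF principal_add[OF rels(1,2)] principal_add[OF rels(3,4)]]
      unfolding four by (subst split(1), subst split(2)) (simp add: algebra_simps)
    then show "\<exists>S m. set S \<subseteq> Gal K0 \<and> length S < m \<and> (length S + m) * d \<le> 2 * genus f \<and>
        principal ((\<Sum>\<sigma>\<leftarrow>S. eff (image_mset (map_curve_point \<sigma>) M)) - frag_cmul (int m) (eff M))"
      using \<sigma> assms(3) by (intro exI[of _ "[\<sigma>\<^sub>1, \<sigma>\<^sub>2]"] exI[of _ 4]) (simp add: D1_def D2_def)
  qed
qed

end

lemma dvd_2_iff: "(n::nat) dvd 2 \<longleftrightarrow> n = 1 \<or> n = 2"
  using two_is_prime_nat[unfolded prime_nat_iff] by auto

lemma hyperelliptic_prod:
  fixes \<alpha> :: "nat \<Rightarrow> 'a::alg_closed_field"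
  assumes "CHAR('a) \<noteq> 2" "inj_on \<alpha> {1..2 * g + 1}" "f = (\<Prod>i = 1..2 * g + 1. [:- \<alpha> i, 1:])"
  shows "hyperelliptic f" "genus f = g"
proof -
  have deg: "degree f = 2 * g + 1"
    unfolding assms(3) by (subst degree_prod_sum_eq) auto
  then show "genus f = g" by (simp add: genus_def)
  show "hyperelliptic f"
  proof
    show "odd (degree f)" using deg by simp
    show "(2 :: 'a) \<noteq> 0"
    proof
      assume "(2 :: 'a) = 0"
      then have "CHAR('a) dvd 2"
        using of_nat_eq_0_iff_char_dvd[of 2, where ?'a = 'a] by simp
      then have "CHAR('a) = 1"
        using assms(1) by (simp add: dvd_2_iff)
      then show False
        using CHAR_not_1'[where ?'a = 'a] by simp
    qed
    fix a assume "poly f a = 0"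
    then obtain i where "i \<in> {1..2 * g + 1}" "poly [:- \<alpha> i, 1:] a = 0"
      unfolding assms(3) poly_prod prod_zero_iff[OF finite_atLeastAtMost] by blast
    then have i: "i \<in> {1..2 * g + 1}" "a = \<alpha> i"
      by simp_all
    have "f = [:- a, 1:] * (\<Prod>j\<in>{1..2 * g + 1} - {i}. [:- \<alpha> j, 1:])"
      unfolding assms(3) i(2) by (rule prod.remove[OF _ i(1)]) simp
    moreover have "\<alpha> i - \<alpha> j \<noteq> 0" if "j \<in> {1..2 * g + 1} - {i}" for j
      using inj_onD[OF assms(2), of i j] i(1) that by auto
    then have "poly (\<Prod>j\<in>{1..2 * g + 1} - {i}. [:- \<alpha> j, 1:]) a \<noteq> 0"
      unfolding poly_prod i(2) by (subst prod_zero_iff) auto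
    ultimately show "\<exists>f1. f = [:- a, 1:] * f1 \<and> poly f1 a \<noteq> 0" by blast
  qed
qed

theorem theorem2p14:
  fixes \<alpha> :: "nat \<Rightarrow> 'a::alg_closed_field" and g :: nat and f :: "'a poly" and K0 :: "'a set"
  assumes "CHAR('a) \<noteq> 2"
    and "g \<ge> 1"
    and "inj_on \<alpha> {1..2 * g + 1}"
    and "f = (\<Prod>i = 1..2 * g + 1. [:- \<alpha> i, 1:])"
    and "subfield K0 ring_of_type_algebra"
    and "\<forall>i. coeff f i \<in> K0"
  shows
    "(g \<ge> 2 \<longrightarrow> property_M3 K0 f \<longrightarrow>
       (\<forall>a. torsion (Jac f) a \<longrightarrow> a \<in> Theta f (2 * g div 4) \<longrightarrow>
          (\<exists>k. group.ord (Jac f) a = 2 ^ k) \<longrightarrow>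
          group.ord (Jac f) a = 1 \<or> group.ord (Jac f) a = 2)) \<and>
     (g \<ge> 2 \<longrightarrow> property_M2 K0 f \<longrightarrow>
       (\<forall>b. torsion (Jac f) b \<longrightarrow> odd (group.ord (Jac f) b) \<longrightarrow> b \<in> Theta f (2 * g div 3) \<longrightarrow>
          b = \<one>\<^bsub>Jac f\<^esub>)) \<and>
     (g \<ge> 3 \<longrightarrow> property_M K0 f \<longrightarrow>
       (\<forall>c. torsion (Jac f) c \<longrightarrow> c \<in> Theta f (2 * g div 6) \<longrightarrow>
          group.ord (Jac f) c = 1 \<or> group.ord (Jac f) c = 2))"
proof -
  interpret hyperelliptic f
    by (rule hyperelliptic_prod(1)[OF assms(1,3,4)])
  interpret hyperelliptic_over f K0
    using assms(5,6)
    by (intro hyperelliptic_over.intro hyperelliptic_over_axioms.intro hyperelliptic_axioms)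
      (simp_all add: coeffs_in_def)
  have genus: "genus f = g"
    by (rule hyperelliptic_prod(2)[OF assms(1,3,4)])
  have "4 * (2 * g div 4) \<le> 2 * g" "3 * (2 * g div 3) \<le> 2 * g" "6 * (2 * g div 6) \<le> 2 * g"
    by simp_all
  then show ?thesis
    using Theta_M3 Theta_M2 Theta_M unfolding dvd_2_iff genus torsion_def by blast
qed

end
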